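(* Let $k\ge2$ and let $F_1,\dots,F_k$ be continuous cumulative distribution functions supported on $[0,1]$ which admit Lipschitz-continuous densities $f_i$ with Lipschitz constant $L$. Suppose we have access to $n$ independent partially observed samples $\{Z_j\}_{j=1}^n$ from the first-price auction with bid distributions $F_1,\dots,F_k$ (partial observation model). Then, given $p,\gamma\in[0,1]$ such that $\Pr(X_i\le p\ \text{for all } i\in[k])\ge\gamma$ (with $X_i\sim F_i$ independent), there exists a polynomial-time estimation algorithm that computes cumulative distribution functions $\hat F_i$, $i\in[k]$, so that for every $\varepsilon\in(0,\gamma/2]$ and $\delta\in(0,1)$ it holds that $$\Pr\left(\max_{x\in[p,1]}\big|\hat F_i(x)-F_i(x)\big|\le\varepsilon\right)\ \ge\ 1-\delta\qquad\text{for all } i\in[k],$$ assuming that $$n=\Theta\left(\frac{k}{\gamma^6\varepsilon^5}\,\log\left(\frac{k}{\gamma^2\varepsilon\,\delta}\right)\log\left(\frac{L}{\gamma^2\varepsilon}\right)\right).$$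
   Context: Notation: $[k]=\{1,\dots,k\}$. A cumulative distribution function (CDF) $F$ is supported on $[0,1]$ if $F(x)=0$ for all $x<0$ and $F(1)=1$. Partial observation model (first-price): for each sample, (1) the observer picks a price $r\in[0,1]$ (possibly depending on previous observations) and $X_{k+1}=r$ is set; (2) $X_i\sim F_i$ are drawn independently for $i\in[k]$, independently across samples; (3) the observer sees only the winner $Z=\arg\max_{i\in[k+1]}X_i$ (not the price paid). Order notation: the constant hidden in $\Theta$ is absolute (independent of the distributions and of all parameters), and "assuming $n=\Theta(f)$" means that there is an absolute constant $C$ such that $n=C f$ samples suffice. "Polynomial time" means polynomial in the number of samples. *)

theory Defs
  imports "HOL-Probability.Probability" "HOL-Computational_Algebra.Polynomial"
begin

section \<open>Bid distributions\<close>

definition is_cdf :: "(real \<Rightarrow> real) \<Rightarrow> bool" where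
  "is_cdf F \<longleftrightarrow> (\<exists>M. real_distribution M \<and> F = cdf M)"

definition supported_unit :: "(real \<Rightarrow> real) \<Rightarrow> bool" where
  "supported_unit F \<longleftrightarrow> (\<forall>x<0. F x = 0) \<and> F 1 = 1"

text \<open>
  Lipschitz continuity of the density is required on the support interval only, so that e.g. the
  uniform distribution is covered. A density that is Lipschitz on the whole line is a special case.
\<close>

definition lipschitz_density :: "real \<Rightarrow> (real \<Rightarrow> real) \<Rightarrow> bool" where
  "lipschitz_density L F \<longleftrightarrow>
     (\<exists>f. f \<in> borel_measurable borel \<and> (\<forall>x. 0 \<le> f x) \<and> L-lipschitz_on {0..1} f \<and>
          interval_measure F = density lborel (\<lambda>x. ennreal (f x)))"


section \<open>Partially observed first-price auctions\<close>

definition bid_law :: "nat \<Rightarrow> (nat \<Rightarrow> real \<Rightarrow> real) \<Rightarrow> (nat \<Rightarrow> real) measure" where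
  "bid_law k F = (\<Pi>\<^sub>M i\<in>{1..k}. interval_measure (F i))"

text \<open>In \<open>\<omega> \<in> space (sample_law n k F)\<close>, \<open>\<omega> j i\<close> is the bid of agent \<open>i\<close> in sample \<open>j\<close>.\<close>

definition sample_law :: "nat \<Rightarrow> nat \<Rightarrow> (nat \<Rightarrow> real \<Rightarrow> real) \<Rightarrow> (nat \<Rightarrow> nat \<Rightarrow> real) measure" where
  "sample_law n k F = (\<Pi>\<^sub>M j\<in>{..<n}. bid_law k F)"

text \<open>
  The price \<open>r\<close> takes part as bidder \<open>k + 1\<close>. Ties are broken arbitrarily (by the choice operator
  inside \<^const>\<open>arg_max_on\<close>); they have probability 0 for continuous distributions.
\<close>

definition winner :: "nat \<Rightarrow> (nat \<Rightarrow> real) \<Rightarrow> real \<Rightarrow> nat" where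
  "winner k X r = arg_max_on (X(k + 1 := r)) {1..k + 1}"


section \<open>Algorithms\<close>

text \<open>
  A while language over a real-number machine: natural-number registers, and arrays of reals
  addressed by computed indices. Real arithmetic and comparisons have unit cost, as is usual for a
  real RAM. There is no rounding, and natural numbers are not multiplied in one step. The only
  constants are natural numbers, so programs cannot carry non-uniform information.
\<close>

datatype nexp =
    NConst nat
  | NVar string
  | NPlus nexp nexp
  | NMinus nexp nexp

datatype rexp =
    OfNat nexp
  | Cell string nexp
  | RPlus rexp rexp
  | RMinus rexp rexp
  | RTimes rexp rexp
  | RDivide rexp rexp

datatype bexp =
    NLess nexp nexp
  | RLess rexp rexp
  | BNot bexp
  | BAnd bexp bexp

datatype com =
    SKIP
  | NAssign string nexp
  | RAssign string nexp rexp
  | Observe string rexp  \<comment> \<open>draw a new sample with the given price and store the winner\<close>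
  | Seq com com
  | Cond bexp com com
  | While bexp com

text \<open>The last component of a state is the number of samples drawn so far.\<close>

type_synonym nregs = "string \<Rightarrow> nat"
type_synonym arrays = "string \<Rightarrow> nat \<Rightarrow> real"
type_synonym state = "nregs \<times> arrays \<times> nat"

fun nval :: "nexp \<Rightarrow> nregs \<Rightarrow> nat" where
  "nval (NConst c) N = c"
| "nval (NVar x) N = N x"
| "nval (NPlus a b) N = nval a N + nval b N"
| "nval (NMinus a b) N = nval a N - nval b N"

fun rval :: "rexp \<Rightarrow> nregs \<Rightarrow> arrays \<Rightarrow> real" where
  "rval (OfNat a) N R = real (nval a N)"
| "rval (Cell x a) N R = R x (nval a N)"
| "rval (RPlus u v) N R = rval u N R + rval v N R"
| "rval (RMinus u v) N R = rval u N R - rval v N R"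
| "rval (RTimes u v) N R = rval u N R * rval v N R"
| "rval (RDivide u v) N R = rval u N R / rval v N R"

fun bval :: "bexp \<Rightarrow> nregs \<Rightarrow> arrays \<Rightarrow> bool" where
  "bval (NLess a b) N R \<longleftrightarrow> nval a N < nval b N"
| "bval (RLess u v) N R \<longleftrightarrow> rval u N R < rval v N R"
| "bval (BNot c) N R \<longleftrightarrow> \<not> bval c N R"
| "bval (BAnd c d) N R \<longleftrightarrow> bval c N R \<and> bval d N R"

text \<open>
  \<open>exec n Z c s t s'\<close>: with a budget of \<open>n\<close> samples, where \<open>Z j r\<close> is the winner of sample \<open>j\<close>
  when its price is \<open>r\<close>, the program \<open>c\<close> started in \<open>s\<close> terminates in \<open>s'\<close> after \<open>t\<close> steps.
  Executed commands and tests count one step each; expressions cost only a constant factor that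
  depends on the program. A run that exceeds the budget, observes one sample twice, or picks a
  price outside \<open>[0,1]\<close> is impossible, since no rule applies. The program sees of a sample nothing
  but the winner, and may choose the price depending on everything seen before.
\<close>

inductive exec ::
  "nat \<Rightarrow> (nat \<Rightarrow> real \<Rightarrow> nat) \<Rightarrow> com \<Rightarrow> state \<Rightarrow> nat \<Rightarrow> state \<Rightarrow> bool"
  for n :: nat and Z :: "nat \<Rightarrow> real \<Rightarrow> nat" where
  Skip: "exec n Z SKIP s 1 s"
| NAssign: "exec n Z (NAssign x a) (N, R, j) 1 (N(x := nval a N), R, j)"
| RAssign: "exec n Z (RAssign x a u) (N, R, j) 1
              (N, R(x := (R x)(nval a N := rval u N R)), j)"
| Observe: "j < n \<Longrightarrow> r = rval u N R \<Longrightarrow> 0 \<le> r \<Longrightarrow> r \<le> 1 \<Longrightarrow>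
              exec n Z (Observe x u) (N, R, j) 1 (N(x := Z j r), R, Suc j)"
| Seq: "exec n Z c s t s' \<Longrightarrow> exec n Z d s' t' s'' \<Longrightarrow> exec n Z (Seq c d) s (t + t') s''"
| CondTrue: "bval b N R \<Longrightarrow> exec n Z c (N, R, j) t s' \<Longrightarrow>
              exec n Z (Cond b c d) (N, R, j) (t + 1) s'"
| CondFalse: "\<not> bval b N R \<Longrightarrow> exec n Z d (N, R, j) t s' \<Longrightarrow>
              exec n Z (Cond b c d) (N, R, j) (t + 1) s'"
| WhileFalse: "\<not> bval b N R \<Longrightarrow> exec n Z (While b c) (N, R, j) 1 (N, R, j)"
| WhileTrue: "bval b N R \<Longrightarrow> exec n Z c (N, R, j) t s' \<Longrightarrow> exec n Z (While b c) s' t' s'' \<Longrightarrow>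
              exec n Z (While b c) (N, R, j) (t + t' + 1) s''"

text \<open>Scalar real inputs are stored at index 0 of the array of their name.\<close>

definition input_state :: "nat \<Rightarrow> nat \<Rightarrow> real \<Rightarrow> real \<Rightarrow> real \<Rightarrow> state" where
  "input_state k n L p \<gamma> =
     ((\<lambda>_. 0)(''k'' := k, ''n'' := n),
      (\<lambda>_ _. 0)(''L'' := (\<lambda>_. 0)(0 := L), ''p'' := (\<lambda>_. 0)(0 := p), ''gamma'' := (\<lambda>_. 0)(0 := \<gamma>)),
      0)"

text \<open>
  The output is a table: register \<open>m\<close> is the number of breakpoints, \<open>x[0], \<dots>, x[m-1]\<close> are the
  breakpoints, and \<open>y[i*m], \<dots>, y[i*m+m-1]\<close> are the values at them for agent \<open>i\<close>. It stands for the
  nondecreasing step functions given by the largest value (at least 0) at a breakpoint not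
  exceeding the argument.
\<close>

definition output_fun :: "state \<Rightarrow> nat \<Rightarrow> real \<Rightarrow> real" where
  "output_fun s i z = (case s of (N, R, j) \<Rightarrow>
     Max (insert 0 {R ''y'' (i * N ''m'' + l) |l. l < N ''m'' \<and> R ''x'' l \<le> z}))"

text \<open>
  \<open>computes_cdfs c T n k L p \<gamma> \<omega> G\<close>: on the samples \<open>\<omega>\<close>, the program \<open>c\<close> outputs the functions
  \<open>G i\<close> for \<open>i \<in> {1..k}\<close> within \<open>T\<close> steps, and these are distribution functions.
\<close>

definition computes_cdfs ::
  "com \<Rightarrow> nat \<Rightarrow> nat \<Rightarrow> nat \<Rightarrow> real \<Rightarrow> real \<Rightarrow> real \<Rightarrow> (nat \<Rightarrow> nat \<Rightarrow> real) \<Rightarrow> (nat \<Rightarrow> real \<Rightarrow> real) \<Rightarrow> bool"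
  where
  "computes_cdfs c T n k L p \<gamma> \<omega> G \<longleftrightarrow>
     (\<exists>t s. exec n (\<lambda>j. winner k (\<omega> j)) c (input_state k n L p \<gamma>) t s \<and> t \<le> T \<and>
            (\<forall>i\<in>{1..k}. G i = output_fun s i \<and> is_cdf (G i)))"


section \<open>Sample size\<close>

text \<open>
  The last factor is bounded below by 1, the usual reading of a logarithm in an order bound. This
  matters only for \<open>L < e \<gamma>\<^sup>2 \<epsilon>\<close>, where the logarithm may vanish or be negative. It never matters if
  the densities are Lipschitz on the whole line: then \<open>L \<ge> 4\<close>, while \<open>\<gamma>\<^sup>2 \<epsilon> \<le> 1/2\<close>.
\<close>

definition sample_bound :: "nat \<Rightarrow> real \<Rightarrow> real \<Rightarrow> real \<Rightarrow> real \<Rightarrow> real" where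
  "sample_bound k L \<gamma> \<epsilon> \<delta> =
     real k / (\<gamma> ^ 6 * \<epsilon> ^ 5) * ln (real k / (\<gamma>\<^sup>2 * \<epsilon> * \<delta>)) * max 1 (ln (L / (\<gamma>\<^sup>2 * \<epsilon>)))"

end

(*
The distribution functions are recovered from H(r) = P(all bids are at most r), the product of the
F i, and G i (r) = P(agent i wins at price r). On an interval (a, b] the increment of ln (F i) lies
between (G i a - G i b) / H b and (G i a - G i b) / H a. Hence it suffices to know G i at the points
where H takes the values 1, 1 - 1/M, 1 - 2/M, ..., and to know these points.

Each quantile of H is located by a noisy binary search with one sample per step. A measure on [0,1]
is tilted towards the side on which the quantile is likely to be, and the next price is its median.
The tilts preserve the total mass, so the median is found by inverting them one by one. The inverse
of the mass of a short interval around the quantile is the potential of a supermartingale. It follows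
that most prices are close to the quantile, so their median is, too. The same samples estimate G i.
Unlike a binary search with repeated tests, this needs no union bound over log L steps, which would
cost a factor log log L.

The program knows neither \<epsilon> nor \<delta>. It therefore works on the scales M, 2 M, 4 M, ..., and spends
geometrically fewer samples on finer ones. An estimate on scale M confines F i z to a half-line. The
result is obtained by projecting onto these half-lines, the coarsest scale last: once the estimates
down to some scale are correct, the errors of finer scales do no harm.
*)

theory Submission
  imports Defs
begin

text \<open>Each share of wins has an error of order 1/M, and there are about M of them, so adding
  up the estimated increments of \<open>ln (F i)\<close> term by term would give an error of order
  1. But neighbouring increments share an estimate, with opposite signs. Summation by parts against
  the weights 1/H leaves the last error and differences of 1/H, altogether O(1/(M \<gamma>)). So
  accuracy \<epsilon> asks for M of order 1/(\<gamma> \<epsilon>) and, up to a logarithm, for M^2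
  samples per threshold.

  The coarsest scale has M of order 1/\<gamma>. The scale M 2^s gets n/(2 M 4^s) samples for each of
  at most M 2^s thresholds, so all scales together fit into n. Requiring (M 2^s)^2 samples at 2^s of
  order 1/\<epsilon> gives n of order \<gamma>^-3 \<epsilon>^-4 times the logarithm; the factor
  1/\<epsilon> beyond the cost of a single scale is the price of not knowing \<epsilon>.

  The Lipschitz constant enters the sample size through one number, the initial mass of the interval
  of acceptable prices, of order 1/(M k (1 + L)). Its inverse is a factor of the failure
  probability, so L ends up inside a logarithm.\<close>

section \<open>Adaptive histories and noisy binary search\<close>

text \<open>The probability of the winners \<open>ws\<close> when \<open>w\<close> wins at price
  \<open>r\<close> with probability \<open>\<pi> r w\<close> and \<open>q\<close> chooses each price
  from the winners seen before.\<close>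

definition hist_weight :: "(real \<Rightarrow> nat \<Rightarrow> real) \<Rightarrow> (nat list \<Rightarrow> real) \<Rightarrow> nat list \<Rightarrow> real" where
  "hist_weight \<pi> q ws = (\<Prod>t<length ws. \<pi> (q (take t ws)) (ws ! t))"

lemma hist_weight_Nil [simp]: "hist_weight \<pi> q [] = 1"
  by (simp add: hist_weight_def)

lemma hist_weight_snoc:
  "hist_weight \<pi> q (ws @ [w]) = hist_weight \<pi> q ws * \<pi> (q ws) w"
  by (simp add: hist_weight_def nth_append)

definition histories :: "nat set \<Rightarrow> nat \<Rightarrow> nat list set" where
  "histories A T = {ws. set ws \<subseteq> A \<and> length ws = T}"

lemma finite_histories: "finite A \<Longrightarrow> finite (histories A T)"
  unfolding histories_def by (rule finite_lists_length_eq)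

lemma histories_Suc:
  "histories A (Suc T) = (\<lambda>(ws, w). ws @ [w]) ` (histories A T \<times> A)"
proof (intro equalityI subsetI)
  fix vs assume "vs \<in> histories A (Suc T)"
  then show "vs \<in> (\<lambda>(ws, w). ws @ [w]) ` (histories A T \<times> A)"
    by (cases vs rule: rev_cases) (auto simp: histories_def)
qed (auto simp: histories_def)

lemma sum_histories_Suc:
  "(\<Sum>vs\<in>histories A (Suc T). f vs) = (\<Sum>ws\<in>histories A T. \<Sum>w\<in>A. f (ws @ [w]))"
proof -
  have "inj_on (\<lambda>(ws, w). ws @ [w]) (histories A T \<times> A)"
    by (auto simp: inj_on_def)
  then show ?thesis
    by (simp add: histories_Suc sum.reindex sum.cartesian_product split_def)
qed

lemma hist_weight_nonneg:
  assumes "\<And>r w. w \<in> A \<Longrightarrow> 0 \<le> \<pi> r w" "set ws \<subseteq> A"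
  shows "0 \<le> hist_weight \<pi> q ws"
  unfolding hist_weight_def using assms
  by (intro prod_nonneg) (auto simp: subset_iff)

text \<open>Histories of a fixed length are finitely many, so expectations are finite sums, and
  conditioning on the past amounts to splitting off the last winner.\<close>

lemma supermartingale_sum:
  assumes nonneg: "\<And>r w. w \<in> A \<Longrightarrow> 0 \<le> \<pi> r w"
    and step: "\<And>ws. set ws \<subseteq> A \<Longrightarrow> (\<Sum>w\<in>A. \<pi> (q ws) w * \<Psi> (ws @ [w])) \<le> \<Psi> ws"
  shows "(\<Sum>ws\<in>histories A T. hist_weight \<pi> q ws * \<Psi> ws) \<le> \<Psi> []"
proof (induction T)
  case 0
  have "histories A 0 = {[]}" by (auto simp: histories_def)
  then show ?case by simp
next
  case (Suc T)
  have "(\<Sum>ws\<in>histories A (Suc T). hist_weight \<pi> q ws * \<Psi> ws) =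
      (\<Sum>ws\<in>histories A T. hist_weight \<pi> q ws * (\<Sum>w\<in>A. \<pi> (q ws) w * \<Psi> (ws @ [w])))"
    by (simp add: sum_histories_Suc hist_weight_snoc sum_distrib_left mult.assoc)
  also have "\<dots> \<le> (\<Sum>ws\<in>histories A T. hist_weight \<pi> q ws * \<Psi> ws)"
    by (intro sum_mono mult_left_mono step hist_weight_nonneg[of A] nonneg) (auto simp: histories_def)
  finally show ?case using Suc by simp
qed

text \<open>Markov's inequality for the potential after \<open>T\<close> rounds. The search for a
  quantile and the counting of wins are two instances, with different potentials.\<close>

lemma supermartingale_markov:
  assumes fin: "finite A" and nonneg: "\<And>r w. w \<in> A \<Longrightarrow> 0 \<le> \<pi> r w"
    and step: "\<And>ws. set ws \<subseteq> A \<Longrightarrow> (\<Sum>w\<in>A. \<pi> (q ws) w * \<Psi> (ws @ [w])) \<le> \<Psi> ws"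
    and pos: "\<And>ws. set ws \<subseteq> A \<Longrightarrow> 0 \<le> \<Psi> ws"
    and bad: "\<And>ws. set ws \<subseteq> A \<Longrightarrow> length ws = T \<Longrightarrow> B ws \<Longrightarrow> c \<le> \<Psi> ws" and c: "0 < c"
  shows "(\<Sum>ws | ws \<in> histories A T \<and> B ws. hist_weight \<pi> q ws) \<le> \<Psi> [] / c"
proof -
  have "c * (\<Sum>ws | ws \<in> histories A T \<and> B ws. hist_weight \<pi> q ws) \<le>
        (\<Sum>ws | ws \<in> histories A T \<and> B ws. hist_weight \<pi> q ws * \<Psi> ws)"
    unfolding sum_distrib_left
  proof (intro sum_mono)
    fix ws assume ws: "ws \<in> {ws. ws \<in> histories A T \<and> B ws}"
    then have "hist_weight \<pi> q ws * c \<le> hist_weight \<pi> q ws * \<Psi> ws"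
      by (intro mult_left_mono bad hist_weight_nonneg[of A] nonneg) (auto simp: histories_def)
    then show "c * hist_weight \<pi> q ws \<le> hist_weight \<pi> q ws * \<Psi> ws"
      by (simp add: mult.commute)
  qed
  also have "\<dots> \<le> (\<Sum>ws\<in>histories A T. hist_weight \<pi> q ws * \<Psi> ws)"
    by (intro sum_mono2 mult_nonneg_nonneg hist_weight_nonneg[of A] nonneg pos finite_histories fin)
       (auto simp: histories_def)
  also have "\<dots> \<le> \<Psi> []"
    using nonneg step by (rule supermartingale_sum)
  finally show ?thesis using c by (simp add: pos_le_divide_eq mult.commute)
qed

section \<open>Exponential moments under adaptively chosen prices\<close>

lemma exp_le_quadratic:
  fixes y :: real
  assumes "\<bar>y\<bar> \<le> 1"
  shows "exp y \<le> 1 + y + y\<^sup>2"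
proof (cases "0 \<le> y")
  case True
  then show ?thesis using assms by (intro exp_bound) auto
next
  case False
  \<comment> \<open>For negative \<open>y\<close> the reciprocal is bounded from below, which leaves
    the comparison of 1/(1 - y) with the start of a geometric series.\<close>
  have "1 - y \<le> exp (- y)" using exp_ge_add_one_self[of "- y"] by simp
  then have "exp y \<le> 1 / (1 - y)"
    using False by (simp add: exp_minus field_simps)
  also have "\<dots> \<le> 1 + y + y\<^sup>2"
  proof -
    have "1 \<le> (1 + y + y\<^sup>2) * (1 - y)"
    proof -
      have "(1 + y + y\<^sup>2) * (1 - y) = 1 - y * y\<^sup>2"
        by (simp add: algebra_simps power2_eq_square)
      moreover have "y * y\<^sup>2 \<le> 0" using False by (intro mult_nonpos_nonneg) auto
      ultimately show ?thesis by linarith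
    qed
    then show ?thesis using False by (simp add: pos_divide_le_eq)
  qed
  finally show ?thesis .
qed

text \<open>An exponential moment replaces Azuma's inequality: the conditional expectation of
  \<open>exp (\<beta> \<sigma> (h w - m ws))\<close> is at most \<open>1 + \<beta>\<^sup>2\<close>.\<close>

lemma adaptive_mean_deviation:
  assumes fin: "finite A" and nonneg: "\<And>r w. w \<in> A \<Longrightarrow> 0 \<le> \<pi> r w"
    and one: "\<And>ws. set ws \<subseteq> A \<Longrightarrow> (\<Sum>w\<in>A. \<pi> (q ws) w) = 1"
    and m: "\<And>ws. set ws \<subseteq> A \<Longrightarrow> m ws = (\<Sum>w\<in>A. \<pi> (q ws) w * h w)"
    and h: "\<And>w. w \<in> A \<Longrightarrow> 0 \<le> h w \<and> h w \<le> (1::real)"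
    and \<beta>: "0 \<le> \<beta>" "\<beta> \<le> 1" and \<sigma>: "\<bar>\<sigma>\<bar> = 1"
  shows "(\<Sum>ws | ws \<in> histories A T \<and> 
            2 * \<beta> * T \<le> \<sigma> * (\<Sum>t<length ws. h (ws ! t) - m (take t ws)). hist_weight \<pi> q ws)
         \<le> exp (- (\<beta>\<^sup>2 * T))"
proof -
  define D where "D ws = (\<Sum>t<length ws. h (ws ! t) - m (take t ws))" for ws
  define \<Psi> where "\<Psi> ws = exp (\<beta> * \<sigma> * D ws - \<beta>\<^sup>2 * length ws)" for ws
  have D_snoc: "D (ws @ [w]) = D ws + (h w - m ws)" for ws w
    by (simp add: D_def nth_append)
  have "(\<Sum>ws | ws \<in> histories A T \<and> 2 * \<beta> * T \<le> \<sigma> * D ws. hist_weight \<pi> q ws)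
       \<le> \<Psi> [] / exp (\<beta>\<^sup>2 * T)"
  proof (rule supermartingale_markov[OF fin nonneg])
    fix ws assume ws: "set ws \<subseteq> A"
    have m01: "0 \<le> m ws \<and> m ws \<le> 1"
    proof
      show "0 \<le> m ws" unfolding m[OF ws] using h nonneg by (intro sum_nonneg) auto
      have "m ws \<le> (\<Sum>w\<in>A. \<pi> (q ws) w * 1)"
        unfolding m[OF ws] using h nonneg by (intro sum_mono mult_left_mono) auto
      then show "m ws \<le> 1" using one[OF ws] by simp
    qed
    have "(\<Sum>w\<in>A. \<pi> (q ws) w * exp (\<beta> * \<sigma> * (h w - m ws))) \<le>
        (\<Sum>w\<in>A. \<pi> (q ws) w * (1 + \<beta> * \<sigma> * (h w - m ws) + \<beta>\<^sup>2))"
    proof (intro sum_mono mult_left_mono nonneg)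
      fix w assume w: "w \<in> A"
      have 1: "\<bar>h w - m ws\<bar> \<le> 1" using m01 h[OF w] by auto
      have 2: "\<bar>\<beta> * \<sigma> * (h w - m ws)\<bar> \<le> \<beta>"
        using 1 \<beta> \<sigma> by (simp add: abs_mult mult_left_le)
      then have 3: "(\<beta> * \<sigma> * (h w - m ws))\<^sup>2 \<le> \<beta>\<^sup>2"
        using abs_le_square_iff[of "\<beta> * \<sigma> * (h w - m ws)" \<beta>] \<beta> by simp
      have "exp (\<beta> * \<sigma> * (h w - m ws)) \<le> 
          1 + \<beta> * \<sigma> * (h w - m ws) + (\<beta> * \<sigma> * (h w - m ws))\<^sup>2"
        using 2 \<beta> by (intro exp_le_quadratic) auto
      with 3 show "exp (\<beta> * \<sigma> * (h w - m ws)) \<le> 1 + \<beta> * \<sigma> * (h w - m ws) + \<beta>\<^sup>2"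
        by linarith
    qed
    also have "\<dots> = (\<Sum>w\<in>A. \<pi> (q ws) w) * (1 - \<beta> * \<sigma> * m ws + \<beta>\<^sup>2)
         + \<beta> * \<sigma> * (\<Sum>w\<in>A. \<pi> (q ws) w * h w)"
      by (simp add: sum.distrib sum_subtractf sum_distrib_left sum_distrib_right algebra_simps)
    also have "\<dots> = 1 + \<beta>\<^sup>2" using one[OF ws] m[OF ws] by simp
    also have "\<dots> \<le> exp (\<beta>\<^sup>2)" by (rule exp_ge_add_one_self)
    finally have *: "(\<Sum>w\<in>A. \<pi> (q ws) w * exp (\<beta> * \<sigma> * (h w - m ws))) \<le> exp (\<beta>\<^sup>2)" .
    have "(\<Sum>w\<in>A. \<pi> (q ws) w * \<Psi> (ws @ [w])) =
        \<Psi> ws * exp (- (\<beta>\<^sup>2)) * (\<Sum>w\<in>A. \<pi> (q ws) w * exp (\<beta> * \<sigma> * (h w - m ws)))"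
      unfolding \<Psi>_def D_snoc sum_distrib_left
      by (intro sum.cong refl) (simp add: mult_exp_exp algebra_simps)
    also have "\<dots> \<le> \<Psi> ws * exp (- (\<beta>\<^sup>2)) * exp (\<beta>\<^sup>2)"
      by (intro mult_left_mono *) (simp add: \<Psi>_def)
    also have "\<dots> = \<Psi> ws" by (simp add: mult.assoc mult_exp_exp)
    finally show "(\<Sum>w\<in>A. \<pi> (q ws) w * \<Psi> (ws @ [w])) \<le> \<Psi> ws" .
    show "0 \<le> \<Psi> ws" by (simp add: \<Psi>_def)
  next
    fix ws assume "length ws = T" "2 * \<beta> * T \<le> \<sigma> * D ws"
    \<comment> \<open>Of the exponent \<open>2 * \<beta>\<^sup>2 * T\<close>, one half pays for the
      term \<open>\<beta>\<^sup>2 * length ws\<close> in the potential, and the other half remains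
      as the bound.\<close>
    then have "\<beta> * (2 * \<beta> * T) \<le> \<beta> * (\<sigma> * D ws)" using \<beta> by (intro mult_left_mono)
    then show "exp (\<beta>\<^sup>2 * T) \<le> \<Psi> ws"
      using \<open>length ws = T\<close> by (simp add: \<Psi>_def power2_eq_square algebra_simps)
  qed auto
  then show ?thesis by (simp add: D_def \<Psi>_def exp_minus field_simps)
qed

section \<open>Tilted measures and their medians\<close>

text \<open>\<open>tilts k \<beta> \<tau> ws\<close> is the distribution function of the measure tilted according to the winners
  \<open>ws\<close>, and \<open>query k \<beta> \<tau> ws\<close> is its median. The winner \<open>k + 1\<close> is the price.\<close>

definition gain :: "nat \<Rightarrow> real \<Rightarrow> real \<Rightarrow> nat \<Rightarrow> real" where
  "gain k \<beta> \<tau> w = \<beta> * (of_bool (k < w) - \<tau>)"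

text \<open>The density is multiplied by 1 + g below the median and by 1 - g above it; both halves
  have mass 1/2, so the total stays 1. At price \<open>r\<close> the mean of \<open>gain\<close> is
  \<open>\<beta> * (H r - \<tau>)\<close>, which is positive to the right of the quantile and
  negative to its left, so on average mass moves towards the quantile.\<close>

definition tilt :: "real \<Rightarrow> real \<Rightarrow> real" where
  "tilt g v = (if v < 1 / 2 then (1 + g) * v else 1 - (1 - g) * (1 - v))"

definition untilt :: "real \<Rightarrow> real \<Rightarrow> real" where
  "untilt g u = (if u < (1 + g) / 2 then u / (1 + g) else 1 - (1 - u) / (1 - g))"

definition query :: "nat \<Rightarrow> real \<Rightarrow> real \<Rightarrow> nat list \<Rightarrow> real" where
  "query k \<beta> \<tau> ws = foldr (\<lambda>w. untilt (gain k \<beta> \<tau> w)) ws (1 / 2)"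

definition tilts :: "nat \<Rightarrow> real \<Rightarrow> real \<Rightarrow> nat list \<Rightarrow> real \<Rightarrow> real" where
  "tilts k \<beta> \<tau> ws v = fold (\<lambda>w. tilt (gain k \<beta> \<tau> w)) ws v"

lemma abs_gain:
  assumes "0 \<le> \<tau>" "\<tau> \<le> 1" "0 \<le> \<beta>"
  shows "\<bar>gain k \<beta> \<tau> w\<bar> \<le> \<beta>"
proof -
  have "\<bar>of_bool (k < w) - \<tau>\<bar> \<le> 1" using assms by auto
  then show ?thesis using assms by (simp add: gain_def abs_mult mult_left_le)
qed

lemma tilt_untilt:
  assumes "\<bar>g\<bar> \<le> 1 / 2"
  shows "tilt g (untilt g u) = u"
proof -
  have g: "1 + g \<noteq> 0" "1 - g \<noteq> 0" "0 < 1 + g" "0 < 1 - g" using assms by auto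
  show ?thesis
  proof (cases "u < (1 + g) / 2")
    case True
    then have "untilt g u < 1 / 2" using g by (simp add: untilt_def pos_divide_less_eq)
    then show ?thesis using True g by (simp add: tilt_def untilt_def)
  next
    case False
    then have "(1 - u) / (1 - g) \<le> 1 / 2" using g by (simp add: pos_divide_le_eq)
    then have "\<not> untilt g u < 1 / 2" using False by (simp add: untilt_def)
    then show ?thesis using False g by (simp add: tilt_def untilt_def)
  qed
qed

lemma tilt_strict_mono: "\<bar>g\<bar> \<le> 1 / 2 \<Longrightarrow> u < v \<Longrightarrow> tilt g u < tilt g v"
proof -
  assume g: "\<bar>g\<bar> \<le> 1 / 2" and uv: "u < v"
  show ?thesis
  proof (cases "u < 1/2 \<and> \<not> v < 1/2")
    case True
    have "(1 + g) * u < (1 + g) * (1/2)" using True g by (intro mult_strict_left_mono) auto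
    moreover have "(1 - g) * (1 - v) \<le> (1 - g) * (1 / 2)" using True g by (intro mult_left_mono) auto
    ultimately show ?thesis using True by (simp add: tilt_def algebra_simps)
  next
    case False
    then show ?thesis using uv g by (auto simp: tilt_def intro!: mult_strict_left_mono)
  qed
qed

lemma untilt_unit: "\<bar>g\<bar> \<le> 1 / 2 \<Longrightarrow> 0 \<le> u \<Longrightarrow> u \<le> 1 \<Longrightarrow> 0 \<le> untilt g u \<and> untilt g u \<le> 1"
  by (auto simp: untilt_def field_simps)

lemma tilt_0 [simp]: "tilt g 0 = 0" and tilt_1 [simp]: "tilt g 1 = 1"
  by (auto simp: tilt_def)

lemma query_unit:
  assumes "0 \<le> \<tau>" "\<tau> \<le> 1" "0 \<le> \<beta>" "\<beta> \<le> 1 / 2"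
  shows "0 \<le> query k \<beta> \<tau> ws \<and> query k \<beta> \<tau> ws \<le> 1"
proof (induction ws)
  case (Cons w ws)
  have "\<bar>gain k \<beta> \<tau> w\<bar> \<le> 1 / 2" using abs_gain[OF assms(1-3), of k w] assms(4) by linarith
  then show ?case using Cons untilt_unit by (simp add: query_def)
qed (simp add: query_def)

lemma tilts_query:
  assumes "0 \<le> \<tau>" "\<tau> \<le> 1" "0 \<le> \<beta>" "\<beta> \<le> 1 / 2"
  shows "tilts k \<beta> \<tau> ws (query k \<beta> \<tau> ws) = 1 / 2"
proof (induction ws)
  case (Cons w ws)
  have "\<bar>gain k \<beta> \<tau> w\<bar> \<le> 1 / 2" using abs_gain[OF assms(1-3), of k w] assms(4) by linarith
  then show ?case using Cons by (simp add: query_def tilts_def tilt_untilt)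
qed (simp add: query_def tilts_def)

lemma tilts_strict_mono:
  assumes "0 \<le> \<tau>" "\<tau> \<le> 1" "0 \<le> \<beta>" "\<beta> \<le> 1 / 2" "u < v"
  shows "tilts k \<beta> \<tau> ws u < tilts k \<beta> \<tau> ws v"
  using assms(5)
proof (induction ws arbitrary: u v)
  case (Cons w ws)
  have "\<bar>gain k \<beta> \<tau> w\<bar> \<le> 1 / 2" using abs_gain[OF assms(1-3), of k w] assms(4) by linarith
  from tilt_strict_mono[OF this Cons.prems] show ?case
    using Cons.IH by (simp add: tilts_def)
qed (simp add: tilts_def)

lemma tilts_0 [simp]: "tilts k \<beta> \<tau> ws 0 = 0" and tilts_1 [simp]: "tilts k \<beta> \<tau> ws 1 = 1"
  by (induction ws) (auto simp: tilts_def)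

lemma tilts_snoc: "tilts k \<beta> \<tau> (ws @ [w]) v = tilt (gain k \<beta> \<tau> w) (tilts k \<beta> \<tau> ws v)"
  by (simp add: tilts_def)

text \<open>The average \<open>A\<close> of the sign over the interval does not depend on \<open>g\<close>.\<close>

lemma tilt_width:
  assumes "u < v"
  obtains A where "\<bar>A\<bar> \<le> 1" "\<And>g. tilt g v - tilt g u = (v - u) * (1 + g * A)"
    "v < 1 / 2 \<Longrightarrow> A = 1" "1 / 2 \<le> u \<Longrightarrow> A = - 1"
proof -
  \<comment> \<open>If the interval straddles 1/2, the part below has length 1/2 - u and sign +1,
    the part above has length v - 1/2 and sign -1.\<close>
  define A where "A = (if v < 1/2 then 1 else if 1/2 \<le> u then -1 else (1 - u - v) / (v - u))"
  have "\<bar>A\<bar> \<le> 1" using assms by (auto simp: A_def abs_le_iff field_simps)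
  moreover have "tilt g v - tilt g u = (v - u) * (1 + g * A)" for g
    using assms by (auto simp: A_def tilt_def field_simps)
  ultimately show ?thesis using that[of A] assms by (auto simp: A_def)
qed

lemma inverse_le_quadratic:
  fixes x :: real
  assumes "\<bar>x\<bar> \<le> 1 / 2"
  shows "1 / (1 + x) \<le> 1 - x + 2 * x\<^sup>2"
proof -
  have "1 \<le> (1 - x + 2 * x\<^sup>2) * (1 + x)"
  proof -
    have "(1 - x + 2 * x\<^sup>2) * (1 + x) = 1 + x\<^sup>2 * (1 + 2 * x)"
      by (simp add: algebra_simps power2_eq_square)
    moreover have "0 \<le> x\<^sup>2 * (1 + 2 * x)" using assms by (intro mult_nonneg_nonneg) auto
    ultimately show ?thesis by linarith
  qed
  then show ?thesis using assms by (simp add: pos_divide_le_eq)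
qed

text \<open>The potential is the inverse of the mass which the tilted measure gives to the interval
  \<open>[a, b]\<close> of almost optimal prices.\<close>

lemma search_deviation:
  assumes fin: "finite A" and nonneg: "\<And>r w. w \<in> A \<Longrightarrow> 0 \<le> \<pi> r w"
    and one: "\<And>r. 0 \<le> r \<Longrightarrow> r \<le> 1 \<Longrightarrow> (\<Sum>w\<in>A. \<pi> r w) = 1"
    and H: "\<And>r. 0 \<le> r \<Longrightarrow> r \<le> 1 \<Longrightarrow> (\<Sum>w\<in>A. \<pi> r w * of_bool (k < w)) = H r"
    and mono: "mono_on {0..1} H"
    and \<tau>: "0 \<le> \<tau>" "\<tau> \<le> 1" and \<beta>: "0 < \<beta>" "\<beta> \<le> 1 / 2"
    and ab: "0 \<le> a" "a < b" "b \<le> 1" and Ha: "\<tau> - \<beta> \<le> H a" and Hb: "H b \<le> \<tau> + \<beta>"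
  shows "(\<Sum>ws | ws \<in> histories A T \<and>
            5 * \<beta> * T \<le> (\<Sum>t<length ws. \<bar>H (query k \<beta> \<tau> (take t ws)) - \<tau>\<bar>).
          hist_weight \<pi> (query k \<beta> \<tau>) ws)
         \<le> exp (- (\<beta>\<^sup>2 * T)) / (b - a)"
proof -
  define q where "q = query k \<beta> \<tau>"
  have q01: "0 \<le> q ws" "q ws \<le> 1" for ws
    using query_unit[of \<tau> \<beta> k ws] \<tau> \<beta> by (auto simp: q_def)
  define W where "W = tilts k \<beta> \<tau>"
  have Wmono: "u < v \<Longrightarrow> W ws u < W ws v" for ws u v
    using tilts_strict_mono[of \<tau> \<beta> u v k ws] \<tau> \<beta> by (simp add: W_def)
  have Wq: "W ws (q ws) = 1 / 2" for ws
    using tilts_query[of \<tau> \<beta> k ws] \<tau> \<beta> by (simp add: W_def q_def)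
  \<comment> \<open>The allowance of 4 \<beta> per round has two equal parts: 2 \<beta> for the loss
    in \<open>drift\<close>, and 2 \<beta> for the quadratic term of
    \<open>inverse_le_quadratic\<close>.\<close>
  define D where "D ws = (\<Sum>t<length ws. \<bar>H (q (take t ws)) - \<tau>\<bar> - 4 * \<beta>)" for ws
  define \<Psi> where "\<Psi> ws = exp (\<beta> * D ws) / (W ws b - W ws a)" for ws
  have D_snoc: "D (ws @ [w]) = D ws + (\<bar>H (q ws) - \<tau>\<bar> - 4 * \<beta>)" for ws w
    by (simp add: D_def nth_append)
  have Hmono: "0 \<le> u \<Longrightarrow> u \<le> v \<Longrightarrow> v \<le> 1 \<Longrightarrow> H u \<le> H v" for u v
    using mono by (auto simp: mono_on_def)
  have "(\<Sum>ws | ws \<in> histories A T \<and> 5 * \<beta> * T \<le> (\<Sum>t<length ws. \<bar>H (q (take t ws)) - \<tau>\<bar>).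
          hist_weight \<pi> q ws) \<le> \<Psi> [] / exp (\<beta>\<^sup>2 * T)"
  proof (rule supermartingale_markov[OF fin nonneg])
    fix ws assume "set ws \<subseteq> A"
    have V: "0 < W ws b - W ws a" using Wmono[OF ab(2)] by simp
    obtain B where B: "\<bar>B\<bar> \<le> 1"
      "\<And>g. tilt g (W ws b) - tilt g (W ws a) = (W ws b - W ws a) * (1 + g * B)"
      "W ws b < 1 / 2 \<Longrightarrow> B = 1" "1 / 2 \<le> W ws a \<Longrightarrow> B = - 1"
      using tilt_width[OF Wmono[OF ab(2)]] by blast
    define r where "r = q ws"
    have r01: "0 \<le> r" "r \<le> 1" using q01 by (auto simp: r_def)
    \<comment> \<open>If the price lies outside \<open>[a, b]\<close>, the interval is entirely on
      one side of the median, so \<open>B\<close> is 1 or -1, with the sign of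
      \<open>H r - \<tau>\<close> up to an error \<beta>. Inside, nothing is known about the sign of
      \<open>B\<close>, but \<open>\<bar>H r - \<tau>\<bar>\<close> is at most \<beta>.\<close>
    have drift: "\<bar>H r - \<tau>\<bar> - 2 * \<beta> \<le> B * (H r - \<tau>)"
    proof -
      consider "b < r" | "r \<le> a" | "a < r" "r \<le> b" by linarith
      then show ?thesis
      proof cases
        case 1
        then have "B = 1" using B(3) Wmono[OF 1, of ws] Wq[of ws] by (simp add: r_def)
        moreover have "H a \<le> H r" using 1 ab r01 by (intro Hmono) auto
        ultimately show ?thesis using Ha \<beta> by (auto simp: abs_if)
      next
        case 2
        then have "W ws r \<le> W ws a" using Wmono[of r a ws] by (cases "r = a") auto
        then have "B = - 1" using B(4) Wq[of ws] by (simp add: r_def)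
        moreover have "H r \<le> H b" using 2 ab r01 by (intro Hmono) auto
        ultimately show ?thesis using Hb \<beta> by (auto simp: abs_if)
      next
        case 3
        have "H a \<le> H r" "H r \<le> H b" using 3 ab r01 by (auto intro!: Hmono)
        then have "\<bar>H r - \<tau>\<bar> \<le> \<beta>" using Ha Hb by auto
        moreover have "\<bar>B * (H r - \<tau>)\<bar> \<le> \<bar>H r - \<tau>\<bar>"
          using B(1) by (simp add: abs_mult mult_left_le_one_le)
        ultimately show ?thesis by (auto simp: abs_le_iff)
      qed
    qed
    have "(\<Sum>w\<in>A. \<pi> r w * (1 / (1 + gain k \<beta> \<tau> w * B))) \<le>
        (\<Sum>w\<in>A. \<pi> r w * (1 - \<beta> * (of_bool (k < w) - \<tau>) * B + 2 * \<beta>\<^sup>2))"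
    proof (intro sum_mono mult_left_mono nonneg)
      fix w
      have 1: "\<bar>gain k \<beta> \<tau> w * B\<bar> \<le> \<beta>"
        using abs_gain[of \<tau> \<beta> k w] \<tau> \<beta> B(1) mult_mono[of "\<bar>gain k \<beta> \<tau> w\<bar>" \<beta> "\<bar>B\<bar>" 1]
        by (simp add: abs_mult)
      then have 2: "(gain k \<beta> \<tau> w * B)\<^sup>2 \<le> \<beta>\<^sup>2"
        using abs_le_square_iff[of "gain k \<beta> \<tau> w * B" \<beta>] \<beta> by simp
      have "1 / (1 + gain k \<beta> \<tau> w * B) \<le> 1 - gain k \<beta> \<tau> w * B + 2 * (gain k \<beta> \<tau> w * B)\<^sup>2"
        using 1 \<beta> by (intro inverse_le_quadratic) auto
      then show "1 / (1 + gain k \<beta> \<tau> w * B) \<le> 1 - \<beta> * (of_bool (k < w) - \<tau>) * B + 2 * \<beta>\<^sup>2"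
        using 2 unfolding gain_def by linarith
    qed
    also have "\<dots> = (\<Sum>w\<in>A. \<pi> r w) * (1 + \<beta> * \<tau> * B + 2 * \<beta>\<^sup>2) - 
        \<beta> * B * (\<Sum>w\<in>A. \<pi> r w * of_bool (k < w))"
    proof -
      have "(\<Sum>w\<in>A. \<pi> r w * (1 - \<beta> * (h w - \<tau>) * B + 2 * \<beta>\<^sup>2)) =
          (\<Sum>w\<in>A. \<pi> r w) * (1 + \<beta> * \<tau> * B + 2 * \<beta>\<^sup>2) - \<beta> * B * (\<Sum>w\<in>A. \<pi> r w * h w)" for h
        by (simp add: sum.distrib sum_subtractf sum_distrib_left sum_distrib_right algebra_simps)
      then show ?thesis .
    qed
    also have "\<dots> = 1 - \<beta> * (B * (H r - \<tau>)) + 2 * \<beta>\<^sup>2"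
      using one[OF r01] H[OF r01] by (simp add: algebra_simps)
    also have "\<dots> \<le> 1 - \<beta> * (\<bar>H r - \<tau>\<bar> - 2 * \<beta>) + 2 * \<beta>\<^sup>2"
      using drift \<beta> by simp
    also have "\<dots> = 1 + - \<beta> * (\<bar>H r - \<tau>\<bar> - 4 * \<beta>)"
      by (simp add: algebra_simps power2_eq_square)
    also have "\<dots> \<le> exp (- \<beta> * (\<bar>H r - \<tau>\<bar> - 4 * \<beta>))" by (rule exp_ge_add_one_self)
    finally have *: "(\<Sum>w\<in>A. \<pi> r w * (1 / (1 + gain k \<beta> \<tau> w * B))) \<le> exp (- \<beta> * (\<bar>H r - \<tau>\<bar> - 4 * \<beta>))" .
    have "(\<Sum>w\<in>A. \<pi> (q ws) w * \<Psi> (ws @ [w])) = 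
        \<Psi> ws * exp (\<beta> * (\<bar>H r - \<tau>\<bar> - 4 * \<beta>)) * (\<Sum>w\<in>A. \<pi> r w * (1 / (1 + gain k \<beta> \<tau> w * B)))"
      unfolding \<Psi>_def D_snoc sum_distrib_left W_def tilts_snoc B(2)[unfolded W_def] r_def
      by (intro sum.cong refl) (simp add: exp_add distrib_left)
    also have "\<dots> \<le> \<Psi> ws * exp (\<beta> * (\<bar>H r - \<tau>\<bar> - 4 * \<beta>)) * exp (- \<beta> * (\<bar>H r - \<tau>\<bar> - 4 * \<beta>))"
      using V by (intro mult_left_mono *) (simp add: \<Psi>_def)
    also have "\<dots> = \<Psi> ws" by (simp add: mult.assoc mult_exp_exp)
    finally show "(\<Sum>w\<in>A. \<pi> (q ws) w * \<Psi> (ws @ [w])) \<le> \<Psi> ws" .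
    show "0 \<le> \<Psi> ws" using V by (simp add: \<Psi>_def)
  next
    fix ws assume len: "length ws = T" and big: "5 * \<beta> * T \<le> (\<Sum>t<length ws. \<bar>H (q (take t ws)) - \<tau>\<bar>)"
    have V: "0 < W ws b - W ws a" using Wmono[OF ab(2)] by simp
    have "0 \<le> W ws a" using Wmono[of 0 a ws] ab by (cases "a = 0") (auto simp: W_def)
    moreover have "W ws b \<le> 1" using Wmono[of b 1 ws] ab by (cases "b = 1") (auto simp: W_def)
    ultimately have V1: "W ws b - W ws a \<le> 1" by simp
    \<comment> \<open>Against the allowance of 4 \<beta>, an average of 5 \<beta> leaves a surplus
      of \<beta> per round. Since the interval has mass at most 1, the denominator of the potential
      only helps.\<close>
    have "\<beta> * T \<le> D ws" using big len by (simp add: D_def sum_subtractf)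
    then have "\<beta> * (\<beta> * T) \<le> \<beta> * D ws" using \<beta> by (intro mult_left_mono) auto
    then have "exp (\<beta>\<^sup>2 * T) \<le> exp (\<beta> * D ws)" by (simp add: power2_eq_square)
    also have "\<dots> \<le> \<Psi> ws" using V V1 by (simp add: \<Psi>_def le_divide_eq mult_left_le)
    finally show "exp (\<beta>\<^sup>2 * T) \<le> \<Psi> ws" .
  qed auto
  then show ?thesis by (simp add: q_def \<Psi>_def D_def W_def tilts_def exp_minus field_simps)
qed

section \<open>Estimating one marginal from the shares of wins\<close>

text \<open>Read \<open>G a\<close> as the probability that the agent wins at price
  \<open>a\<close>. Then \<open>F_le_G\<close> and \<open>G_le_F\<close> say that
  \<open>G a - G b\<close> lies between H/F at \<open>a\<close> and H/F at \<open>b\<close>, each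
  times \<open>F b - F a\<close>, where H/F is the distribution function of the highest other bid.
  The products avoid a division where \<open>F\<close> vanishes.\<close>

locale auction_marginal =
  fixes F G H :: "real \<Rightarrow> real"
  assumes F_mono: "\<And>a b. 0 \<le> a \<Longrightarrow> a \<le> b \<Longrightarrow> b \<le> 1 \<Longrightarrow> F a \<le> F b"
    and H_mono: "\<And>a b. 0 \<le> a \<Longrightarrow> a \<le> b \<Longrightarrow> b \<le> 1 \<Longrightarrow> H a \<le> H b"
    and G_antimono: "\<And>a b. 0 \<le> a \<Longrightarrow> a \<le> b \<Longrightarrow> b \<le> 1 \<Longrightarrow> G b \<le> G a"
    and G_le_H: "\<And>a b. 0 \<le> a \<Longrightarrow> a \<le> b \<Longrightarrow> b \<le> 1 \<Longrightarrow> G a - G b \<le> H b - H a"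
    and F_le_G: "\<And>a b. 0 \<le> a \<Longrightarrow> a \<le> b \<Longrightarrow> b \<le> 1 \<Longrightarrow> (F b - F a) * H a \<le> F a * (G a - G b)"
    and G_le_F: "\<And>a b. 0 \<le> a \<Longrightarrow> a \<le> b \<Longrightarrow> b \<le> 1 \<Longrightarrow> F b * (G a - G b) \<le> H b * (F b - F a)"
    and F_le_H: "\<And>a b. 0 \<le> a \<Longrightarrow> a \<le> b \<Longrightarrow> b \<le> 1 \<Longrightarrow> (F b - F a) * H a \<le> H b - H a"
    and H_le: "\<And>a. 0 \<le> a \<Longrightarrow> a \<le> 1 \<Longrightarrow> H a \<le> F a"
    and H_nonneg: "\<And>a. 0 \<le> a \<Longrightarrow> a \<le> 1 \<Longrightarrow> 0 \<le> H a"
    and F_1: "F 1 = 1" and H_1: "H 1 = 1" and G_1: "G 1 = 0"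
begin

text \<open>The inequality ln t \<le> t - 1 is applied to \<open>F a / F b\<close> for the lower and
  to \<open>F b / F a\<close> for the upper bound.\<close>

lemma ln_F_bounds:
  assumes "0 \<le> a" "a \<le> b" "b \<le> 1" "0 < H a"
  shows "(G a - G b) / H b \<le> ln (F b) - ln (F a)" "ln (F b) - ln (F a) \<le> (G a - G b) / H a"
proof -
  have pos: "0 < F a" "0 < F b" "0 < H b"
    using assms H_le[of a] F_mono[of a b] H_mono[of a b] by auto
  have "(G a - G b) / H b \<le> 1 - F a / F b"
    using G_le_F[of a b] assms pos by (simp add: field_simps)
  also have "\<dots> \<le> - ln (F a / F b)" using ln_le_minus_one[of "F a / F b"] pos by simp
  also have "\<dots> = ln (F b) - ln (F a)" using pos by (simp add: ln_div)
  finally show "(G a - G b) / H b \<le> ln (F b) - ln (F a)" .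
  have "ln (F b) - ln (F a) = ln (F b / F a)" using pos by (simp add: ln_div)
  also have "\<dots> \<le> F b / F a - 1" using ln_le_minus_one[of "F b / F a"] pos by simp
  also have "\<dots> \<le> (G a - G b) / H a"
    using F_le_G[of a b] assms pos by (simp add: field_simps)
  finally show "ln (F b) - ln (F a) \<le> (G a - G b) / H a" .
qed

end

text \<open>\<open>x q\<close> is the point where \<open>H\<close> takes the value \<open>1 - q / M\<close>, \<open>b q\<close> is the computed substitute for it,
  and \<open>g q\<close> estimates \<open>G (x q)\<close>. Thresholds below \<open>\<gamma> / 2\<close> are not used.\<close>

locale scale_estimate = auction_marginal +
  fixes M :: nat and \<gamma> :: real and x g Y b :: "nat \<Rightarrow> real"
  assumes M: "128 \<le> \<gamma> * M" and \<gamma>: "0 < \<gamma>" "\<gamma> \<le> 1"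
    and x: "\<And>q. \<gamma> * M < 2 * (real M - q) \<Longrightarrow> 0 \<le> x q \<and> x q \<le> 1 \<and> H (x q) = (real M - q) / M"
    and x_0: "x 0 = 1"
    and g: "\<And>q. \<gamma> * M < 2 * (real M - q) \<Longrightarrow> \<bar>g q - G (x q)\<bar> \<le> 7 / (100 * M)"
    and b: "\<And>q. \<gamma> * M < 2 * (real M - q) \<Longrightarrow> 0 < q \<Longrightarrow> 
              0 \<le> b q \<and> b q \<le> 1 \<and> \<bar>H (b q) - (real M - q) / M\<bar> \<le> 1 / (5 * M)"
    and g_0: "g 0 = 0"
    and Y_0: "Y 0 = 1" 
    and Y_Suc: "\<And>q. \<gamma> * M < 2 * (real M - Suc q) \<Longrightarrow> 
                  Y (Suc q) = Y q * (1 - (g (Suc q) - g q) / ((real M - q) / M))"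
begin

definition \<tau> :: "nat \<Rightarrow> real" where "\<tau> q = (real M - q) / M"
definition \<eta> :: real where "\<eta> = 1 / M"

lemma M_pos: "0 < M"
  using M \<gamma> by (cases M) auto

lemma \<eta>_pos: "0 < \<eta>" using M_pos by (simp add: \<eta>_def)

lemma \<eta>_le: "128 * \<eta> \<le> \<gamma>"
  using M M_pos by (simp add: \<eta>_def field_simps)

lemma \<eta>_M: "\<eta> * (real M * c) = c"
  using M_pos by (simp add: \<eta>_def)

lemma \<tau>_eq: "\<tau> q = 1 - \<eta> * q"
  using M_pos by (simp add: \<tau>_def \<eta>_def field_simps)

lemma active_iff: "\<gamma> * M < 2 * (real M - q) \<longleftrightarrow> \<gamma> < 2 * \<tau> q"
  using M_pos by (simp add: \<tau>_def field_simps)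

lemma \<tau>_0: "\<tau> 0 = 1" using M_pos by (simp add: \<tau>_def)

lemma \<tau>_Suc: "\<tau> (Suc q) = \<tau> q - \<eta>"
  using M_pos by (simp add: \<tau>_def \<eta>_def field_simps)

text \<open>The errors of the increments of \<open>g\<close> are summed by parts, hence the term \<open>(g q - G (x q)) / \<tau> q\<close>.\<close>

lemma ln_Y:
  assumes "\<gamma> < 2 * \<tau> q"
  shows "0 < Y q \<and> \<bar>ln (Y q) - ln (F (x q)) + (g q - G (x q)) / \<tau> q\<bar> \<le> 10 * \<eta> * (1 / \<tau> q - 1)"
  using assms
proof (induction q)
  case 0
  then show ?case by (simp add: x_0 Y_0 g_0 F_1 G_1 \<tau>_0)
next
  case (Suc q)
  define D where "D q = g q - G (x q)" for q
  have act': "\<gamma> < 2 * \<tau> (Suc q)" and act: "\<gamma> < 2 * \<tau> q" using Suc.prems \<tau>_Suc[of q] \<eta>_pos by auto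
  have t: "0 < \<tau> q" "0 < \<tau> (Suc q)" using act act' \<gamma> by auto
  have xq: "0 \<le> x q" "x q \<le> 1" "H (x q) = \<tau> q"
    and xs: "0 \<le> x (Suc q)" "x (Suc q) \<le> 1" "H (x (Suc q)) = \<tau> (Suc q)"
    using x[of q] x[of "Suc q"] act act' unfolding active_iff \<tau>_def by auto
  have le: "x (Suc q) \<le> x q"
    using H_mono[of "x q" "x (Suc q)"] xq xs \<tau>_Suc[of q] \<eta>_pos by (cases "x q \<le> x (Suc q)") auto
  define p where "p = G (x (Suc q)) - G (x q)"
  have p: "0 \<le> p" "p \<le> \<eta>"
    using G_antimono[of "x (Suc q)" "x q"] G_le_H[of "x (Suc q)" "x q"] xq xs le \<tau>_Suc[of q]
    by (auto simp: p_def)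
  have Dq: "\<bar>D q\<bar> \<le> 7 * \<eta> / 100" and Ds: "\<bar>D (Suc q)\<bar> \<le> 7 * \<eta> / 100"
    using g[of q] g[of "Suc q"] act act' unfolding active_iff D_def \<eta>_def by auto
  define X where "X = (g (Suc q) - g q) / \<tau> q"
  have X_eq: "X = (p + D (Suc q) - D q) / \<tau> q" by (simp add: X_def p_def D_def)
  have X: "\<bar>X\<bar> \<le> 2 * \<eta> / \<tau> q"
    unfolding X_eq abs_divide using Dq Ds p t \<eta>_pos by (intro frac_le) auto
  also have "2 * \<eta> / \<tau> q \<le> 1 / 2" using \<eta>_le act t by (simp add: pos_divide_le_eq)
  finally have X2: "\<bar>X\<bar> \<le> 1 / 2" .
  have "Y (Suc q) = Y q * (1 - X)"
    using Y_Suc[of q] act' unfolding active_iff X_def by (simp add: \<tau>_def)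
  moreover have Yq: "0 < Y q" using Suc.IH act by simp
  moreover have X_pos: "0 < 1 - X" using X2 by auto
  ultimately have Ys: "0 < Y (Suc q)" "ln (Y (Suc q)) = ln (Y q) + ln (1 - X)"
    by (auto simp: ln_mult)
  have e1: "\<bar>ln (1 - X) + X\<bar> \<le> 2 * X\<^sup>2"
    using abs_ln_one_plus_x_minus_x_bound[of "- X"] X2 by simp
  have "X\<^sup>2 \<le> (2 * \<eta> / \<tau> q)\<^sup>2"
    using X abs_le_square_iff[of X "2 * \<eta> / \<tau> q"] t \<eta>_pos by simp
  \<comment> \<open>All errors of one step are charged to \<open>E\<close>. It telescopes to
    \<open>1 / \<tau> q - 1\<close>, and it dominates \<open>\<eta> / (\<tau> q)\<^sup>2\<close>,
    which is the size of the second-order terms.\<close>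
  define E where "E = 1 / \<tau> (Suc q) - 1 / \<tau> q"
  have E_eq: "E = \<eta> / (\<tau> (Suc q) * \<tau> q)" using t by (simp add: E_def \<tau>_Suc field_simps)
  have E_ge: "\<eta> / (\<tau> q)\<^sup>2 \<le> E"
    unfolding E_eq power2_eq_square using t \<eta>_pos \<tau>_Suc[of q]
    by (intro divide_left_mono mult_right_mono) auto
  have E0: "0 \<le> E" using t \<eta>_pos by (simp add: E_eq)
  have "2 * X\<^sup>2 \<le> 8 * \<eta> * (\<eta> / (\<tau> q)\<^sup>2)"
    using \<open>X\<^sup>2 \<le> _\<close> by (simp add: power_divide power_mult_distrib power2_eq_square)
  also have "\<dots> \<le> 8 * \<eta> * E" using E_ge \<eta>_pos by (intro mult_left_mono) auto
  finally have e1': "\<bar>ln (1 - X) + X\<bar> \<le> 8 * (\<eta> * E)" using e1 by (simp only: mult.assoc)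
  have L: "p / \<tau> q \<le> ln (F (x q)) - ln (F (x (Suc q)))"
      "ln (F (x q)) - ln (F (x (Suc q))) \<le> p / \<tau> (Suc q)"
    using ln_F_bounds[of "x (Suc q)" "x q"] xq xs le t by (auto simp: p_def)
  define l where "l = ln (F (x q)) - ln (F (x (Suc q))) - p / \<tau> q"
  have "p / \<tau> (Suc q) - p / \<tau> q = p * E" by (simp add: E_def algebra_simps)
  moreover have "p * E \<le> \<eta> * E" using p E0 by (intro mult_right_mono)
  ultimately have e2: "0 \<le> l" "l \<le> \<eta> * E" using L by (auto simp: l_def)
  have e3: "\<bar>D (Suc q) * E\<bar> \<le> 7 / 100 * (\<eta> * E)"
    using Ds E0 mult_right_mono[of "\<bar>D (Suc q)\<bar>" "7 * \<eta> / 100" E] by (simp add: abs_mult)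
  \<comment> \<open>Summation by parts as an identity: the old error keeps its weight
    \<open>1 / \<tau> q\<close> inside the induction hypothesis, the new one receives
    \<open>1 / \<tau> (Suc q)\<close>, and their mismatch is \<open>D (Suc q) * E\<close>. The three
    new terms are at most 8, 1 and 7/100 times \<open>\<eta> * E\<close>, hence the constant
    10.\<close>
  have eq: "ln (Y (Suc q)) - ln (F (x (Suc q))) + D (Suc q) / \<tau> (Suc q)
       = (ln (Y q) - ln (F (x q)) + D q / \<tau> q) + (ln (1 - X) + X) + l + D (Suc q) * E"
    unfolding Ys l_def X_eq E_def by (simp add: algebra_simps add_divide_distrib diff_divide_distrib)
  have IH: "\<bar>ln (Y q) - ln (F (x q)) + D q / \<tau> q\<bar> \<le> 10 * \<eta> * (1 / \<tau> q - 1)"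
    using Suc.IH act by (simp add: D_def)
  have "10 * \<eta> * (1 / \<tau> (Suc q) - 1) = 10 * \<eta> * (1 / \<tau> q - 1) + 10 * (\<eta> * E)"
    by (simp add: E_def algebra_simps)
  moreover have "0 \<le> \<eta> * E" using E0 \<eta>_pos by simp
  ultimately have "\<bar>ln (Y (Suc q)) - ln (F (x (Suc q))) + D (Suc q) / \<tau> (Suc q)\<bar> \<le> 
      10 * \<eta> * (1 / \<tau> (Suc q) - 1)"
    unfolding eq using IH e1' e2 e3 by linarith
  then show ?case using Ys by (simp add: D_def)
qed

text \<open>Since 1/\<tau> < 2/\<gamma>, the logarithmic error is at most 21 \<eta>/\<gamma>, which
  is below 1. Exponentiating at most doubles it, and the factor \<open>F (x q) \<le> 1\<close> turns
  the relative error into an absolute one.\<close>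

lemma Y_close:
  assumes "\<gamma> < 2 * \<tau> q"
  shows "\<bar>Y q - F (x q)\<bar> \<le> 42 * \<eta> / \<gamma>"
proof -
  have t: "0 < \<tau> q" using assms \<gamma> by auto
  have xq: "0 \<le> x q" "x q \<le> 1" "H (x q) = \<tau> q" "\<bar>g q - G (x q)\<bar> \<le> 7 * \<eta> / 100"
    using x[of q] g[of q] assms unfolding active_iff \<tau>_def \<eta>_def by auto
  have F: "0 < F (x q)" "F (x q) \<le> 1"
    using H_le[of "x q"] F_mono[of "x q" 1] F_1 xq t by auto
  define \<Delta> where "\<Delta> = ln (Y q) - ln (F (x q))"
  have inv: "1 / \<tau> q \<le> 2 / \<gamma>" using assms \<gamma> t by (simp add: field_simps)
  have *: "\<bar>\<Delta> + (g q - G (x q)) / \<tau> q\<bar> \<le> 10 * \<eta> * (1 / \<tau> q - 1)" and Y: "0 < Y q"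
    using ln_Y[OF assms] by (auto simp: \<Delta>_def)
  have "\<bar>(g q - G (x q)) / \<tau> q\<bar> \<le> 7 * \<eta> / 100 * (1 / \<tau> q)"
    using divide_right_mono[OF xq(4), of "\<tau> q"] t by (simp add: abs_divide)
  with * have "\<bar>\<Delta>\<bar> \<le> 10 * \<eta> * (1 / \<tau> q - 1) + 7 * \<eta> / 100 * (1 / \<tau> q)" by linarith
  also have "\<dots> \<le> (21 / 2 * \<eta>) * (1 / \<tau> q)" using t \<eta>_pos by (simp add: field_simps)
  also have "\<dots> \<le> (21 / 2 * \<eta>) * (2 / \<gamma>)" using inv \<eta>_pos by (intro mult_left_mono) auto
  finally have \<Delta>: "\<bar>\<Delta>\<bar> \<le> 21 * \<eta> / \<gamma>" by simp
  also have "21 * \<eta> / \<gamma> \<le> 1" using \<eta>_le \<gamma> \<eta>_pos by (simp add: field_simps)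
  finally have \<Delta>1: "\<bar>\<Delta>\<bar> \<le> 1" .
  have "\<bar>exp \<Delta> - 1\<bar> \<le> 2 * \<bar>\<Delta>\<bar>"
  proof -
    have "1 + \<Delta> \<le> exp \<Delta>" by (rule exp_ge_add_one_self)
    moreover have "exp \<Delta> \<le> 1 + 2 * \<bar>\<Delta>\<bar>"
    proof (cases "0 \<le> \<Delta>")
      case True
      then have "exp \<Delta> \<le> 1 + \<Delta> + \<Delta>\<^sup>2" using \<Delta>1 by (intro exp_bound) auto
      moreover have "\<Delta>\<^sup>2 \<le> \<Delta>" using True \<Delta>1 by (simp add: power2_eq_square mult_left_le)
      ultimately show ?thesis using True by simp
    next
      case False
      then have "exp \<Delta> \<le> 1" by simp
      then show ?thesis by linarith
    qed
    ultimately show ?thesis by linarith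
  qed
  then have "\<bar>exp \<Delta> - 1\<bar> \<le> 42 * \<eta> / \<gamma>" using \<Delta> by simp
  moreover have "Y q = F (x q) * exp \<Delta>" using F Y by (simp add: \<Delta>_def exp_diff)
  then have "Y q - F (x q) = F (x q) * (exp \<Delta> - 1)" by (simp add: algebra_simps)
  then have "\<bar>Y q - F (x q)\<bar> = F (x q) * \<bar>exp \<Delta> - 1\<bar>" using F by (simp add: abs_mult)
  ultimately show ?thesis using F mult_left_le_one_le[of "\<bar>exp \<Delta> - 1\<bar>" "F (x q)"] by linarith
qed

lemma b_at:
  assumes "\<gamma> < 2 * \<tau> q" "0 < q"
  shows "0 \<le> b q" "b q \<le> 1" "\<bar>H (b q) - \<tau> q\<bar> \<le> \<eta> / 5"
  using b[of q] assms unfolding active_iff \<tau>_def \<eta>_def by auto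

lemma x_at:
  assumes "\<gamma> < 2 * \<tau> q"
  shows "0 \<le> x q" "x q \<le> 1" "H (x q) = \<tau> q"
  using x[of q] assms unfolding active_iff \<tau>_def by auto

text \<open>Breakpoints are controlled only through \<open>H\<close>. Dividing \<open>F_le_H\<close>
  by a lower bound of \<open>H\<close> transfers that control to \<open>F\<close>.\<close>

lemma F_close:
  assumes "0 \<le> u" "u \<le> 1" "0 \<le> v" "v \<le> 1" "c \<le> H u" "0 < c" "H v \<le> H u + e" "0 \<le> e"
  shows "F v \<le> F u + e / c"
proof (cases "v \<le> u")
  case True
  then show ?thesis using F_mono[of v u] assms by (simp add: add_increasing2)
next
  case False
  have "(F v - F u) * c \<le> (F v - F u) * H u"
    using F_mono[of u v] assms False by (intro mult_left_mono) auto
  also have "\<dots> \<le> e" using F_le_H[of u v] assms False by auto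
  finally show ?thesis using assms by (simp add: field_simps)
qed

text \<open>The error 42 \<eta>/\<gamma> is that of \<open>Y_close\<close>; the breakpoint misses
  the quantile by \<eta>/5 in terms of \<open>H\<close>, which adds at most \<eta>/(5 \<gamma>). The
  accuracy 64 \<eta>/\<gamma> is chosen large enough for the tight versions, too.\<close>

lemma record_lower:
  assumes z: "0 \<le> z" "z \<le> 1" "\<gamma> \<le> H z" and q: "\<gamma> < 2 * \<tau> q" "0 < q" "b q \<le> z"
  shows "Y q - 64 * \<eta> / \<gamma> \<le> F z"
proof -
  have "H (b q) \<le> H z" using H_mono b_at[OF q(1,2)] q z by auto
  then have "H (x q) \<le> H z + \<eta> / 5" using b_at[OF q(1,2)] x_at[OF q(1)] by linarith
  then have "F (x q) \<le> F z + (\<eta> / 5) / \<gamma>"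
    using z x_at[OF q(1)] \<gamma> \<eta>_pos by (intro F_close[of z "x q" \<gamma>]) auto
  then show ?thesis using Y_close[OF q(1)] \<eta>_pos \<gamma> by (simp add: field_simps abs_le_iff)
qed

lemma record_upper:
  assumes z: "0 \<le> z" "z \<le> 1" and q: "\<gamma> < 2 * \<tau> q" "0 < q" "z < b q"
  shows "F z \<le> Y q + 64 * \<eta> / \<gamma>"
proof -
  have "H z \<le> H (b q)" using H_mono b_at[OF q(1,2)] q z by auto
  then have "H z \<le> H (x q) + \<eta> / 5" using b_at[OF q(1,2)] x_at[OF q(1)] by linarith
  \<comment> \<open>Here the smaller value of \<open>H\<close> is the one at the quantile, for which
    only the bound \<gamma>/2 is available.\<close>
  then have "F z \<le> F (x q) + (\<eta> / 5) / (\<gamma> / 2)"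
    using z x_at[OF q(1)] \<gamma> \<eta>_pos q(1) by (intro F_close[of "x q" z "\<gamma> / 2"]) auto
  then show ?thesis using Y_close[OF q(1)] \<eta>_pos \<gamma> by (simp add: field_simps abs_le_iff)
qed

lemma record_lower_tight:
  assumes z: "0 \<le> z" "z \<le> 1" "\<gamma> \<le> H z"
  obtains q where "\<gamma> < 2 * \<tau> q" "0 < q" "b q \<le> z" "F z \<le> Y q - 64 * \<eta> / \<gamma> + 128 * \<eta> / \<gamma>"
proof -
  \<comment> \<open>The least \<open>q\<close> with \<open>\<tau> q < H z - \<eta> / 5\<close>. The
    margin covers the error of the breakpoint, so that \<open>b q \<le> z\<close> is forced; being
    least keeps \<open>\<tau> q\<close> within 6 \<eta>/5 of \<open>H z\<close> and thus above
    \<gamma>/2.\<close>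
  define q where "q = Suc (nat \<lfloor>real M - M * H z + 1 / 5\<rfloor>)"
  have Hz: "H z \<le> 1" using H_mono[of z 1] H_1 z by simp
  have "real M * H z \<le> M" using Hz by (simp add: mult_left_le)
  then have nn: "0 \<le> \<lfloor>real M - M * H z + 1 / 5\<rfloor>" by simp
  have q1: "real M - M * H z + 1 / 5 < q" "real q \<le> real M - M * H z + 6 / 5"
    using nn unfolding q_def by linarith+
  have tq: "\<tau> q < H z - \<eta> / 5" "H z - 6 / 5 * \<eta> \<le> \<tau> q"
    using mult_strict_left_mono[OF q1(1) \<eta>_pos] mult_left_mono[OF q1(2), of \<eta>] \<eta>_pos
      \<eta>_M[of 1] \<eta>_M[of "H z"] by (auto simp: \<tau>_eq algebra_simps)
  have act: "\<gamma> < 2 * \<tau> q" using tq z \<eta>_le \<eta>_pos \<gamma> by linarith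
  have "0 < q" by (simp add: q_def)
  note bq = b_at[OF act this] and xq = x_at[OF act]
  have "b q \<le> z"
  proof (rule ccontr)
    assume "\<not> b q \<le> z"
    then have "H z \<le> H (b q)" using H_mono z bq by auto
    then show False using bq tq by linarith
  qed
  moreover have "F z \<le> F (x q) + (6 / 5 * \<eta>) / (\<gamma> / 2)"
    using z xq act tq \<gamma> \<eta>_pos by (intro F_close) auto
  then have "F z \<le> Y q - 64 * \<eta> / \<gamma> + 128 * \<eta> / \<gamma>"
    using Y_close[OF act] \<eta>_pos \<gamma> by (simp add: field_simps abs_le_iff)
  ultimately show ?thesis using that act \<open>0 < q\<close> by blast
qed

text \<open>Close to the top no threshold with positive index lies safely above \<open>H z\<close>.
  There \<open>F z \<ge> H z\<close> is itself almost 1, and the trivial upper bound 1 takes the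
  role of a record.\<close>

lemma record_upper_tight:
  assumes z: "0 \<le> z" "z \<le> 1" "\<gamma> \<le> H z"
  shows "1 \<le> F z + 128 * \<eta> / \<gamma> \<or> 
    (\<exists>q. \<gamma> < 2 * \<tau> q \<and> 0 < q \<and> z < b q \<and> Y q + 64 * \<eta> / \<gamma> \<le> F z + 128 * \<eta> / \<gamma>)"
proof (cases "real M - M * H z - 1 / 5 \<le> 1")
  case True
  then have "1 - 6 / 5 * \<eta> \<le> H z" using M_pos by (simp add: \<eta>_def field_simps)
  moreover have "6 / 5 * \<eta> \<le> 128 * \<eta> / \<gamma>"
    using \<eta>_pos \<gamma> by (simp add: field_simps)
  ultimately show ?thesis using H_le[of z] z by linarith
next
  case False
  \<comment> \<open>The largest \<open>q\<close> with \<open>\<tau> q > H z + \<eta> / 5\<close>; it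
    is positive because the other case was excluded.\<close>
  define q where "q = nat (\<lceil>real M - M * H z - 1 / 5\<rceil> - 1)"
  have c: "2 \<le> \<lceil>real M - M * H z - 1 / 5\<rceil>" using False by linarith
  have q1: "real q < real M - M * H z - 1 / 5" "real M - M * H z - 6 / 5 \<le> real q" "0 < q"
    using c unfolding q_def by linarith+
  have tq: "H z + \<eta> / 5 < \<tau> q" "\<tau> q \<le> H z + 6 / 5 * \<eta>"
    using mult_strict_left_mono[OF q1(1) \<eta>_pos] mult_left_mono[OF q1(2), of \<eta>] \<eta>_pos
      \<eta>_M[of 1] \<eta>_M[of "H z"] by (auto simp: \<tau>_eq algebra_simps)
  have act: "\<gamma> < 2 * \<tau> q" using tq z \<eta>_pos \<gamma> by linarith
  note bq = b_at[OF act q1(3)] and xq = x_at[OF act]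
  have "z < b q"
  proof (rule ccontr)
    assume "\<not> z < b q"
    then have "H (b q) \<le> H z" using H_mono z bq by auto
    then show False using bq tq by linarith
  qed
  moreover have "F (x q) \<le> F z + (6 / 5 * \<eta>) / \<gamma>"
    using z xq act tq \<gamma> \<eta>_pos by (intro F_close) auto
  then have "Y q + 64 * \<eta> / \<gamma> \<le> F z + 128 * \<eta> / \<gamma>"
  proof -
    define e where "e = \<eta> / \<gamma>"
    have e: "c * \<eta> / \<gamma> = c * e" for c by (simp add: e_def)
    have "0 < e" using \<eta>_pos \<gamma> by (simp add: e_def)
    with Y_close[OF act] \<open>F (x q) \<le> F z + (6 / 5 * \<eta>) / \<gamma>\<close> show ?thesis
      unfolding e by linarith
  qed
  ultimately show ?thesis using act q1(3) by blast
qed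

end

section \<open>Combining records by projections onto half-lines\<close>

text \<open>A breakpoint, the accuracy, and the value at the breakpoint for each agent.\<close>

type_synonym estimate = "real \<times> real \<times> (nat \<Rightarrow> real)"

text \<open>A record is a one-sided constraint on the value at \<open>z\<close>: a lower bound if
  its breakpoint is at most \<open>z\<close>, otherwise an upper bound. \<open>foldr\<close> applies
  the head of the list last, so the earlier records have the last word.\<close>

definition combine :: "nat \<Rightarrow> real \<Rightarrow> estimate list \<Rightarrow> real \<Rightarrow> real" where
  "combine i z = foldr (\<lambda>(b, R, Y) v. if b \<le> z then max v (Y i - R) else min v (Y i + R))"

lemma combine_simps [simp]:
  "combine i z [] v = v"
  "combine i z ((b, R, Y) # rs) v =
     (if b \<le> z then max (combine i z rs v) (Y i - R) else min (combine i z rs v) (Y i + R))"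
  "combine i z (rs @ rs') v = combine i z rs (combine i z rs' v)"
  by (auto simp: combine_def)

definition sound_at :: "nat \<Rightarrow> real \<Rightarrow> real \<Rightarrow> estimate \<Rightarrow> bool" where
  "sound_at i z f = (\<lambda>(b, R, Y). if b \<le> z then Y i - R \<le> f else f \<le> Y i + R)"

text \<open>From a start below \<open>f\<close>, upper bounds that are at least \<open>f\<close>
  change nothing, and lower bounds that are at most \<open>f\<close> only raise the value, never
  beyond \<open>f\<close>. So a lower bound stays satisfied once it has been applied.\<close>

lemma combine_below:
  assumes "\<forall>r\<in>set rs. sound_at i z f r" "v \<le> f"
  shows "v \<le> combine i z rs v \<and> combine i z rs v \<le> f \<and>
    (\<forall>b R Y. (b, R, Y) \<in> set rs \<longrightarrow> b \<le> z \<longrightarrow> Y i - R \<le> combine i z rs v)"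
  using assms
proof (induction rs)
  case (Cons r rs)
  obtain b R Y where r: "r = (b, R, Y)" by (cases r)
  have IH: "v \<le> combine i z rs v" "combine i z rs v \<le> f"
      "\<And>b R Y. (b, R, Y) \<in> set rs \<Longrightarrow> b \<le> z \<Longrightarrow> Y i - R \<le> combine i z rs v"
    using Cons by auto
  have "if b \<le> z then Y i - R \<le> f else f \<le> Y i + R"
    using Cons.prems by (auto simp: r sound_at_def)
  then have "combine i z rs v \<le> combine i z (r # rs) v" "combine i z (r # rs) v \<le> f"
    "b \<le> z \<Longrightarrow> Y i - R \<le> combine i z (r # rs) v"
    using IH(2) by (auto simp: r split: if_splits)
  then show ?case using IH(1) IH(3)[THEN order_trans] by (auto simp: r simp del: combine_simps)
qed simp

lemma combine_above:
  assumes "\<forall>r\<in>set rs. sound_at i z f r" "f \<le> v"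
  shows "combine i z rs v \<le> v \<and> f \<le> combine i z rs v \<and>
    (\<forall>b R Y. (b, R, Y) \<in> set rs \<longrightarrow> z < b \<longrightarrow> combine i z rs v \<le> Y i + R)"
  using assms
proof (induction rs)
  case (Cons r rs)
  obtain b R Y where r: "r = (b, R, Y)" by (cases r)
  have IH: "combine i z rs v \<le> v" "f \<le> combine i z rs v"
      "\<And>b R Y. (b, R, Y) \<in> set rs \<Longrightarrow> z < b \<Longrightarrow> combine i z rs v \<le> Y i + R"
    using Cons by auto
  have "if b \<le> z then Y i - R \<le> f else f \<le> Y i + R"
    using Cons.prems by (auto simp: r sound_at_def)
  then have "combine i z (r # rs) v \<le> combine i z rs v" "f \<le> combine i z (r # rs) v"
    "z < b \<Longrightarrow> combine i z (r # rs) v \<le> Y i + R"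
    using IH(2) by (auto simp: r split: if_splits)
  then show ?case using IH(1) order_trans[OF _ IH(3)] by (auto simp: r simp del: combine_simps)
qed simp

text \<open>Only the records up to some scale need to be sound: the later ones only determine the value
  from which the projections onto the half-lines of the sound records start.\<close>

lemma combine_close:
  assumes sound: "\<forall>r\<in>set rs. sound_at i z f r" and f: "f \<le> 1" and e: "0 \<le> e"
    and lower: "\<exists>(b, R, Y)\<in>set rs. b \<le> z \<and> f - e \<le> Y i - R"
    and upper: "1 \<le> f + e \<or> (\<exists>(b, R, Y)\<in>set rs. z < b \<and> Y i + R \<le> f + e)"
  shows "\<bar>min 1 (combine i z rs v) - f\<bar> \<le> e"
proof (cases "v \<le> f")
  \<comment> \<open>Sound projections never cross \<open>f\<close>. So the side of the start value
    decides which of \<open>lower\<close> and \<open>upper\<close> yields the estimate.\<close>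
  case True
  then show ?thesis using combine_below[OF sound True] lower f e by fastforce
next
  case False
  then have fv: "f \<le> v" by simp
  show ?thesis using combine_above[OF sound fv] upper f e by (fastforce simp: min_def)
qed

text \<open>When a breakpoint passes from above the argument to below it, a minimum with the current
  value is replaced by a maximum with it, whatever the accuracy is.\<close>

lemma combine_mono: "z \<le> z' \<Longrightarrow> v \<le> v' \<Longrightarrow> combine i z rs v \<le> combine i z' rs v'"
  by (induction rs) (auto simp: min_def max_def)

lemma combine_cong:
  "(\<And>b R Y. (b, R, Y) \<in> set rs \<Longrightarrow> b \<le> z \<longleftrightarrow> b \<le> z') \<Longrightarrow> combine i z rs v = combine i z' rs v"
  by (induction rs) fastforce+

section \<open>Step functions as distribution functions\<close>

definition step_fun :: "(nat \<Rightarrow> real) \<Rightarrow> (nat \<Rightarrow> real) \<Rightarrow> nat \<Rightarrow> real \<Rightarrow> real" where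
  "step_fun x y m z = Max (insert 0 {y l |l. l < m \<and> x l \<le> z})"

lemma step_fun_is_cdf:
  assumes x: "\<And>l. l < m \<Longrightarrow> 0 \<le> x l \<and> x l \<le> 1" and y: "\<And>l. l < m \<Longrightarrow> y l \<le> 1"
    and m: "0 < m" and 0: "x 0 = 1" "y 0 = 1"
  shows "is_cdf (step_fun x y m)"
proof -
  let ?G = "step_fun x y m"
  have mono: "?G z \<le> ?G z'" if "z \<le> z'" for z z'
    unfolding step_fun_def using that by (intro Max_mono) auto
  have neg: "?G z = 0" if "z < 0" for z
  proof -
    have empty: "{y l |l. l < m \<and> x l \<le> z} = {}" using that x by force
    show ?thesis unfolding step_fun_def empty by simp
  qed
  have one: "?G z = 1" if "1 \<le> z" for z
    unfolding step_fun_def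
  proof (rule Max_eqI)
    show "1 \<in> insert 0 {y l |l. l < m \<and> x l \<le> z}" using m 0 that by force
  qed (use y in auto)
  have right: "continuous (at_right a) ?G" for a
  proof -
    let ?B = "{x l |l. l < m \<and> a < x l}"
    \<comment> \<open>The next breakpoint to the right of \<open>a\<close>, or \<open>a + 1\<close>
      if there is none: the function is constant from \<open>a\<close> up to \<open>d\<close>, which
      gives right continuity.\<close>
    define d where "d = Min (insert (a + 1) ?B)"
    have fin: "finite (insert (a + 1) ?B)" by auto
    have d: "a < d" unfolding d_def using fin by (subst Min_gr_iff) auto
    have le: "d \<le> x l" if "l < m" "a < x l" for l
      unfolding d_def using that fin by (intro Min_le) auto
    have "?G w = ?G a" if "w \<in> {a<..<d}" for w
    proof -
      have "{y l |l. l < m \<and> x l \<le> w} = {y l |l. l < m \<and> x l \<le> a}"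
        using that le by force
      then show ?thesis by (simp add: step_fun_def)
    qed
    then have "eventually (\<lambda>w. ?G w = ?G a) (at_right a)"
      using eventually_at_right_real[OF d] by (auto elim: eventually_mono)
    then show ?thesis
      unfolding continuous_within by (rule tendsto_eventually)
  qed
  have bot: "(?G \<longlongrightarrow> 0) at_bot"
    by (rule tendsto_eventually, rule eventually_mono[OF eventually_gt_at_bot[of "0::real"]]) 
       (auto intro: neg)
  have top: "(?G \<longlongrightarrow> 1) at_top"
    by (rule tendsto_eventually, rule eventually_mono[OF eventually_ge_at_top[of "1::real"]])
       (auto intro: one)
  show ?thesis unfolding is_cdf_def
    using real_distribution_interval_measure[OF mono right bot top]
      cdf_interval_measure[OF mono right bot] by metis
qed

section \<open>The law of the winner\<close>

lemma winner_max:
  "winner k X r \<in> {1..k + 1}" "j \<in> {1..k + 1} \<Longrightarrow> (X(k + 1 := r)) j \<le> (X(k + 1 := r)) (winner k X r)"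
proof -
  let ?Y = "X(k + 1 := r)"
  have "\<exists>w. is_arg_max ?Y (\<lambda>x. x \<in> {1..k + 1}) w"
  proof -
    have "\<exists>w\<in>S. \<forall>j\<in>S. f j \<le> f w" if "finite S" "S \<noteq> {}" for S :: "nat set" and f :: "nat \<Rightarrow> real"
      using Max_in[of "f ` S"] Max_ge[of "f ` S"] that by fastforce
    from this[of "{1..k + 1}" ?Y] show ?thesis
      unfolding is_arg_max_linorder by (auto simp del: fun_upd_apply)
  qed
  then have "is_arg_max ?Y (\<lambda>x. x \<in> {1..k + 1}) (winner k X r)"
    unfolding winner_def arg_max_on_def arg_max_def by (rule someI_ex)
  then show "winner k X r \<in> {1..k + 1}" "j \<in> {1..k + 1} \<Longrightarrow> ?Y j \<le> ?Y (winner k X r)"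
    by (auto simp: is_arg_max_linorder simp del: fun_upd_apply)
qed

lemma winner_eqI:
  assumes "w \<in> {1..k + 1}" "\<And>j. j \<in> {1..k + 1} \<Longrightarrow> j \<noteq> w \<Longrightarrow> (X(k + 1 := r)) j < (X(k + 1 := r)) w"
  shows "winner k X r = w"
  using winner_max(2)[of w k X r] winner_max(1)[of k X r] assms by (metis not_less)

section \<open>Laws of the bids, Lipschitz bounds, absence of ties\<close>

locale auction =
  fixes k :: nat and L :: real and F :: "nat \<Rightarrow> real \<Rightarrow> real"
  assumes k: "2 \<le> k"
    and marginals: "\<forall>i\<in>{1..k}. is_cdf (F i) \<and> continuous_on UNIV (F i) \<and> supported_unit (F i) \<and>
                   lipschitz_density L (F i)"
begin

lemma marginal:
  assumes "i \<in> {1..k}"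
  shows "is_cdf (F i)" "continuous_on UNIV (F i)" "isCont (F i) x" "supported_unit (F i)" "lipschitz_density L (F i)"
  using bspec[OF marginals assms] continuous_on_eq_continuous_at[of UNIV "F i"] by auto

text \<open>A probability measure for every index: the product locale demands one outside
  \<open>{1..k}\<close> as well, where \<open>interval_measure (F i)\<close> may be
  arbitrary.\<close>

definition bidder :: "nat \<Rightarrow> real measure" where
  "bidder i = (if i \<in> {1..k} then interval_measure (F i) else return borel 0)"

lemma real_distribution_bid:
  assumes "i \<in> {1..k}"
  shows "real_distribution (interval_measure (F i))" "cdf (interval_measure (F i)) = F i"
proof -
  obtain M where M: "real_distribution M" "F i = cdf M"
    using marginal(1)[OF assms] by (auto simp: is_cdf_def)
  interpret M: real_distribution M by fact
  note props = M.cdf_nondecreasing M.cdf_is_right_cont M.cdf_lim_at_bot M.cdf_lim_at_top_prob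
  show "real_distribution (interval_measure (F i))"
    unfolding M(2) by (intro real_distribution_interval_measure props)
  show "cdf (interval_measure (F i)) = F i"
    unfolding M(2) by (intro cdf_interval_measure props)
qed

lemma prob_space_bidder: "prob_space (bidder i)"
proof (cases "i \<in> {1..k}")
  case True
  interpret real_distribution "interval_measure (F i)" by (rule real_distribution_bid) fact
  have "bidder i = interval_measure (F i)" unfolding bidder_def using True by (rule if_P)
  then show ?thesis using prob_space_axioms by simp
next
  case False
  then show ?thesis unfolding bidder_def by (simp only: if_False) (rule prob_space_return, simp)
qed

sublocale bids: product_prob_space bidder "{1..k}"
  by (intro product_prob_spaceI prob_space_bidder)

lemma bid_law_eq: "bid_law k F = Pi\<^sub>M {1..k} bidder"
  unfolding bid_law_def by (intro PiM_cong) (auto simp: bidder_def)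

sublocale bid: prob_space "bid_law k F"
  unfolding bid_law_eq by (intro prob_space_PiM prob_space_bidder)

sublocale sample: product_prob_space "\<lambda>_. bid_law k F" "{..<n}" for n :: nat
  by (intro product_prob_spaceI bid.prob_space_axioms)

lemma sample_prob_space: "prob_space (sample_law n k F)"
  unfolding sample_law_def by (intro prob_space_PiM bid.prob_space_axioms)

lemma sets_bidder [simp, measurable_cong]: "sets (bidder i) = sets borel"
  by (simp add: bidder_def)

lemma space_bidder [simp]: "space (bidder i) = UNIV"
  using sets_eq_imp_space_eq[OF sets_bidder[of i]] by simp

lemma bid_coord [measurable]: "i \<in> {1..k} \<Longrightarrow> (\<lambda>X. X i) \<in> borel_measurable (bid_law k F)"
  unfolding bid_law_eq using measurable_component_singleton[of i "{1..k}" bidder]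
  by (simp cong: measurable_cong_sets)

lemma bid_sets:
  assumes "J \<subseteq> {1..k}" "\<And>i. i \<in> J \<Longrightarrow> A i \<in> sets borel"
  shows "{X \<in> space (bid_law k F). \<forall>i\<in>J. X i \<in> A i} \<in> sets (bid_law k F)"
proof (cases "J = {}")
  case False
  have "{X \<in> space (bid_law k F). X i \<in> A i} \<in> sets (bid_law k F)" if "i \<in> J" for i
  proof -
    have "{X \<in> space (bid_law k F). X i \<in> A i} = (\<lambda>X. X i) -` A i \<inter> space (bid_law k F)" by auto
    then show ?thesis using measurable_sets[OF bid_coord] assms that by auto
  qed
  then show ?thesis
    using finite_subset[OF assms(1)] False by (intro sets.sets_Collect_finite_All) auto
qed simp

lemma bid_prob:
  assumes "J \<subseteq> {1..k}" "\<And>i. i \<in> J \<Longrightarrow> A i \<in> sets borel"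
  shows "measure (bid_law k F) {X \<in> space (bid_law k F). \<forall>i\<in>J. X i \<in> A i} = (\<Prod>i\<in>J. measure (bidder i) (A i))"
proof -
  have "finite J" using assms(1) by (rule finite_subset) simp
  have "emeasure (bid_law k F) {X \<in> space (bid_law k F). \<forall>i\<in>J. X i \<in> A i} = (\<Prod>i\<in>J. emeasure (bidder i) (A i))"
    unfolding bid_law_eq using assms \<open>finite J\<close> by (intro bids.emeasure_PiM_Collect) auto
  also have "\<dots> = ennreal (\<Prod>i\<in>J. measure (bidder i) (A i))"
    by (simp add: bids.M.emeasure_eq_measure prod_ennreal)
  finally show ?thesis
    by (simp add: bid.emeasure_eq_measure prod_nonneg)
qed

lemma bidder_intervals:
  assumes i: "i \<in> {1..k}"
  shows "measure (bidder i) {..a} = F i a" "measure (bidder i) {..<a} = F i a"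
    "a \<le> b \<Longrightarrow> measure (bidder i) {a<..b} = F i b - F i a" "measure (bidder i) {a} = 0"
proof -
  interpret D: real_distribution "interval_measure (F i)" by (rule real_distribution_bid) fact
  have cdf: "D.prob {..a} = F i a" for a
    using real_distribution_bid(2)[OF i] by (simp add: cdf_def fun_eq_iff)
  show 1: "measure (bidder i) {..a} = F i a" using i cdf by (simp add: bidder_def)
  show "a \<le> b \<Longrightarrow> measure (bidder i) {a<..b} = F i b - F i a"
    using D.cdf_diff_eq[of a b] real_distribution_bid(2)[OF i] i
    by (cases "a = b") (auto simp: bidder_def)
  have "isCont (cdf (interval_measure (F i))) a"
    unfolding real_distribution_bid(2)[OF i]
    by (rule marginal(3)[OF i])
  then have z: "D.prob {a} = 0" using D.isCont_cdf by blast
  then show 2: "measure (bidder i) {a} = 0" using i by (simp add: bidder_def)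
  have "{..a} = {..<a} \<union> {a}" by auto
  then have "D.prob {..a} = D.prob {..<a} + D.prob {a}"
    by (simp only:) (rule D.finite_measure_Union, auto)
  then show "measure (bidder i) {..<a} = F i a" using cdf[of a] z i by (simp add: bidder_def)
qed

lemma F_unit:
  assumes i: "i \<in> {1..k}"
  shows "0 \<le> F i a" "F i a \<le> 1" "a \<le> b \<Longrightarrow> F i a \<le> F i b" "F i 1 = 1" "F i 0 = 0"
proof -
  interpret D: real_distribution "interval_measure (F i)" by (rule real_distribution_bid) fact
  show "0 \<le> F i a" "F i a \<le> 1" "a \<le> b \<Longrightarrow> F i a \<le> F i b"
    using D.cdf_nonneg[of a] D.cdf_bounded_prob[of a] D.cdf_nondecreasing[of a b]
    unfolding real_distribution_bid(2)[OF i] by auto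
  have supp: "\<And>x. x < 0 \<Longrightarrow> F i x = 0" and "F i 1 = 1" 
    using marginal(4)[OF i] by (auto simp: supported_unit_def)
  show "F i 1 = 1" by fact
  \<comment> \<open>The support condition fixes the values to the left of 0; continuity carries them
    over to 0.\<close>
  have "isCont (F i) 0" by (rule marginal(3)[OF i])
  then have "(F i \<longlongrightarrow> F i 0) (at_left 0)"
    by (simp add: continuous_within filterlim_at_split isCont_def)
  moreover have "(F i \<longlongrightarrow> 0) (at_left 0)"
    by (rule tendsto_eventually) (auto simp: eventually_at_filter supp)
  ultimately show "F i 0 = 0" by (rule tendsto_unique[rotated]) simp
qed

lemma L_nonneg: "0 \<le> L"
proof -
  have "1 \<in> {1..k}" using k by simp
  then obtain f where "L-lipschitz_on {0..1} (f :: real \<Rightarrow> real)"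
    using marginal(5)[of 1] by (auto simp: lipschitz_density_def)
  then show ?thesis by (rule lipschitz_on_nonneg)
qed

text \<open>If the density exceeded 1 + L at a point of the unit interval, the Lipschitz condition
  would keep it above 1 on the whole interval, and the total mass would exceed 1.\<close>

lemma F_lipschitz:
  assumes i: "i \<in> {1..k}" and ab: "0 \<le> a" "a \<le> b" "b \<le> 1"
  shows "F i b - F i a \<le> (1 + L) * (b - a)"
proof -
  obtain f where f: "f \<in> borel_measurable borel" "\<And>x. 0 \<le> f x" "L-lipschitz_on {0..1} f"
      "interval_measure (F i) = density lborel (\<lambda>x. ennreal (f x))"
    using marginal(5)[OF i] by (auto simp: lipschitz_density_def)
  interpret D: real_distribution "interval_measure (F i)" by (rule real_distribution_bid) fact
  have em: "emeasure (interval_measure (F i)) A = (\<integral>\<^sup>+x. ennreal (f x) * indicator A x \<partial>lborel)"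
    if "A \<in> sets borel" for A
    unfolding f(4) using f(1) that by (intro emeasure_density) auto
  have bound: "f x \<le> 1 + L" if x: "0 \<le> x" "x \<le> 1" for x
  proof (rule ccontr)
    assume "\<not> f x \<le> 1 + L"
    define c where "c = f x - L"
    have c: "1 < c" using \<open>\<not> f x \<le> 1 + L\<close> by (simp add: c_def)
    have ge: "c \<le> f y" if "y \<in> {0..1}" for y
    proof -
      have "dist (f x) (f y) \<le> L * dist x y"
        using f(3) that x by (intro lipschitz_onD) auto
      also have "\<dots> \<le> L * 1" using that x L_nonneg by (intro mult_left_mono) (auto simp: dist_real_def)
      finally show ?thesis by (simp add: dist_real_def c_def)
    qed
    have "ennreal c = (\<integral>\<^sup>+y. ennreal c * indicator {0..1::real} y \<partial>lborel)"
      by (subst nn_integral_cmult_indicator) auto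
    also have "\<dots> \<le> (\<integral>\<^sup>+y. ennreal (f y) * indicator {0..1::real} y \<partial>lborel)"
      using ge by (intro nn_integral_mono) (auto simp: indicator_def intro!: ennreal_leI)
    also have "\<dots> = emeasure (interval_measure (F i)) {0..1}" by (simp add: em)
    also have "\<dots> \<le> ennreal 1" using D.prob_le_1[of "{0..1}"] by (simp add: D.emeasure_eq_measure)
    finally show False using c by (simp add: ennreal_le_iff)
  qed
  have "ennreal (F i b - F i a) = emeasure (interval_measure (F i)) {a<..b}"
    using bidder_intervals(3)[OF i ab(2)] i by (simp add: bidder_def D.emeasure_eq_measure)
  also have "\<dots> = (\<integral>\<^sup>+x. ennreal (f x) * indicator {a<..b} x \<partial>lborel)" by (simp add: em)
  also have "\<dots> \<le> (\<integral>\<^sup>+x. ennreal (1 + L) * indicator {a<..b} x \<partial>lborel)"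
    using bound ab by (intro nn_integral_mono) (auto simp: indicator_def intro!: ennreal_leI)
  also have "\<dots> = ennreal ((1 + L) * (b - a))"
    using L_nonneg ab by (simp add: nn_integral_cmult_indicator ennreal_mult)
  finally show ?thesis using L_nonneg ab by (simp add: ennreal_le_iff)
qed

definition H :: "real \<Rightarrow> real" where "H r = (\<Prod>i\<in>{1..k}. F i r)"

definition rest :: "nat \<Rightarrow> real \<Rightarrow> real" where "rest i r = (\<Prod>j\<in>{1..k} - {i}. F j r)"

lemma H_rest: "i \<in> {1..k} \<Longrightarrow> H r = F i r * rest i r"
  unfolding H_def rest_def by (intro prod.remove) auto

lemma rest_unit: "0 \<le> rest i r" "rest i r \<le> 1" "r \<le> s \<Longrightarrow> rest i r \<le> rest i s"
  unfolding rest_def by (auto intro!: prod_nonneg prod_le_1 prod_mono simp: F_unit)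

lemma H_unit: "0 \<le> H r" "H r \<le> 1" "r \<le> s \<Longrightarrow> H r \<le> H s" "H 1 = 1" "H 0 = 0"
  unfolding H_def using k by (auto intro!: prod_nonneg prod_le_1 prod_mono simp: F_unit)

lemma H_continuous: "continuous_on S H"
  unfolding H_def by (intro continuous_on_prod continuous_on_subset[OF marginal(2)]) auto

lemma H_lipschitz:
  assumes "0 \<le> a" "a \<le> b" "b \<le> 1"
  shows "H b - H a \<le> k * (1 + L) * (b - a)"
proof -
  have "norm (H b - H a) \<le> (\<Sum>i\<in>{1..k}. norm (F i b - F i a))"
    unfolding H_def by (intro norm_prod_diff) (auto simp: F_unit)
  also have "\<dots> \<le> (\<Sum>i\<in>{1..k}. (1 + L) * (b - a))"
    using F_lipschitz assms F_unit(3) by (intro sum_mono) auto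
  finally show ?thesis by simp
qed

lemma H_le_p: "measure (bid_law k F) {X \<in> space (bid_law k F). \<forall>i\<in>{1..k}. X i \<le> p} = H p"
  using bid_prob[of "{1..k}" "\<lambda>_. {..p}"] by (simp add: H_def bidder_intervals)

text \<open>Cut the unit interval into N cells. In a tie both bids share a cell. Bid
  \<open>i\<close> falls into a given cell with probability at most (1 + L)/N, and the probabilities
  of the cells under bid \<open>j\<close> sum to 1, so a tie has probability at most (1 + L)/N for
  every N.\<close>

lemma AE_no_tie:
  assumes ij: "i \<in> {1..k}" "j \<in> {1..k}" "i \<noteq> j"
  shows "AE X in bid_law k F. X i \<noteq> X j"
proof -
  let ?E = "{X \<in> space (bid_law k F). X i = X j}"
  have E: "?E \<in> sets (bid_law k F)" using ij by measurable
  have cells: "measure (bid_law k F) ?E \<le> (1 + L) / N" if N: "0 < N" for N :: nat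
  proof -
    define C where "C m = {real m / N <.. real (Suc m) / N}" for m
    have split: "\<exists>m<N. x \<in> C m" if "0 < x" "x \<le> 1" for x :: real
    proof -
      define m where "m = nat (\<lceil>x * N\<rceil> - 1)"
      have c: "0 < \<lceil>x * N\<rceil>" using that N by simp
      then have "real m < x * N" "x * N \<le> real m + 1" unfolding m_def by linarith+
      moreover have "x * N \<le> N" using that mult_right_mono[of x 1 "real N"] by simp
      moreover have "real m < real N" using \<open>real m < x * N\<close> \<open>x * N \<le> N\<close> by linarith
      ultimately have "m < N" "x \<in> C m" using N by (auto simp: C_def field_simps)
      then show ?thesis by blast
    qed
    let ?P = "measure (bid_law k F)" and ?S = "space (bid_law k F)"
    define Out where "Out = {X \<in> ?S. \<forall>l\<in>{i}. X l \<in> - {0<..1}}"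
    define D where "D m = {X \<in> ?S. \<forall>l\<in>{i, j}. X l \<in> C m}" for m
    have Out: "?P Out = 0"
    proof -
      have "measure (bidder i) (- {0<..1}) = 1 - measure (bidder i) {0<..1}"
        using bids.M.prob_compl[of "{0<..1}" i] by (simp add: Compl_eq_Diff_UNIV)
      also have "\<dots> = 0" using ij by (simp add: bidder_intervals F_unit)
      finally show ?thesis unfolding Out_def using ij by (subst bid_prob) auto
    qed
    have dF: "measure (bidder l) (C m) = F l (real (Suc m) / N) - F l (real m / N)" if "l \<in> {1..k}" for l m
      unfolding C_def using that N by (intro bidder_intervals) (auto simp: divide_right_mono)
    have D: "?P (D m) \<le> (1 + L) / N * (F j (real (Suc m) / N) - F j (real m / N))" if "m < N" for m
    proof -
      have "?P (D m) = measure (bidder i) (C m) * measure (bidder j) (C m)"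
        unfolding D_def using ij by (subst bid_prob) (auto simp: C_def)
      moreover have "measure (bidder i) (C m) \<le> (1 + L) / N"
      proof -
        have "real (Suc m) / N - real m / N = 1 / N" by (simp add: add_divide_distrib)
        then show ?thesis
          using F_lipschitz[OF ij(1), of "real m / N" "real (Suc m) / N"] that N
          unfolding dF[OF ij(1)] by (simp add: divide_right_mono)
      qed
      ultimately have "?P (D m) \<le> (1 + L) / N * measure (bidder j) (C m)"
        by (simp only: mult_right_mono measure_nonneg)
      then show ?thesis unfolding dF[OF ij(2)] .
    qed
    have sO: "Out \<in> sets (bid_law k F)" unfolding Out_def using ij by (intro bid_sets) auto
    have sD: "D m \<in> sets (bid_law k F)" for m unfolding D_def C_def using ij by (intro bid_sets) auto
    have "?E \<subseteq> Out \<union> (\<Union>m<N. D m)"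
    proof
      fix X assume X: "X \<in> ?E"
      show "X \<in> Out \<union> (\<Union>m<N. D m)"
      proof (cases "X i \<in> {0<..1}")
        case True
        then obtain m where "m < N" "X i \<in> C m" using split by auto
        then show ?thesis using X by (auto simp: D_def)
      qed (use X in \<open>auto simp: Out_def\<close>)
    qed
    then have "?P ?E \<le> ?P (Out \<union> (\<Union>m<N. D m))"
      using sO sD by (intro bid.finite_measure_mono) auto
    also have "\<dots> \<le> ?P Out + ?P (\<Union>m<N. D m)"
      using sO sD by (intro measure_Un_le) auto
    also have "\<dots> \<le> 0 + (\<Sum>m<N. ?P (D m))"
      unfolding Out using sD by (intro add_left_mono measure_UNION_le) auto
    also have "\<dots> \<le> 0 + (\<Sum>m<N. (1 + L) / N * (F j (real (Suc m) / N) - F j (real m / N)))"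
      using D by (intro add_left_mono sum_mono) auto
    also have "\<dots> = (1 + L) / N * (F j (real N / N) - F j (real 0 / N))"
      unfolding sum_distrib_left[symmetric] 
      using sum_lessThan_telescope[of "\<lambda>m. F j (real m / N)" N] by simp
    also have "\<dots> = (1 + L) / N" using N ij by (simp add: F_unit)
    finally show ?thesis .
  qed
  have "measure (bid_law k F) ?E \<le> 0"
  proof (rule field_le_epsilon)
    fix e :: real assume e: "0 < e"
    obtain N where N: "(1 + L) / e < real N" using reals_Archimedean2 by blast
    have "0 \<le> (1 + L) / e" using L_nonneg e by simp
    then have "0 < N" using N by (cases N) auto
    have "(1 + L) / N \<le> e" using N e \<open>0 < N\<close> by (simp add: field_simps)
    then show "measure (bid_law k F) ?E \<le> 0 + e" using cells[OF \<open>0 < N\<close>] by simp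
  qed
  then have "measure (bid_law k F) ?E = 0" using measure_nonneg[of "bid_law k F" ?E] by linarith
  then show ?thesis
    using E by (subst AE_iff_measurable[where N = ?E]) (auto simp: bid.emeasure_eq_measure)
qed

lemma AE_not_price:
  assumes i: "i \<in> {1..k}"
  shows "AE X in bid_law k F. X i \<noteq> r"
proof -
  let ?E = "{X \<in> space (bid_law k F). \<forall>l\<in>{i}. X l \<in> {r}}"
  have "measure (bid_law k F) ?E = (\<Prod>l\<in>{i}. measure (bidder l) {r})"
    using i by (intro bid_prob) auto
  then have "measure (bid_law k F) ?E = 0"
    by (simp add: bidder_intervals(4)[OF i])
  moreover have "?E = {X \<in> space (bid_law k F). X i = r}" by auto
  then have "?E \<in> sets (bid_law k F)" using i by simp
  ultimately show ?thesis
    by (subst AE_iff_measurable[where N = ?E]) (auto simp: bid.emeasure_eq_measure)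
qed

text \<open>Ties are broken by the choice operator, so nothing is known about the value chosen. But
  it is a function of the set of maximisers, and this set takes finitely many values, each on an
  event defined by comparisons.\<close>

lemma winner_measurable [measurable]: "(\<lambda>X. winner k X r) \<in> measurable (bid_law k F) (count_space UNIV)"
proof -
  define S where "S X = {w \<in> {1..k + 1}. \<forall>j\<in>{1..k + 1}. (X(k + 1 := r)) j \<le> (X(k + 1 := r)) w}" for X
  have "winner k X r = (SOME w. w \<in> S X)" for X
    unfolding winner_def arg_max_on_def arg_max_def S_def is_arg_max_linorder
    by (simp only: mem_Collect_eq Ball_def)
  moreover have "(\<lambda>X. SOME w. w \<in> S X) \<in> measurable (bid_law k F) (count_space UNIV)"
  proof (rule measurable_compose[where g = "\<lambda>A. SOME w. w \<in> A"])
    have coord: "(\<lambda>X. (X(k + 1 := r)) j) \<in> borel_measurable (bid_law k F)" if "j \<in> {1..k + 1}" for j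
      using that by (cases "j = k + 1") auto
    show "S \<in> measurable (bid_law k F) (count_space (Pow {1..k + 1}))"
    proof (rule measurable_count_space_eq2[THEN iffD2])
      show "S \<in> space (bid_law k F) \<rightarrow> Pow {1..k + 1} \<and>
        (\<forall>A\<in>Pow {1..k + 1}. S -` {A} \<inter> space (bid_law k F) \<in> sets (bid_law k F))"
      proof (intro conjI ballI)
        fix A assume "A \<in> Pow {1..k + 1}"
        then have "S -` {A} \<inter> space (bid_law k F) = {X \<in> space (bid_law k F). \<forall>w\<in>{1..k + 1}.
            w \<in> A \<longleftrightarrow> (\<forall>j\<in>{1..k + 1}. (X(k + 1 := r)) j \<le> (X(k + 1 := r)) w)}"
          unfolding S_def by blast
        also have "\<dots> \<in> sets (bid_law k F)"
        proof (intro sets.sets_Collect_finite_All')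
          fix w assume w: "w \<in> {1..k + 1}"
          have "{X \<in> space (bid_law k F). \<forall>j\<in>{1..k + 1}. (X(k + 1 := r)) j \<le> (X(k + 1 := r)) w} \<in> sets (bid_law k F)"
            using coord w by (intro sets.sets_Collect_finite_All' borel_measurable_le) auto
          then show "{X \<in> space (bid_law k F). w \<in> A \<longleftrightarrow>
              (\<forall>j\<in>{1..k + 1}. (X(k + 1 := r)) j \<le> (X(k + 1 := r)) w)} \<in> sets (bid_law k F)"
            by (cases "w \<in> A") (simp_all only: simp_thms sets.sets_Collect_neg)
        qed auto
        finally show "S -` {A} \<inter> space (bid_law k F) \<in> sets (bid_law k F)" .
      qed (auto simp: S_def)
    qed simp
  qed simp
  ultimately show ?thesis by simp
qed

section \<open>Winning probabilities as functions of the price\<close>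

definition win_prob :: "real \<Rightarrow> nat \<Rightarrow> real" where
  "win_prob r w = measure (bid_law k F) {X \<in> space (bid_law k F). winner k X r = w}"

lemma winner_sets: "{X \<in> space (bid_law k F). winner k X r = w} \<in> sets (bid_law k F)"
  by measurable

lemma win_prob_nonneg: "0 \<le> win_prob r w"
  by (simp add: win_prob_def)

lemma sum_win_prob: "(\<Sum>w\<in>{1..k + 1}. win_prob r w) = 1"
proof -
  have "(\<Sum>w\<in>{1..k + 1}. win_prob r w) =
      measure (bid_law k F) (\<Union>w\<in>{1..k + 1}. {X \<in> space (bid_law k F). winner k X r = w})"
    unfolding win_prob_def using winner_sets
    by (intro bid.finite_measure_finite_Union[symmetric]) (auto simp: disjoint_family_on_def)
  also have "(\<Union>w\<in>{1..k + 1}. {X \<in> space (bid_law k F). winner k X r = w}) = space (bid_law k F)"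
    using winner_max(1)[of k _ r] by auto
  finally show ?thesis by (simp add: bid.prob_space)
qed

text \<open>The price wins if all bids are below it, and only if all bids are at most it. Both
  events have probability \<open>H r\<close>, as the distributions are continuous.\<close>

lemma win_prob_price: "win_prob r (k + 1) = H r"
proof (rule antisym)
  have "win_prob r (k + 1) \<le> measure (bid_law k F) {X \<in> space (bid_law k F). \<forall>i\<in>{1..k}. X i \<in> {..r}}"
    unfolding win_prob_def
  proof (intro bid.finite_measure_mono subsetI)
    fix X assume X: "X \<in> {X \<in> space (bid_law k F). winner k X r = k + 1}"
    show "X \<in> {X \<in> space (bid_law k F). \<forall>i\<in>{1..k}. X i \<in> {..r}}"
    proof (intro CollectI conjI ballI)
      fix i assume "i \<in> {1..k}"
      then show "X i \<in> {..r}" using X winner_max(2)[of i k X r] by auto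
    qed (use X in auto)
  qed (intro bid_sets, auto)
  also have "\<dots> = H r"
    by (subst bid_prob) (auto simp: H_def bidder_intervals)
  finally show "win_prob r (k + 1) \<le> H r" .
  have "H r = measure (bid_law k F) {X \<in> space (bid_law k F). \<forall>i\<in>{1..k}. X i \<in> {..<r}}"
    by (subst bid_prob) (auto simp: H_def bidder_intervals)
  also have "\<dots> \<le> win_prob r (k + 1)"
    unfolding win_prob_def
    by (intro bid.finite_measure_mono subsetI winner_sets) (auto intro!: winner_eqI)
  finally show "H r \<le> win_prob r (k + 1)" .
qed

lemma win_prob_bidder:
  assumes i: "i \<in> {1..k}"
  shows "win_prob r i = measure (bid_law k F)
    {X \<in> space (bid_law k F). r < X i \<and> (\<forall>j\<in>{1..k} - {i}. X j < X i)}"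
  unfolding win_prob_def
proof (rule bid.finite_measure_eq_AE)
  have "AE X in bid_law k F. X i \<noteq> r \<and> (\<forall>j\<in>{1..k} - {i}. X i \<noteq> X j)"
    using AE_not_price[OF i] AE_no_tie[OF i] by (intro AE_conjI AE_finite_allI) auto
  then show "AE X in bid_law k F. X \<in> {X \<in> space (bid_law k F). winner k X r = i} \<longleftrightarrow>
      X \<in> {X \<in> space (bid_law k F). r < X i \<and> (\<forall>j\<in>{1..k} - {i}. X j < X i)}"
  proof eventually_elim
    case (elim X)
    have "winner k X r = i \<longleftrightarrow> r < X i \<and> (\<forall>j\<in>{1..k} - {i}. X j < X i)"
    proof
      assume w: "winner k X r = i"
      have "r \<le> X i" using winner_max(2)[of "k + 1" k X r] w i by auto
      moreover have "X j \<le> X i" if "j \<in> {1..k}" for j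
        using winner_max(2)[of j k X r] w i that by auto
      ultimately show "r < X i \<and> (\<forall>j\<in>{1..k} - {i}. X j < X i)"
        using elim by (metis DiffD1 order_less_le)
    next
      assume "r < X i \<and> (\<forall>j\<in>{1..k} - {i}. X j < X i)"
      then show "winner k X r = i" using i by (intro winner_eqI) auto
    qed
    then show ?case by auto
  qed
  show "{X \<in> space (bid_law k F). r < X i \<and> (\<forall>j\<in>{1..k} - {i}. X j < X i)} \<in> sets (bid_law k F)"
    using i by measurable
qed (rule winner_sets)

text \<open>Agent \<open>i\<close> wins at price \<open>a\<close> but not at price \<open>b\<close>
  exactly if the bid lies in \<open>{a<..b}\<close> and beats all others. This event contains the
  box where the others are at most \<open>a\<close>, and is contained in the box where they are at
  most \<open>b\<close>; boxes have product probabilities.\<close>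

lemma win_prob_diff:
  assumes i: "i \<in> {1..k}" and ab: "a \<le> b"
  shows "rest i a * (F i b - F i a) \<le> win_prob a i - win_prob b i"
    "win_prob a i - win_prob b i \<le> rest i b * (F i b - F i a)"
proof -
  let ?P = "measure (bid_law k F)" and ?S = "space (bid_law k F)"
  let ?W = "\<lambda>r. {X \<in> ?S. r < X i \<and> (\<forall>j\<in>{1..k} - {i}. X j < X i)}"
  have W: "?W r \<in> sets (bid_law k F)" for r using i by measurable
  have sub: "?W b \<subseteq> ?W a" using ab by auto
  have diff: "win_prob a i - win_prob b i = ?P (?W a - ?W b)"
    unfolding win_prob_bidder[OF i] using W sub by (intro bid.finite_measure_Diff[symmetric]) auto
  define C where "C r = {X \<in> ?S. \<forall>j\<in>{1..k}. X j \<in> (if j = i then {a<..b} else {..r})}" for r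
  have C: "C r \<in> sets (bid_law k F)" for r
    unfolding C_def by (intro bid_sets) auto
  have PC: "?P (C r) = rest i r * (F i b - F i a)" for r
  proof -
    have "?P (C r) = (\<Prod>j\<in>{1..k}. measure (bidder j) (if j = i then {a<..b} else {..r}))"
      unfolding C_def by (intro bid_prob) auto
    also have "\<dots> = (F i b - F i a) * (\<Prod>j\<in>{1..k} - {i}. F j r)"
      using i ab by (subst prod.remove[of _ i]) (auto simp: bidder_intervals intro!: prod.cong)
    finally show ?thesis by (simp add: rest_def)
  qed
  have "C a \<subseteq> ?W a - ?W b"
  proof
    fix X assume X: "X \<in> C a"
    then have all: "X j \<in> (if j = i then {a<..b} else {..a})" if "j \<in> {1..k}" for j
      using that by (simp add: C_def)
    have "X i \<in> {a<..b}" using all[OF i] by simp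
    moreover have "X j \<le> a" if "j \<in> {1..k} - {i}" for j
      using all[of j] that by simp
    ultimately show "X \<in> ?W a - ?W b" using X by (fastforce simp: C_def)
  qed
  then show "rest i a * (F i b - F i a) \<le> win_prob a i - win_prob b i"
    unfolding diff PC[symmetric] using W C by (intro bid.finite_measure_mono) auto
  have "?W a - ?W b \<subseteq> C b"
  proof
    fix X assume X: "X \<in> ?W a - ?W b"
    then have "X i \<in> {a<..b}" "\<And>j. j \<in> {1..k} - {i} \<Longrightarrow> X j < X i" "X \<in> ?S" by auto
    then show "X \<in> C b" by (fastforce simp: C_def)
  qed
  then show "win_prob a i - win_prob b i \<le> rest i b * (F i b - F i a)"
    unfolding diff PC[symmetric] using W C by (intro bid.finite_measure_mono) auto
qed

lemma win_prob_1:
  assumes i: "i \<in> {1..k}"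
  shows "win_prob 1 i = 0"
proof -
  have "win_prob 1 i + win_prob 1 (k + 1) = (\<Sum>w\<in>{i, k + 1}. win_prob 1 w)"
    using i by simp
  also have "\<dots> \<le> (\<Sum>w\<in>{1..k + 1}. win_prob 1 w)"
    using i by (intro sum_mono2) (auto simp: win_prob_nonneg)
  finally show ?thesis
    using win_prob_price[of 1] H_unit(4) win_prob_nonneg[of 1 i] sum_win_prob[of 1] by linarith
qed

lemma marginal_estimable:
  assumes i: "i \<in> {1..k}"
  shows "auction_marginal (F i) (\<lambda>r. win_prob r i) H"
proof -
  have HF: "H r = F i r * rest i r" for r using i by (rule H_rest)
  have G: "win_prob b i \<le> win_prob a i" and GH: "win_prob a i - win_prob b i \<le> H b - H a"
    and FH: "(F i b - F i a) * H a \<le> H b - H a"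
    and FG: "(F i b - F i a) * H a \<le> F i a * (win_prob a i - win_prob b i)"
    and GF: "F i b * (win_prob a i - win_prob b i) \<le> H b * (F i b - F i a)" if ab: "a \<le> b" for a b
  proof -
    note d = win_prob_diff[OF i ab] 
    have dF: "0 \<le> F i b - F i a" using F_unit[OF i] ab by simp
    have r: "rest i a \<le> rest i b" "0 \<le> rest i a" "0 \<le> rest i b" using rest_unit ab by auto
    show "win_prob b i \<le> win_prob a i" using d(1) mult_nonneg_nonneg[OF r(2) dF] by linarith
    have "rest i b * (F i b - F i a) \<le> H b - H a"
      unfolding HF using mult_left_mono[OF r(1) F_unit(1)[OF i, of a]] by (simp add: algebra_simps)
    then show "win_prob a i - win_prob b i \<le> H b - H a" using d by linarith
    have "H a \<le> rest i b" unfolding HF 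
      using mult_right_mono[OF F_unit(2)[OF i, of a] r(2)] r by simp
    then have "(F i b - F i a) * H a \<le> (F i b - F i a) * rest i b"
      using dF by (intro mult_left_mono)
    then show "(F i b - F i a) * H a \<le> H b - H a" 
      using \<open>rest i b * (F i b - F i a) \<le> H b - H a\<close> by (simp add: mult.commute)
    show "(F i b - F i a) * H a \<le> F i a * (win_prob a i - win_prob b i)"
      unfolding HF using mult_left_mono[OF d(1) F_unit(1)[OF i, of a]] by (simp add: algebra_simps)
    show "F i b * (win_prob a i - win_prob b i) \<le> H b * (F i b - F i a)"
      unfolding HF using mult_left_mono[OF d(2) F_unit(1)[OF i, of b]] by (simp add: algebra_simps)
  qed
  have "H a \<le> F i a" for a
    unfolding HF using mult_left_mono[OF rest_unit(2) F_unit(1)[OF i]] by simp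
  then show ?thesis
    using F_unit[OF i] H_unit G GH FH FG GF win_prob_1[OF i]
    by unfold_locales auto
qed

end

section \<open>Blocks of samples\<close>

text \<open>The winners of the consecutive samples from number \<open>j\<close> on, where each price
  is computed by \<open>q\<close> from the earlier winners of the same block.\<close>

fun transcript :: "(nat \<Rightarrow> real \<Rightarrow> nat) \<Rightarrow> (nat list \<Rightarrow> real) \<Rightarrow> nat \<Rightarrow> nat \<Rightarrow> nat list" where
  "transcript Z q j 0 = []"
| "transcript Z q j (Suc t) = (let ws = transcript Z q j t in ws @ [Z (j + t) (q ws)])"

lemma length_transcript [simp]: "length (transcript Z q j T) = T"
  by (induction T) (auto simp: Let_def)

lemma take_transcript: "t \<le> T \<Longrightarrow> take t (transcript Z q j T) = transcript Z q j t"
proof (induction T)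
  case (Suc T)
  then show ?case by (cases "t = Suc T") (auto simp: Let_def)
qed simp

lemma nth_transcript: "t < T \<Longrightarrow> transcript Z q j T ! t = Z (j + t) (q (transcript Z q j t))"
proof (induction T)
  case (Suc T)
  then show ?case by (cases "t = T") (auto simp: Let_def nth_append)
qed simp

text \<open>For a fixed outcome \<open>h\<close> the adaptive prices become constants, and the
  condition splits into one condition per sample. This is what makes independence
  applicable.\<close>

lemma transcript_eq_iff:
  "transcript Z q j T = h \<longleftrightarrow> length h = T \<and> (\<forall>t<T. Z (j + t) (q (take t h)) = h ! t)"
proof
  assume "transcript Z q j T = h"
  then show "length h = T \<and> (\<forall>t<T. Z (j + t) (q (take t h)) = h ! t)"
    using nth_transcript take_transcript by fastforce
next
  assume h: "length h = T \<and> (\<forall>t<T. Z (j + t) (q (take t h)) = h ! t)"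
  have "t \<le> T \<Longrightarrow> transcript Z q j t = take t h" for t
    by (induction t) (use h in \<open>auto simp: Let_def take_Suc_conv_app_nth\<close>)
  from this[of T] show "transcript Z q j T = h" using h by simp
qed

section \<open>Medians of the prices\<close>

definition is_median :: "nat \<Rightarrow> (nat \<Rightarrow> real) \<Rightarrow> real \<Rightarrow> bool" where
  "is_median T r m \<longleftrightarrow> 2 * card {s. s < T \<and> r s < m} \<le> T \<and> 2 * card {s. s < T \<and> m < r s} \<le> T"

text \<open>The last entry that is a median, found by scanning; the start value 0 survives only if
  \<open>T = 0\<close>. The form follows the loop of the program, which counts instead of
  sorting.\<close>

definition median :: "nat \<Rightarrow> (nat \<Rightarrow> real) \<Rightarrow> real" where
  "median T r = fold (\<lambda>t m. if is_median T r (r t) then r t else m) [0..<T] 0"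

text \<open>The least entry with at least half of the entries at or below it: the next smaller
  entry, if there is one, fails this condition, which bounds the number of entries strictly
  below.\<close>

lemma ex_median:
  assumes "0 < T"
  shows "\<exists>t<T. is_median T r (r t)"
proof -
  define S where "S = r ` {..<T}"
  define A where "A = {v \<in> S. T \<le> 2 * card {s. s < T \<and> r s \<le> v}}"
  have S: "finite S" "S \<noteq> {}" using assms by (auto simp: S_def)
  have "{s. s < T \<and> r s \<le> Max S} = {..<T}" using S by (auto simp: S_def)
  then have "Max S \<in> A" using S by (simp add: A_def)
  then have A: "A \<noteq> {}" by blast
  have fin: "finite A" using S by (simp add: A_def)
  define m where "m = Min A"
  have m: "m \<in> A" unfolding m_def using fin A by (rule Min_in)
  have "{s. s < T \<and> m < r s} = {..<T} - {s. s < T \<and> r s \<le> m}" by auto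
  then have "card {s. s < T \<and> m < r s} = T - card {s. s < T \<and> r s \<le> m}"
    by (simp only:) (subst card_Diff_subset, auto)
  moreover have "T \<le> 2 * card {s. s < T \<and> r s \<le> m}" using m by (simp add: A_def)
  ultimately have above: "2 * card {s. s < T \<and> m < r s} \<le> T" by linarith
  have below: "2 * card {s. s < T \<and> r s < m} \<le> T"
  proof (cases "{v \<in> S. v < m} = {}")
    case True
    then have "{s. s < T \<and> r s < m} = {}" by (auto simp: S_def)
    then show ?thesis by (simp only: card.empty)
  next
    case False
    define v where "v = Max {v \<in> S. v < m}"
    have fin': "finite {v \<in> S. v < m}" using S by simp
    have v: "v \<in> S" "v < m" using Max_in[OF fin' False] by (auto simp: v_def)
    have "{s. s < T \<and> r s < m} = {s. s < T \<and> r s \<le> v}"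
      using Max_ge[OF fin'] v by (fastforce simp: v_def S_def)
    moreover have "v \<notin> A" using Min_le[OF fin, of v] v by (auto simp: m_def)
    ultimately show ?thesis using v by (simp add: A_def)
  qed
  obtain t where "t < T" "m = r t" using m by (auto simp: A_def S_def)
  then show ?thesis using above below by (auto simp: is_median_def)
qed

lemma median:
  assumes "0 < T"
  shows "is_median T r (median T r)" "\<exists>t<T. median T r = r t"
proof -
  have "(\<exists>t<U. is_median T r (r t)) \<Longrightarrow> 
      is_median T r (fold (\<lambda>t m. if is_median T r (r t) then r t else m) [0..<U] 0) \<and>
      (\<exists>t<U. fold (\<lambda>t m. if is_median T r (r t) then r t else m) [0..<U] 0 = r t)" for U
  proof (induction U)
    case (Suc U)
    then show ?case by (auto simp: less_Suc_eq)
  qed simp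
  from this[OF ex_median[OF assms]] show "is_median T r (median T r)" "\<exists>t<T. median T r = r t"
    by (auto simp: median_def)
qed

text \<open>By Markov's inequality, more than half of the points satisfy the claimed bound.\<close>

lemma median_close:
  fixes \<beta> \<tau> :: real and H :: "real \<Rightarrow> real"
  assumes T: "0 < T" and mono: "mono_on {0..1} H" and r: "\<And>t. t < T \<Longrightarrow> r t \<in> {0..1}"
    and avg: "(\<Sum>t<T. \<bar>H (r t) - \<tau>\<bar>) < 5 * \<beta> * T" and \<beta>: "0 < \<beta>"
  shows "\<bar>H (median T r) - \<tau>\<bar> \<le> 20 * \<beta>"
proof -
  define B where "B = {t. t < T \<and> 20 * \<beta> < \<bar>H (r t) - \<tau>\<bar>}"
  have "20 * \<beta> * card B = (\<Sum>t\<in>B. 20 * \<beta>)" by simp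
  also have "\<dots> \<le> (\<Sum>t\<in>B. \<bar>H (r t) - \<tau>\<bar>)" by (intro sum_mono) (auto simp: B_def)
  also have "\<dots> \<le> (\<Sum>t<T. \<bar>H (r t) - \<tau>\<bar>)" by (intro sum_mono2) (auto simp: B_def)
  finally have "\<beta> * (4 * card B) < \<beta> * T" using avg by simp
  then have card: "real (4 * card B) < T" using \<beta> by simp
  then have B: "2 * card B < T" by linarith
  define m where "m = median T r"
  have med: "2 * card {s. s < T \<and> r s < m} \<le> T" "2 * card {s. s < T \<and> m < r s} \<le> T" "m \<in> {0..1}"
    using median[OF T, of r] r by (auto simp: m_def is_median_def)
  \<comment> \<open>Fewer than half of the points are in \<open>B\<close>, and at most half lie
    strictly on one side of the median, so a point outside \<open>B\<close> is found on either side.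
    Monotonicity of \<open>H\<close> then encloses \<open>H m\<close>.\<close>
  have ex: "\<exists>t. t < T \<and> P t \<and> t \<notin> B" if "2 * card {s. s < T \<and> \<not> P s} \<le> T" for P
  proof (rule ccontr)
    assume "\<nexists>t. t < T \<and> P t \<and> t \<notin> B"
    then have "{..<T} \<subseteq> B \<union> {s. s < T \<and> \<not> P s}" by auto
    then have "card {..<T} \<le> card (B \<union> {s. s < T \<and> \<not> P s})"
      by (intro card_mono) (auto simp: B_def)
    also have "\<dots> \<le> card B + card {s. s < T \<and> \<not> P s}" by (rule card_Un_le)
    finally show False using B that by simp
  qed
  obtain t where t: "t < T" "m \<le> r t" "t \<notin> B" using ex[of "\<lambda>s. m \<le> r s"] med by (auto simp: not_le)
  obtain s where s: "s < T" "r s \<le> m" "s \<notin> B" using ex[of "\<lambda>s. r s \<le> m"] med by (auto simp: not_le)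
  have "H m \<le> H (r t)" "H (r s) \<le> H m"
    using mono_onD[OF mono] t s med r by auto
  then show ?thesis using s t unfolding m_def[symmetric] B_def by auto
qed

definition prices :: "nat \<Rightarrow> real \<Rightarrow> real \<Rightarrow> nat list \<Rightarrow> nat \<Rightarrow> real" where
  "prices k \<beta> \<tau> ws t = query k \<beta> \<tau> (take t ws)"

definition wins :: "nat list \<Rightarrow> nat \<Rightarrow> nat" where
  "wins ws i = card {t. t < length ws \<and> ws ! t = i}"

section \<open>The law of a block of samples and its failure probability\<close>

context auction
begin

lemma sample_coord: "\<omega> \<in> space (sample_law n k F) \<Longrightarrow> j < n \<Longrightarrow> \<omega> j \<in> space (bid_law k F)"
  by (auto simp: sample_law_def space_PiM)

definition block :: "(nat \<Rightarrow> nat \<Rightarrow> real) \<Rightarrow> (nat list \<Rightarrow> real) \<Rightarrow> nat \<Rightarrow> nat \<Rightarrow> nat list" where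
  "block \<omega> q j T = transcript (\<lambda>j. winner k (\<omega> j)) q j T"

lemma block_histories: "block \<omega> q j T \<in> histories {1..k + 1} T"
  using nth_transcript[of _ T] winner_max(1) by (force simp: block_def histories_def set_conv_nth)

lemma block_eq_collect:
  assumes "length h = T" "j + T \<le> n"
  shows "{\<omega> \<in> space (sample_law n k F). block \<omega> q j T = h} =
    {\<omega> \<in> space (sample_law n k F). \<forall>l\<in>{j..<j + T}. \<omega> l \<in>
       {X \<in> space (bid_law k F). winner k X (q (take (l - j) h)) = h ! (l - j)}}"
  (is "?A = ?B")
proof (intro equalityI subsetI)
  fix \<omega> assume "\<omega> \<in> ?A"
  then have "winner k (\<omega> l) (q (take (l - j) h)) = h ! (l - j)" if "l \<in> {j..<j + T}" for l
    using that by (auto simp: block_def transcript_eq_iff dest!: spec[of _ "l - j"])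
  then show "\<omega> \<in> ?B" using \<open>\<omega> \<in> ?A\<close> assms sample_coord[of \<omega> n] by auto
next
  fix \<omega> assume w: "\<omega> \<in> ?B"
  have "winner k (\<omega> (j + t)) (q (take t h)) = h ! t" if "t < T" for t
  proof -
    have "j + t \<in> {j..<j + T}" using that by simp
    with w have "\<omega> (j + t) \<in> {X \<in> space (bid_law k F). winner k X (q (take (j + t - j) h)) = h ! (j + t - j)}"
      by blast
    then show ?thesis by simp
  qed
  then show "\<omega> \<in> ?A" using w assms by (auto simp: block_def transcript_eq_iff)
qed

lemma block_sets:
  assumes "j + T \<le> n"
  shows "{\<omega> \<in> space (sample_law n k F). block \<omega> q j T = h} \<in> sets (sample_law n k F)"
proof (cases "length h = T")
  case True
  have comp: "(\<lambda>\<omega>. \<omega> l) \<in> measurable (sample_law n k F) (bid_law k F)" if "l \<in> {j..<j + T}" for l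
    using that assms unfolding sample_law_def by (intro measurable_component_singleton) auto
  show ?thesis
  proof (cases "T = 0")
    case False
    show ?thesis unfolding block_eq_collect[OF True assms]
    proof (intro sets.sets_Collect_finite_All)
      fix l assume l: "l \<in> {j..<j + T}"
      let ?A = "{X \<in> space (bid_law k F). winner k X (q (take (l - j) h)) = h ! (l - j)}"
      have "{\<omega> \<in> space (sample_law n k F). \<omega> l \<in> ?A} = (\<lambda>\<omega>. \<omega> l) -` ?A \<inter> space (sample_law n k F)"
        by blast
      then show "{\<omega> \<in> space (sample_law n k F). \<omega> l \<in> ?A} \<in> sets (sample_law n k F)"
        by (simp only:) (rule measurable_sets[OF comp[OF l] winner_sets])
    qed (use False in auto)
  next
    case True
    then have eq: "{\<omega> \<in> space (sample_law n k F). block \<omega> q j T = h} = space (sample_law n k F)"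
      using \<open>length h = T\<close> by (auto simp: block_def)
    show ?thesis by (simp only: eq sets.top)
  qed
next
  case False
  then have eq: "{\<omega> \<in> space (sample_law n k F). block \<omega> q j T = h} = {}"
    by (auto simp: block_def)
  show ?thesis by (simp only: eq sets.empty_sets)
qed

lemma block_measurable:
  assumes "j + T \<le> n"
  shows "(\<lambda>\<omega>. block \<omega> q j T) \<in> measurable (sample_law n k F) (count_space UNIV)"
proof -
  have "(\<lambda>\<omega>. block \<omega> q j T) -` {h} \<inter> space (sample_law n k F) =
      {\<omega> \<in> space (sample_law n k F). block \<omega> q j T = h}" for h by auto
  then show ?thesis
    using block_sets[OF assms] by (simp add: measurable_count_space_eq_countable)
qed

text \<open>The link between the product measure and the finite sums over histories: the
  supermartingale bounds apply to the samples through this identity.\<close>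

lemma block_prob:
  assumes "j + T \<le> n" "h \<in> histories {1..k + 1} T"
  shows "measure (sample_law n k F) {\<omega> \<in> space (sample_law n k F). block \<omega> q j T = h} = hist_weight win_prob q h"
proof -
  interpret S: prob_space "sample_law n k F" by (rule sample_prob_space)
  have len: "length h = T" using assms(2) by (simp add: histories_def)
  have "emeasure (sample_law n k F) {\<omega> \<in> space (sample_law n k F). block \<omega> q j T = h} =
      (\<Prod>l\<in>{j..<j + T}. emeasure (bid_law k F)
         {X \<in> space (bid_law k F). winner k X (q (take (l - j) h)) = h ! (l - j)})"
    unfolding block_eq_collect[OF len assms(1)] unfolding sample_law_def
    using assms(1) winner_sets by (intro sample.emeasure_PiM_Collect) auto
  also have "\<dots> = (\<Prod>l\<in>{j..<j + T}. ennreal (win_prob (q (take (l - j) h)) (h ! (l - j))))"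
    by (simp add: win_prob_def bid.emeasure_eq_measure)
  also have "\<dots> = (\<Prod>t<T. ennreal (win_prob (q (take t h)) (h ! t)))"
    by (rule prod.reindex_bij_witness[of _ "\<lambda>t. j + t" "\<lambda>l. l - j"]) auto
  also have "\<dots> = ennreal (hist_weight win_prob q h)"
    unfolding hist_weight_def len by (intro prod_ennreal) (rule win_prob_nonneg)
  finally show ?thesis
    using hist_weight_nonneg[of "{1..k + 1}" win_prob h q] assms(2) win_prob_nonneg
    by (simp add: S.emeasure_eq_measure histories_def)
qed

lemma block_event_prob:
  assumes "j + T \<le> n"
  shows "measure (sample_law n k F) {\<omega> \<in> space (sample_law n k F). B (block \<omega> q j T)} =
    (\<Sum>h | h \<in> histories {1..k + 1} T \<and> B h. hist_weight win_prob q h)"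
proof -
  interpret S: prob_space "sample_law n k F" by (rule sample_prob_space)
  let ?N = "{h. h \<in> histories {1..k + 1} T \<and> B h}"
  have fin: "finite ?N"
    by (rule finite_subset[OF _ finite_histories[OF finite_atLeastAtMost]]) blast
  have eq: "{\<omega> \<in> space (sample_law n k F). B (block \<omega> q j T)} =
      (\<Union>h\<in>?N. {\<omega> \<in> space (sample_law n k F). block \<omega> q j T = h})"
  proof (intro equalityI subsetI)
    fix \<omega> assume "\<omega> \<in> {\<omega> \<in> space (sample_law n k F). B (block \<omega> q j T)}"
    then show "\<omega> \<in> (\<Union>h\<in>?N. {\<omega> \<in> space (sample_law n k F). block \<omega> q j T = h})"
      using block_histories[of \<omega> q j T] by (intro UN_I[of "block \<omega> q j T"]) auto
  qed auto
  have "S.prob (\<Union>h\<in>?N. {\<omega> \<in> space (sample_law n k F). block \<omega> q j T = h}) = (\<Sum>h\<in>?N. S.prob {\<omega> \<in> space (sample_law n k F). block \<omega> q j T = h})"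
  proof (intro S.finite_measure_finite_Union)
    show "(\<lambda>h. {\<omega> \<in> space (sample_law n k F). block \<omega> q j T = h}) ` ?N \<subseteq> S.events"
      by (rule image_subsetI, rule block_sets[OF assms])
    show "disjoint_family_on (\<lambda>h. {\<omega> \<in> space (sample_law n k F). block \<omega> q j T = h}) ?N"
      unfolding disjoint_family_on_def by blast
  qed (rule fin)
  also have "\<dots> = (\<Sum>h\<in>?N. hist_weight win_prob q h)"
    by (rule sum.cong[OF refl], rule block_prob[OF assms], blast)
  finally show ?thesis unfolding eq .
qed

text \<open>The complements of the events bounded by \<open>search_deviation\<close> and, with both
  signs, by \<open>adaptive_mean_deviation\<close>.\<close>

definition good_block :: "nat \<Rightarrow> real \<Rightarrow> real \<Rightarrow> nat \<Rightarrow> nat list \<Rightarrow> bool" where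
  "good_block i \<beta> \<tau> T ws \<longleftrightarrow>
     (\<Sum>t<T. \<bar>H (prices k \<beta> \<tau> ws t) - \<tau>\<bar>) < 5 * \<beta> * T \<and>
     \<bar>wins ws i - (\<Sum>t<T. win_prob (prices k \<beta> \<tau> ws t) i)\<bar> < 2 * \<beta> * T"

lemma slope_ge_1: "1 \<le> real k * (1 + L)"
  using k L_nonneg by (intro mult_ge1_I) auto

text \<open>\<open>H\<close> is Lipschitz with constant \<open>k * (1 + L)\<close>, so an interval
  of this length next to a \<tau>-quantile has values within \<beta> of \<tau>. It is placed to the
  right of the quantile if it fits into the unit interval, otherwise to the left.\<close>

lemma quantile_interval:
  assumes \<tau>: "0 \<le> \<tau>" "\<tau> \<le> 1" and \<beta>: "0 < \<beta>" "\<beta> \<le> 1 / 2"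
  obtains a b where "0 \<le> a" "b \<le> 1" "b - a = \<beta> / (k * (1 + L))" "\<tau> - \<beta> \<le> H a" "H b \<le> \<tau> + \<beta>"
proof -
  define K where "K = k * (1 + L)"
  have K: "1 \<le> K" using slope_ge_1 by (simp add: K_def)
  obtain x where x: "0 \<le> x" "x \<le> 1" "H x = \<tau>"
    using IVT'[of H 0 \<tau> 1] \<tau> H_unit H_continuous by auto
  have "\<beta> / K \<le> \<beta>" using \<beta> K by (simp add: divide_le_eq mult_left_le)
  then have d: "0 < \<beta> / K" "\<beta> / K \<le> 1 / 2" using \<beta> K by auto
  have lip: "H v - H u \<le> \<beta>" if "0 \<le> u" "v \<le> 1" "v - u = \<beta> / K" for u v
  proof -
    have "H v - H u \<le> K * (v - u)" unfolding K_def using that d by (intro H_lipschitz) auto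
    then show ?thesis using that K by simp
  qed
  define \<delta> where "\<delta> = \<beta> / K"
  note d = d[folded \<delta>_def]
  show ?thesis
  proof (cases "x + \<delta> \<le> 1")
    case True
    show ?thesis
    proof (rule that[of x "x + \<delta>"])
      show "H (x + \<delta>) \<le> \<tau> + \<beta>" using lip[of x "x + \<delta>"] True x by (simp add: \<delta>_def)
    qed (use True x \<beta> in \<open>auto simp: \<delta>_def K_def\<close>)
  next
    case False
    show ?thesis
    proof (rule that[of "x - \<delta>" x])
      show "0 \<le> x - \<delta>" using False d(2) by linarith
      then show "\<tau> - \<beta> \<le> H (x - \<delta>)" using lip[of "x - \<delta>" x] x by (simp add: \<delta>_def)
    qed (use x \<beta> in \<open>auto simp: \<delta>_def K_def\<close>)
  qed
qed

lemma H_mono_on: "mono_on {0..1} H"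
  by (auto simp: mono_on_def H_unit)

text \<open>Three events: the search contributes the inverse of the interval length, which is
  \<open>k * (1 + L) / \<beta>\<close>, and the two directions of deviation contribute 1 each. As
  the first number is at least 1, three times it covers everything.\<close>

lemma good_block_prob:
  assumes i: "i \<in> {1..k}" and \<tau>: "0 \<le> \<tau>" "\<tau> \<le> 1" and \<beta>: "0 < \<beta>" "\<beta> \<le> 1 / 2" and jT: "j + T \<le> n"
  shows "measure (sample_law n k F)
      {\<omega> \<in> space (sample_law n k F). \<not> good_block i \<beta> \<tau> T (block \<omega> (query k \<beta> \<tau>) j T)}
    \<le> 3 * (k * (1 + L) / \<beta>) * exp (- (\<beta>\<^sup>2 * T))"
proof -
  let ?A = "{1..k + 1}" and ?q = "query k \<beta> \<tau>" and ?E = "exp (- (\<beta>\<^sup>2 * T))"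
  let ?w = "hist_weight win_prob ?q"
  define K where "K = k * (1 + L)"
  have K1: "1 \<le> K" using slope_ge_1 by (simp add: K_def)
  then have K: "1 \<le> K / \<beta>" using \<beta> by (simp add: le_divide_eq)
  obtain a b where ab: "0 \<le> a" "b \<le> 1" "b - a = \<beta> / K" "\<tau> - \<beta> \<le> H a" "H b \<le> \<tau> + \<beta>"
    using quantile_interval[OF \<tau> \<beta>] unfolding K_def by blast
  have "0 < b - a" unfolding ab(3) using K1 \<beta> by simp
  then have "a < b" by simp
  define B0 where "B0 ws \<longleftrightarrow> 5 * \<beta> * T \<le> (\<Sum>t<length ws. \<bar>H (?q (take t ws)) - \<tau>\<bar>)" for ws
  define B where "B \<sigma> ws \<longleftrightarrow> 2 * \<beta> * T \<le> \<sigma> * (\<Sum>t<length ws. of_bool (ws ! t = i) - win_prob (?q (take t ws)) i)"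
    for \<sigma> :: real and ws
  have "(\<Sum>w\<in>?A. win_prob r w * of_bool (k < w)) = H r" for r
  proof -
    have "(\<Sum>w\<in>?A. win_prob r w * of_bool (k < w)) = (\<Sum>w\<in>?A. if w = k + 1 then win_prob r w else 0)"
      by (intro sum.cong) auto
    then show ?thesis by (simp add: win_prob_price[simplified])
  qed
  then have S0: "(\<Sum>ws | ws \<in> histories ?A T \<and> B0 ws. ?w ws) \<le> ?E / (b - a)"
    unfolding B0_def
    by (intro search_deviation[OF finite_atLeastAtMost win_prob_nonneg sum_win_prob _ H_mono_on
          \<tau> \<beta> ab(1) \<open>a < b\<close> ab(2,4,5)])
  have mean: "win_prob (?q ws) i = (\<Sum>w\<in>?A. win_prob (?q ws) w * of_bool (w = i))" for ws
  proof -
    have "(\<Sum>w\<in>?A. win_prob (?q ws) w * of_bool (w = i)) = (\<Sum>w\<in>?A. if w = i then win_prob (?q ws) w else 0)"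
      by (intro sum.cong) auto
    then show ?thesis using i by simp
  qed
  have S: "(\<Sum>ws | ws \<in> histories ?A T \<and> B \<sigma> ws. ?w ws) \<le> ?E" if "\<bar>\<sigma>\<bar> = 1" for \<sigma>
    unfolding B_def using \<beta> that
    by (intro adaptive_mean_deviation[where h = "\<lambda>w. of_bool (w = i)" and m = "\<lambda>ws. win_prob (?q ws) i",
          OF finite_atLeastAtMost win_prob_nonneg sum_win_prob mean]) simp_all
  have sub: "{h. h \<in> histories ?A T \<and> \<not> good_block i \<beta> \<tau> T h} \<subseteq>
      {h. h \<in> histories ?A T \<and> B0 h} \<union> ({h. h \<in> histories ?A T \<and> B 1 h} \<union> {h. h \<in> histories ?A T \<and> B (-1) h})"
  proof
    fix h assume h: "h \<in> {h. h \<in> histories ?A T \<and> \<not> good_block i \<beta> \<tau> T h}"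
    then have len: "length h = T" by (simp add: histories_def)
    have "real (wins h i) = (\<Sum>t<T. of_bool (h ! t = i))"
      by (simp add: wins_def len of_bool_def sum.If_cases Int_def lessThan_def)
    moreover have "\<not> good_block i \<beta> \<tau> T h" "h \<in> histories ?A T" using h by auto
    moreover have "a \<le> S \<or> c \<le> 1 * (v - s) \<or> c \<le> - 1 * (v - s)" if "\<not> (S < a \<and> \<bar>v - s\<bar> < c)"
      for S a v s c :: real using that by (auto simp: abs_if not_less split: if_splits)
    ultimately have "B0 h \<or> B 1 h \<or> B (-1) h"
      unfolding good_block_def B0_def B_def prices_def sum_subtractf len by metis
    then show "h \<in> {h. h \<in> histories ?A T \<and> B0 h} \<union> ({h. h \<in> histories ?A T \<and> B 1 h} \<union> {h. h \<in> histories ?A T \<and> B (-1) h})"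
      using h by blast
  qed
  have "(\<Sum>h | h \<in> histories ?A T \<and> \<not> good_block i \<beta> \<tau> T h. ?w h) \<le>
      (\<Sum>h \<in> {h. h \<in> histories ?A T \<and> B0 h} \<union> ({h. h \<in> histories ?A T \<and> B 1 h} \<union> {h. h \<in> histories ?A T \<and> B (-1) h}). ?w h)"
  proof (rule sum_mono2[OF _ sub])
    show "finite ({h. h \<in> histories ?A T \<and> B0 h} \<union> ({h. h \<in> histories ?A T \<and> B 1 h} \<union> {h. h \<in> histories ?A T \<and> B (-1) h}))"
      using finite_histories[of ?A T] by simp
  next
    fix h assume "h \<in> {h. h \<in> histories ?A T \<and> B0 h} \<union> ({h. h \<in> histories ?A T \<and> B 1 h} \<union> {h. h \<in> histories ?A T \<and> B (-1) h})
      - {h. h \<in> histories ?A T \<and> \<not> good_block i \<beta> \<tau> T h}"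
    then show "0 \<le> ?w h"
      by (intro hist_weight_nonneg[of ?A] win_prob_nonneg) (auto simp: histories_def)
  qed
  also have "\<dots> \<le> (\<Sum>h | h \<in> histories ?A T \<and> B0 h. ?w h) +
      ((\<Sum>h | h \<in> histories ?A T \<and> B 1 h. ?w h) + (\<Sum>h | h \<in> histories ?A T \<and> B (-1) h. ?w h))"
  proof -
    have un: "(\<Sum>h\<in>U \<union> V. ?w h) \<le> (\<Sum>h\<in>U. ?w h) + (\<Sum>h\<in>V. ?w h)"
      if "U \<subseteq> histories ?A T" "V \<subseteq> histories ?A T" for U V
    proof -
      have "finite U" "finite V" using that finite_histories[of ?A T] finite_subset by auto
      moreover have "0 \<le> (\<Sum>h\<in>U \<inter> V. ?w h)"
        using that win_prob_nonneg
        by (intro sum_nonneg hist_weight_nonneg[of ?A]) (auto simp: histories_def)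
      ultimately show ?thesis using sum.union_inter[of U V ?w] by linarith
    qed
    show ?thesis by (intro order_trans[OF un] add_left_mono un) auto
  qed
  also have "\<dots> \<le> ?E / (b - a) + (?E + ?E)"
    using S0 S[of 1] S[of "-1"] by (intro add_mono) auto
  also have "\<dots> = (K / \<beta> + 2) * ?E" using ab(3) by (simp add: algebra_simps)
  also have "\<dots> \<le> 3 * (K / \<beta>) * ?E" using K by (intro mult_right_mono) auto
  finally show ?thesis
    unfolding block_event_prob[OF jT, of "\<lambda>ws. \<not> good_block i \<beta> \<tau> T ws" ?q] K_def .
qed

text \<open>By \<open>G_le_H\<close> the win probability varies no more than \<open>H\<close> does,
  so querying near the quantile instead of at it costs 5 \<beta> on average; the fluctuation of the
  wins adds 2 \<beta>.\<close>

lemma good_block_estimates: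
  assumes good: "good_block i \<beta> \<tau> T ws" and i: "i \<in> {1..k}" and T: "0 < T"
    and \<tau>: "0 \<le> \<tau>" "\<tau> \<le> 1" and \<beta>: "0 < \<beta>" "\<beta> \<le> 1 / 2" and x: "0 \<le> x" "x \<le> 1" "H x = \<tau>"
  shows "\<bar>wins ws i / T - win_prob x i\<bar> \<le> 7 * \<beta>"
    "\<bar>H (median T (prices k \<beta> \<tau> ws)) - \<tau>\<bar> \<le> 20 * \<beta>"
    "median T (prices k \<beta> \<tau> ws) \<in> {0..1}"
proof -
  interpret E: auction_marginal "F i" "\<lambda>r. win_prob r i" H by (rule marginal_estimable[OF i])
  let ?p = "prices k \<beta> \<tau> ws"
  have p: "?p t \<in> {0..1}" for t using query_unit[of \<tau> \<beta> k "take t ws"] \<tau> \<beta> by (simp add: prices_def)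
  show "\<bar>H (median T ?p) - \<tau>\<bar> \<le> 20 * \<beta>"
    using good T p \<beta> H_mono_on by (intro median_close) (auto simp: good_block_def)
  show "median T ?p \<in> {0..1}" using median(2)[OF T, of ?p] p by auto
  have diff: "\<bar>win_prob r i - win_prob x i\<bar> \<le> \<bar>H r - \<tau>\<bar>" if "r \<in> {0..1}" for r
  proof (cases "r \<le> x")
    case True
    then show ?thesis using E.G_le_H[of r x] E.G_antimono[of r x] that x by auto
  next
    case False
    then show ?thesis using E.G_le_H[of x r] E.G_antimono[of x r] that x by auto
  qed
  have "\<bar>(\<Sum>t<T. win_prob (?p t) i) - T * win_prob x i\<bar> = \<bar>\<Sum>t<T. win_prob (?p t) i - win_prob x i\<bar>"
    by (simp add: sum_subtractf)
  also have "\<dots> \<le> (\<Sum>t<T. \<bar>win_prob (?p t) i - win_prob x i\<bar>)" by (rule sum_abs)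
  also have "\<dots> \<le> (\<Sum>t<T. \<bar>H (?p t) - \<tau>\<bar>)" using diff p by (intro sum_mono) blast
  finally have "\<bar>wins ws i - T * win_prob x i\<bar> \<le> 7 * \<beta> * T"
    using good by (auto simp: good_block_def abs_le_iff abs_less_iff)
  moreover have "wins ws i / T - win_prob x i = (wins ws i - T * win_prob x i) / T"
    using T by (simp add: field_simps)
  ultimately show "\<bar>wins ws i / T - win_prob x i\<bar> \<le> 7 * \<beta>"
    using T by (simp add: pos_divide_le_eq)
qed

end

section \<open>Reasoning about programs\<close>

text \<open>Total correctness from one start state together with a step bound; \<open>Q\<close> is
  the postcondition.\<close>

definition runs ::
  "nat \<Rightarrow> (nat \<Rightarrow> real \<Rightarrow> nat) \<Rightarrow> com \<Rightarrow> state \<Rightarrow> (state \<Rightarrow> bool) \<Rightarrow> nat \<Rightarrow> bool" where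
  "runs n Z c s Q b \<longleftrightarrow> (\<exists>t s'. exec n Z c s t s' \<and> t \<le> b \<and> Q s')"

lemma runs_mono:
  "runs n Z c s Q b \<Longrightarrow> (\<And>s'. Q s' \<Longrightarrow> Q' s') \<Longrightarrow> b \<le> b' \<Longrightarrow> runs n Z c s Q' b'"
  unfolding runs_def using order_trans by blast

lemma runs_SKIP: "1 \<le> b \<Longrightarrow> Q s \<Longrightarrow> runs n Z SKIP s Q b"
  unfolding runs_def using exec.Skip by blast

lemma runs_NAssign: "1 \<le> b \<Longrightarrow> Q (N(x := nval a N), R, j) \<Longrightarrow> runs n Z (NAssign x a) (N, R, j) Q b"
  unfolding runs_def using exec.NAssign by blast

lemma runs_RAssign: 
  "1 \<le> b \<Longrightarrow> Q (N, R(x := (R x)(nval a N := rval u N R)), j) \<Longrightarrow> runs n Z (RAssign x a u) (N, R, j) Q b"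
  unfolding runs_def using exec.RAssign by blast

lemma runs_Observe:
  "1 \<le> b \<Longrightarrow> j < n \<Longrightarrow> 0 \<le> rval u N R \<Longrightarrow> rval u N R \<le> 1 \<Longrightarrow>
    Q (N(x := Z j (rval u N R)), R, Suc j) \<Longrightarrow> runs n Z (Observe x u) (N, R, j) Q b"
  unfolding runs_def using exec.Observe[OF _ refl] by blast

lemma runs_Seq:
  assumes "runs n Z c s Q' b" "\<And>s'. Q' s' \<Longrightarrow> runs n Z d s' Q b'"
  shows "runs n Z (Seq c d) s Q (b + b')"
proof -
  obtain t s' where 1: "exec n Z c s t s'" "t \<le> b" "Q' s'" using assms(1) by (auto simp: runs_def)
  obtain t' s'' where 2: "exec n Z d s' t' s''" "t' \<le> b'" "Q s''"
    using assms(2)[OF 1(3)] by (auto simp: runs_def)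
  have "exec n Z (Seq c d) s (t + t') s''" using 1(1) 2(1) by (rule exec.Seq)
  then show ?thesis unfolding runs_def using 1(2) 2(2,3) add_mono by blast
qed

lemma runs_Cond:
  assumes "bval e N R \<Longrightarrow> runs n Z c (N, R, j) Q b" "\<not> bval e N R \<Longrightarrow> runs n Z d (N, R, j) Q b"
  shows "runs n Z (Cond e c d) (N, R, j) Q (Suc b)"
proof (cases "bval e N R")
  case True
  with assms(1) obtain t s' where "exec n Z c (N, R, j) t s'" "t \<le> b" "Q s'" by (auto simp: runs_def)
  then show ?thesis using exec.CondTrue[OF True] unfolding runs_def
    by (metis Suc_eq_plus1 Suc_le_mono)
next
  case False
  with assms(2) obtain t s' where "exec n Z d (N, R, j) t s'" "t \<le> b" "Q s'" by (auto simp: runs_def)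
  then show ?thesis using exec.CondFalse[OF False] unfolding runs_def
    by (metis Suc_eq_plus1 Suc_le_mono)
qed

fun nat_mods :: "com \<Rightarrow> string set" where
  "nat_mods SKIP = {}"
| "nat_mods (NAssign x a) = {x}"
| "nat_mods (RAssign x a u) = {}"
| "nat_mods (Observe x u) = {x}"
| "nat_mods (Seq c d) = nat_mods c \<union> nat_mods d"
| "nat_mods (Cond b c d) = nat_mods c \<union> nat_mods d"
| "nat_mods (While b c) = nat_mods c"

fun real_mods :: "com \<Rightarrow> string set" where
  "real_mods SKIP = {}"
| "real_mods (NAssign x a) = {}"
| "real_mods (RAssign x a u) = {x}"
| "real_mods (Observe x u) = {}"
| "real_mods (Seq c d) = real_mods c \<union> real_mods d"
| "real_mods (Cond b c d) = real_mods c \<union> real_mods d"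
| "real_mods (While b c) = real_mods c"

definition agree_off :: "'a set \<Rightarrow> ('a \<Rightarrow> 'b) \<Rightarrow> ('a \<Rightarrow> 'b) \<Rightarrow> bool" where
  "agree_off X f g \<longleftrightarrow> (\<forall>x. x \<notin> X \<longrightarrow> f x = g x)"

lemma agree_offD: "agree_off X f g \<Longrightarrow> x \<notin> X \<Longrightarrow> f x = g x"
  by (simp add: agree_off_def)

lemma agree_off_refl [simp]: "agree_off X f f"
  by (simp add: agree_off_def)

text \<open>The frame rule. It lets the specification of a loop be silent about everything that the
  loop does not assign.\<close>

lemma exec_frame:
  "exec n Z c s t s' \<Longrightarrow> agree_off (nat_mods c) (fst s') (fst s) \<and> 
     agree_off (real_mods c) (fst (snd s')) (fst (snd s))"
  by (induction rule: exec.induct) (auto simp: agree_off_def)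

lemma runs_frame:
  assumes "runs n Z c (N, R, j) Q b"
  shows "runs n Z c (N, R, j) (\<lambda>(N', R', j'). Q (N', R', j') \<and>
    agree_off (nat_mods c) N' N \<and> agree_off (real_mods c) R' R) b"
proof -
  obtain t N' R' j' where e: "exec n Z c (N, R, j) t (N', R', j')" "t \<le> b" "Q (N', R', j')"
    using assms by (auto simp: runs_def)
  with exec_frame[OF e(1)] show ?thesis unfolding runs_def by fastforce
qed

lemma runs_While_aux:
  assumes "I v s"
    and body: "\<And>v N R j. I v (N, R, j) \<Longrightarrow> bval e N R \<Longrightarrow> 
          0 < v \<and> runs n Z c (N, R, j) (I (v - 1)) B"
  shows "runs n Z (While e c) s (\<lambda>(N, R, j). \<not> bval e N R \<and> (\<exists>v. I v (N, R, j))) (v * (B + 1) + 1)"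
  using assms(1)
proof (induction v arbitrary: s)
  case 0
  obtain N R j where s: "s = (N, R, j)" by (cases s)
  have "\<not> bval e N R" using body[of 0 N R j] 0 s by auto
  then have "exec n Z (While e c) s 1 s" unfolding s by (rule exec.WhileFalse)
  then show ?case unfolding runs_def using \<open>\<not> bval e N R\<close> 0 s by fastforce
next
  case (Suc v)
  obtain N R j where s: "s = (N, R, j)" by (cases s)
  show ?case
  proof (cases "bval e N R")
    case False
    then have "exec n Z (While e c) s 1 s" unfolding s by (rule exec.WhileFalse)
    then show ?thesis unfolding runs_def using False Suc.prems s by fastforce
  next
    case True
    then obtain t s' where 1: "exec n Z c (N, R, j) t s'" "t \<le> B" "I v s'"
      using body[of "Suc v" N R j] Suc.prems s by (auto simp: runs_def)
    obtain t' s'' where 2: "exec n Z (While e c) s' t' s''" "t' \<le> v * (B + 1) + 1"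
        "case s'' of (N, R, j) \<Rightarrow> \<not> bval e N R \<and> (\<exists>v. I v (N, R, j))"
      using Suc.IH[OF 1(3)] unfolding runs_def by blast
    have "exec n Z (While e c) s (t + t' + 1) s''" unfolding s using True 1(1) 2(1) by (rule exec.WhileTrue)
    moreover have "t + t' + 1 \<le> Suc v * (B + 1) + 1" using 1(2) 2(2) by simp
    ultimately show ?thesis unfolding runs_def using 2(3) by blast
  qed
qed

text \<open>The invariant is indexed by a bound on the number of remaining iterations.\<close>

lemma runs_While:
  assumes init: "I v0 N0 R0 j0"
    and body: "\<And>v N R j. I v N R j \<Longrightarrow> agree_off (nat_mods c) N N0 \<Longrightarrow> agree_off (real_mods c) R R0 \<Longrightarrow>
          bval e N R \<Longrightarrow> 0 < v \<and> runs n Z c (N, R, j) (\<lambda>(N', R', j'). I (v - 1) N' R' j') B"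
    and exit: "\<And>v N R j. I v N R j \<Longrightarrow> agree_off (nat_mods c) N N0 \<Longrightarrow> agree_off (real_mods c) R R0 \<Longrightarrow>
          \<not> bval e N R \<Longrightarrow> Q (N, R, j)"
    and b: "v0 * (B + 1) + 1 \<le> b"
  shows "runs n Z (While e c) (N0, R0, j0) Q b"
proof -
  let ?J = "\<lambda>v (N, R, j). I v N R j \<and> agree_off (nat_mods c) N N0 \<and> agree_off (real_mods c) R R0"
  have "runs n Z (While e c) (N0, R0, j0) (\<lambda>(N, R, j). \<not> bval e N R \<and> (\<exists>v. ?J v (N, R, j))) (v0 * (B + 1) + 1)"
  proof (rule runs_While_aux)
    show "?J v0 (N0, R0, j0)" using init by simp
  next
    fix v N R j assume J: "?J v (N, R, j)" and e: "bval e N R"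
    then have "0 < v" and r: "runs n Z c (N, R, j) (\<lambda>(N', R', j'). I (v - 1) N' R' j') B"
      using body by auto
    have "runs n Z c (N, R, j) (?J (v - 1)) B"
      by (rule runs_mono[OF runs_frame[OF r]]) (use J in \<open>auto simp: agree_off_def\<close>)
    then show "0 < v \<and> runs n Z c (N, R, j) (?J (v - 1)) B" using \<open>0 < v\<close> by simp
  qed
  then show ?thesis by (rule runs_mono) (use exit b in auto)
qed

lemma runs_seq_NAssign:
  "runs n Z d (N(x := nval a N), R, j) Q b \<Longrightarrow> runs n Z (Seq (NAssign x a) d) (N, R, j) Q (Suc b)"
  using runs_Seq[of n Z "NAssign x a" "(N, R, j)" "\<lambda>s. s = (N(x := nval a N), R, j)" 1 d Q b]
  by (simp add: runs_NAssign)

lemma runs_seq_RAssign: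
  "runs n Z d (N, R(x := (R x)(nval a N := rval u N R)), j) Q b \<Longrightarrow> 
    runs n Z (Seq (RAssign x a u) d) (N, R, j) Q (Suc b)"
  using runs_Seq[of n Z "RAssign x a u" "(N, R, j)" "\<lambda>s. s = (N, R(x := (R x)(nval a N := rval u N R)), j)" 1 d Q b]
  by (simp add: runs_RAssign)

lemma runs_seq_Observe:
  "j < n \<Longrightarrow> 0 \<le> rval u N R \<Longrightarrow> rval u N R \<le> 1 \<Longrightarrow>
    runs n Z d (N(x := Z j (rval u N R)), R, Suc j) Q b \<Longrightarrow>
    runs n Z (Seq (Observe x u) d) (N, R, j) Q (Suc b)"
  using runs_Seq[of n Z "Observe x u" "(N, R, j)" "\<lambda>s. s = (N(x := Z j (rval u N R)), R, Suc j)" 1 d Q b]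
  by (simp add: runs_Observe)

text \<open>Moving the continuation \<open>d\<close> into both branches avoids an intermediate
  assertion, so straight-line code with branches can be executed symbolically.\<close>

lemma runs_seq_Cond:
  "(bval e N R \<Longrightarrow> runs n Z (Seq c d) (N, R, j) Q b) \<Longrightarrow> (\<not> bval e N R \<Longrightarrow> runs n Z (Seq c' d) (N, R, j) Q b) \<Longrightarrow>
    runs n Z (Seq (Cond e c c') d) (N, R, j) Q (Suc b)"
proof -
  assume 1: "bval e N R \<Longrightarrow> runs n Z (Seq c d) (N, R, j) Q b" 
    and 2: "\<not> bval e N R \<Longrightarrow> runs n Z (Seq c' d) (N, R, j) Q b"
  have seq: "\<exists>t s'. exec n Z (Seq (Cond e c c') d) (N, R, j) t s' \<and> t \<le> Suc b \<and> Q s'"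
    if r: "runs n Z (Seq c0 d) (N, R, j) Q b" 
      and ex: "\<And>t s'. exec n Z c0 (N, R, j) t s' \<Longrightarrow> exec n Z (Cond e c c') (N, R, j) (t + 1) s'" for c0
  proof -
    obtain t s' where t: "exec n Z (Seq c0 d) (N, R, j) t s'" "t \<le> b" "Q s'"
      using r by (auto simp: runs_def)
    from t(1) obtain t1 t2 s1 where "t = t1 + t2" "exec n Z c0 (N, R, j) t1 s1" "exec n Z d s1 t2 s'"
      by (cases rule: exec.cases) auto
    with ex have "exec n Z (Seq (Cond e c c') d) (N, R, j) (t1 + 1 + t2) s'" by (intro exec.Seq)
    then show ?thesis using t(2,3) \<open>t = t1 + t2\<close> by (intro exI conjI) auto
  qed
  show ?thesis
  proof (cases "bval e N R")
    case True
    show ?thesis unfolding runs_def by (rule seq[OF 1[OF True] exec.CondTrue[OF True]])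
  next
    case False
    show ?thesis unfolding runs_def by (rule seq[OF 2[OF False] exec.CondFalse[OF False]])
  qed
qed

lemma runs_seq_SKIP: "runs n Z d s Q b \<Longrightarrow> runs n Z (Seq SKIP d) s Q (Suc b)"
  using runs_Seq[of n Z SKIP s "\<lambda>s'. s' = s" 1 d Q b] by (simp add: runs_SKIP)

lemma runs_le: "runs n Z c s Q b \<Longrightarrow> b \<le> b' \<Longrightarrow> runs n Z c s Q b'"
  by (rule runs_mono)

lemma runs_call:
  assumes "runs n Z c (N, R, j) P b"
    "\<And>N' R' j'. P (N', R', j') \<Longrightarrow> agree_off (nat_mods c) N' N \<Longrightarrow> agree_off (real_mods c) R' R \<Longrightarrow> Q (N', R', j')"
  shows "runs n Z c (N, R, j) Q b"
  by (rule runs_mono[OF runs_frame[OF assms(1)]]) (use assms(2) in auto)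

lemma runs_seq_call:
  assumes "runs n Z c (N, R, j) P b"
    "\<And>N' R' j'. P (N', R', j') \<Longrightarrow> agree_off (nat_mods c) N' N \<Longrightarrow> agree_off (real_mods c) R' R \<Longrightarrow>
       runs n Z d (N', R', j') Q b'"
  shows "runs n Z (Seq c d) (N, R, j) Q (b + b')"
  by (rule runs_Seq[OF runs_frame[OF assms(1)]]) (use assms(2) in auto)

lemmas runs_step = runs_seq_NAssign runs_seq_RAssign runs_seq_Cond runs_seq_SKIP runs_Cond
  runs_NAssign[where b = "Suc b" for b, simplified] runs_RAssign[where b = "Suc b" for b, simplified]
  runs_SKIP[where b = "Suc b" for b, simplified]

section \<open>The estimation algorithm\<close>

abbreviation seq_com :: "com \<Rightarrow> com \<Rightarrow> com" (infixr ";;" 60) where "c ;; d \<equiv> Seq c d"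

abbreviation incr :: "string \<Rightarrow> com" where "incr x \<equiv> NAssign x (NPlus (NVar x) (NConst 1))"
abbreviation decr :: "string \<Rightarrow> com" where "decr x \<equiv> NAssign x (NMinus (NVar x) (NConst 1))"
abbreviation NumR :: "nat \<Rightarrow> rexp" where "NumR c \<equiv> OfNat (NConst c)"
abbreviation RegR :: "string \<Rightarrow> rexp" where "RegR x \<equiv> OfNat (NVar x)"
abbreviation At :: "string \<Rightarrow> string \<Rightarrow> rexp" where "At a x \<equiv> Cell a (NVar x)"
abbreviation Scalar :: "string \<Rightarrow> rexp" where "Scalar a \<equiv> Cell a (NConst 0)"
abbreviation SetScalar :: "string \<Rightarrow> rexp \<Rightarrow> com" where "SetScalar a u \<equiv> RAssign a (NConst 0) u"

definition tauR :: "nexp \<Rightarrow> rexp" where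
  "tauR q = RDivide (RMinus (RegR ''M'') (OfNat q)) (RegR ''M'')"
text \<open>The strength of the tilts. With 1/(100 M), the errors 7 \<beta> and 20 \<beta> of a good
  block are 7/100 and 1/5 of the distance 1/M between neighbouring thresholds.\<close>

definition betaR :: rexp where
  "betaR = RDivide (NumR 1) (RTimes (NumR 100) (RegR ''M''))"

text \<open>
  Registers: \<open>M\<close> is the scale, \<open>T\<close> the number of samples per threshold, \<open>q\<close> the index of the threshold
  \<open>1 - q / M\<close>, \<open>l\<close> the number of records so far, \<open>m = n + 1\<close> the row length of the arrays \<open>v\<close> and \<open>y\<close>,
  and \<open>o\<close> the start of the current row. Arrays: \<open>h\<close> holds the gains and \<open>e\<close> the prices of the current
  search, \<open>c\<close> counts wins, \<open>g\<close> and \<open>f\<close> hold the share of wins and the estimated value of each agent at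
  the previous threshold, and \<open>x\<close>, \<open>z\<close>, \<open>v\<close> hold the breakpoints, accuracies and values of the records.
  Unused breakpoints have \<open>x = y = 0\<close>, which does not change the output.
\<close>

definition divide_loop :: com where
  "divide_loop = NAssign ''T'' (NConst 0) ;; NAssign ''a'' (NVar ''n'') ;;
     While (BNot (NLess (NVar ''a'') (NVar ''d'')))
       (NAssign ''a'' (NMinus (NVar ''a'') (NVar ''d'')) ;; incr ''T'')"

definition query_loop :: com where
  "query_loop = SetScalar ''u'' (RDivide (NumR 1) (NumR 2)) ;; NAssign ''s'' (NVar ''t'') ;;
     While (NLess (NConst 0) (NVar ''s''))
       (decr ''s'' ;;
        Cond (RLess (Scalar ''u'') (RDivide (RPlus (NumR 1) (At ''h'' ''s'')) (NumR 2)))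
          (SetScalar ''u'' (RDivide (Scalar ''u'') (RPlus (NumR 1) (At ''h'' ''s''))))
          (SetScalar ''u'' (RMinus (NumR 1)
             (RDivide (RMinus (NumR 1) (Scalar ''u'')) (RMinus (NumR 1) (At ''h'' ''s''))))))"

definition sample_body :: com where
  "sample_body = query_loop ;; RAssign ''e'' (NVar ''t'') (Scalar ''u'') ;;
     Observe ''w'' (Scalar ''u'') ;;
     RAssign ''c'' (NVar ''w'') (RPlus (At ''c'' ''w'') (NumR 1)) ;;
     Cond (NLess (NVar ''k'') (NVar ''w''))
       (RAssign ''h'' (NVar ''t'') (RTimes betaR (RMinus (NumR 1) (tauR (NVar ''q'')))))
       (RAssign ''h'' (NVar ''t'') (RTimes betaR (RMinus (NumR 0) (tauR (NVar ''q''))))) ;;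
     incr ''t''"

definition reset_counts :: com where
  "reset_counts = NAssign ''i'' (NConst 0) ;;
     While (NLess (NVar ''i'') (NVar ''k'')) (incr ''i'' ;; RAssign ''c'' (NVar ''i'') (NumR 0))"

definition sample_loop :: com where
  "sample_loop = reset_counts ;; NAssign ''t'' (NConst 0) ;;
     While (NLess (NVar ''t'') (NVar ''T'')) sample_body"

definition rank_loop :: com where
  "rank_loop = NAssign ''a'' (NConst 0) ;; NAssign ''b'' (NConst 0) ;; NAssign ''s'' (NConst 0) ;;
     While (NLess (NVar ''s'') (NVar ''T''))
       (Cond (RLess (At ''e'' ''s'') (At ''e'' ''t'')) (incr ''a'') SKIP ;;
        Cond (RLess (At ''e'' ''t'') (At ''e'' ''s'')) (incr ''b'') SKIP ;;
        incr ''s'')"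

definition median_loop :: com where
  "median_loop = RAssign ''x'' (NVar ''l'') (NumR 0) ;; NAssign ''t'' (NConst 0) ;;
     While (NLess (NVar ''t'') (NVar ''T''))
       (rank_loop ;;
        Cond (BAnd (BNot (NLess (NVar ''T'') (NPlus (NVar ''a'') (NVar ''a''))))
                   (BNot (NLess (NVar ''T'') (NPlus (NVar ''b'') (NVar ''b'')))))
          (RAssign ''x'' (NVar ''l'') (At ''e'' ''t'')) SKIP ;;
        incr ''t'')"

definition update_loop :: com where
  "update_loop = NAssign ''i'' (NConst 0) ;; NAssign ''o'' (NConst 0) ;;
     While (NLess (NVar ''i'') (NVar ''k''))
       (incr ''i'' ;; NAssign ''o'' (NPlus (NVar ''o'') (NVar ''m'')) ;;
        RAssign ''f'' (NVar ''i'') (RTimes (At ''f'' ''i'') (RMinus (NumR 1)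
          (RDivide (RMinus (RDivide (At ''c'' ''i'') (RegR ''T'')) (At ''g'' ''i''))
            (tauR (NMinus (NVar ''q'') (NConst 1)))))) ;;
        RAssign ''g'' (NVar ''i'') (RDivide (At ''c'' ''i'') (RegR ''T'')) ;;
        RAssign ''v'' (NPlus (NVar ''o'') (NVar ''l'')) (At ''f'' ''i''))"

definition threshold_body :: com where
  "threshold_body = incr ''l'' ;; sample_loop ;; median_loop ;;
     RAssign ''z'' (NVar ''l'') (RDivide (NumR 64) (RTimes (RegR ''M'') (Scalar ''gamma''))) ;;
     update_loop ;; incr ''q''"

definition reset_levels :: com where
  "reset_levels = NAssign ''i'' (NConst 0) ;;
     While (NLess (NVar ''i'') (NVar ''k''))
       (incr ''i'' ;; RAssign ''g'' (NVar ''i'') (NumR 0) ;; RAssign ''f'' (NVar ''i'') (NumR 1))"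

text \<open>Threshold 0 belongs to the price 1, where \<open>F\<close> is 1 and an agent wins with
  probability 0. These exact values are set by \<open>reset_levels\<close>, and the searches start
  with \<open>q = 1\<close>.\<close>

definition threshold_loop :: com where
  "threshold_loop = reset_levels ;; NAssign ''q'' (NConst 1) ;;
     While (RLess (RTimes (Scalar ''gamma'') (RegR ''M''))
                  (RTimes (NumR 2) (RMinus (RegR ''M'') (RegR ''q''))))
       threshold_body"

text \<open>Doubling \<open>M\<close> and quadrupling \<open>d\<close> halves the bound M n/d on the
  samples of a scale. It starts with n/2, since \<open>d = 2 * M\<close> initially, so the total
  stays below n.\<close>

definition scale_body :: com where
  "scale_body = divide_loop ;; threshold_loop ;;
     NAssign ''M'' (NPlus (NVar ''M'') (NVar ''M'')) ;;
     NAssign ''d'' (NPlus (NPlus (NVar ''d'') (NVar ''d'')) (NPlus (NVar ''d'') (NVar ''d'')))"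

text \<open>The bound 128 makes the increments of the logarithm small enough for the linear
  estimates, and keeps the threshold just below \<open>H z \<ge> \<gamma>\<close> above
  \<gamma>/2.\<close>

definition base_loop :: com where
  "base_loop = NAssign ''M'' (NConst 1) ;;
     While (RLess (RTimes (Scalar ''gamma'') (RegR ''M'')) (NumR 128))
       (NAssign ''M'' (NPlus (NVar ''M'') (NVar ''M'')))"

definition fold_loop :: com where
  "fold_loop = SetScalar ''u'' (NumR 1) ;; NAssign ''s'' (NVar ''l'') ;;
     While (NLess (NConst 0) (NVar ''s''))
       (Cond (RLess (At ''x'' ''t'') (At ''x'' ''s''))
          (Cond (RLess (RPlus (Cell ''v'' (NPlus (NVar ''o'') (NVar ''s''))) (At ''z'' ''s'')) (Scalar ''u''))
            (SetScalar ''u'' (RPlus (Cell ''v'' (NPlus (NVar ''o'') (NVar ''s''))) (At ''z'' ''s''))) SKIP)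
          (Cond (RLess (Scalar ''u'') (RMinus (Cell ''v'' (NPlus (NVar ''o'') (NVar ''s''))) (At ''z'' ''s'')))
            (SetScalar ''u'' (RMinus (Cell ''v'' (NPlus (NVar ''o'') (NVar ''s''))) (At ''z'' ''s''))) SKIP) ;;
        decr ''s'')"

definition row_loop :: com where
  "row_loop = NAssign ''i'' (NConst 0) ;; NAssign ''o'' (NConst 0) ;;
     While (NLess (NVar ''i'') (NVar ''k''))
       (incr ''i'' ;; NAssign ''o'' (NPlus (NVar ''o'') (NVar ''m'')) ;; fold_loop ;;
        Cond (RLess (NumR 1) (Scalar ''u'')) (SetScalar ''u'' (NumR 1)) SKIP ;;
        RAssign ''y'' (NPlus (NVar ''o'') (NVar ''t'')) (Scalar ''u''))"

definition combine_loop :: com where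
  "combine_loop = NAssign ''t'' (NConst 0) ;;
     While (NLess (NVar ''t'') (NVar ''l'')) (incr ''t'' ;; row_loop)"

text \<open>Records occupy the indices from 1 on, because \<open>threshold_body\<close> increments
  \<open>l\<close> first. Index 0 is left for the breakpoint 1 with value 1, which makes every row a
  distribution function.\<close>

definition endpoint_loop :: com where
  "endpoint_loop = RAssign ''x'' (NConst 0) (NumR 1) ;; NAssign ''i'' (NConst 0) ;; NAssign ''o'' (NConst 0) ;;
     While (NLess (NVar ''i'') (NVar ''k''))
       (incr ''i'' ;; NAssign ''o'' (NPlus (NVar ''o'') (NVar ''m'')) ;;
        RAssign ''y'' (NVar ''o'') (NumR 1))"

definition estimator :: com where
  "estimator = NAssign ''m'' (NPlus (NVar ''n'') (NConst 1)) ;; base_loop ;;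
     NAssign ''d'' (NPlus (NVar ''M'') (NVar ''M'')) ;; NAssign ''l'' (NConst 0) ;;
     While (BNot (NLess (NVar ''n'') (NVar ''d''))) scale_body ;;
     combine_loop ;; endpoint_loop"

section \<open>Correctness and running time of the loops\<close>

lemma runs_divide_loop:
  assumes "0 < N ''d''"
  shows "runs n Z divide_loop (N, R, j)
    (\<lambda>(N', R', j'). N' ''T'' = N ''n'' div N ''d'' \<and> j' = j) (5 + 3 * N ''n'')"
  unfolding divide_loop_def
proof (rule runs_le, (rule runs_seq_NAssign)+, rule runs_While[where B = 2 and ?v0.0 = "N ''n''" and
      I = "\<lambda>v N' R' j'. N' ''T'' + N' ''a'' div N ''d'' = N ''n'' div N ''d'' \<and> N' ''a'' \<le> v \<and> j' = j", OF _ _ _ order_refl],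
    goal_cases)
  case (2 v N' R' j')
  have d: "N' ''d'' = N ''d''" "\<not> N' ''a'' < N ''d''"
    using 2(4) agree_offD[OF 2(2), of "''d''"] by simp_all
  have "N' ''a'' div N ''d'' = Suc ((N' ''a'' - N ''d'') div N ''d'')"
    using d assms by (subst le_div_geq) auto
  then show ?case using 2 d assms by (auto simp: eval_nat_numeral intro!: runs_step)
next
  case (3 v N' R' j')
  then show ?case using agree_offD[OF 3(2), of "''d''"] by simp
qed simp_all

text \<open>The index runs downwards, because the newest tilt has to be undone first.\<close>

lemma runs_query_loop:
  "runs n Z query_loop (N, R, j)
    (\<lambda>(N', R', j'). R' ''u'' 0 = foldr untilt (map (R ''h'') [0..<N ''t'']) (1 / 2) \<and> j' = j) (5 + 5 * N ''t'')"
  unfolding query_loop_def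
proof (rule runs_le, (rule runs_seq_NAssign runs_seq_RAssign)+, 
    rule runs_While[where B = 4 and ?v0.0 = "N ''t''" and
      I = "\<lambda>v N' R' j'. N' ''s'' = v \<and> v \<le> N ''t'' \<and> R' ''u'' 0 = foldr untilt (map (R ''h'') [v..<N ''t'']) (1 / 2) \<and> j' = j",
      OF _ _ _ order_refl],
    goal_cases)
  case (2 v N' R' j')
  have h: "R' ''h'' = R ''h''" using agree_offD[OF 2(3), of "''h''"] by simp
  obtain v' where v: "v = Suc v'" using 2(1,4) by (cases v) auto
  have s: "N' ''s'' = Suc v'" "Suc v' \<le> N ''t''" using 2(1) v by auto
  then have u: "[v'..<N ''t''] = v' # [Suc v'..<N ''t'']" by (simp add: upt_rec)
  show ?case using 2(1) s
    by (auto simp: eval_nat_numeral h u v untilt_def intro!: runs_step)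
qed simp_all

lemma runs_rank_loop:
  "runs n Z rank_loop (N, R, j)
    (\<lambda>(N', R', j'). N' ''a'' = card {s. s < N ''T'' \<and> R ''e'' s < R ''e'' (N ''t'')} \<and>
       N' ''b'' = card {s. s < N ''T'' \<and> R ''e'' (N ''t'') < R ''e'' s} \<and> R' = R \<and> j' = j) (5 + 6 * N ''T'')"
  unfolding rank_loop_def
proof (rule runs_le, (rule runs_seq_NAssign runs_seq_RAssign)+, 
    rule runs_While[where B = 5 and ?v0.0 = "N ''T''" and
      I = "\<lambda>v N' R' j'. N' ''s'' + v = N ''T'' \<and> N' ''a'' = card {s. s < N' ''s'' \<and> R ''e'' s < R ''e'' (N ''t'')} \<and>
       N' ''b'' = card {s. s < N' ''s'' \<and> R ''e'' (N ''t'') < R ''e'' s} \<and> R' = R \<and> j' = j",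
      OF _ _ _ order_refl],
    goal_cases)
  case (2 v N' R' j')
  have fr: "N' ''T'' = N ''T''" "N' ''t'' = N ''t''"
    using agree_offD[OF 2(2), of "''T''"] agree_offD[OF 2(2), of "''t''"] by simp_all
  have ins: "{s. s < Suc i \<and> P s} = (if P i then insert i {s. s < i \<and> P s} else {s. s < i \<and> P s})"
    for i and P :: "nat \<Rightarrow> bool" by (auto simp: less_Suc_eq)
  show ?case using 2(1,4) fr
    by (auto simp: eval_nat_numeral ins intro!: runs_step)
next
  case (3 v N' R' j')
  have "N' ''s'' = N ''T''" using 3(1,4) agree_offD[OF 3(2), of "''T''"] by auto
  then show ?case using 3(1) by simp
qed simp_all

lemma runs_median_loop:
  "runs n Z median_loop (N, R, j)
    (\<lambda>(N', R', j'). R' = R(''x'' := (R ''x'')(N ''l'' := median (N ''T'') (R ''e''))) \<and> j' = j)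
    (3 + N ''T'' * (9 + 6 * N ''T''))"
  unfolding median_loop_def
proof (rule runs_le, (rule runs_seq_NAssign runs_seq_RAssign)+, 
    rule runs_While[where B = "8 + 6 * N ''T''" and ?v0.0 = "N ''T''" and
      I = "\<lambda>v N' R' j'. N' ''t'' + v = N ''T'' \<and> R' = R(''x'' := (R ''x'')(N ''l'' := 
         fold (\<lambda>t m. if is_median (N ''T'') (R ''e'') (R ''e'' t) then R ''e'' t else m) [0..<N' ''t''] 0)) \<and> j' = j",
      OF _ _ _ order_refl],
    goal_cases)
  case (2 v N' R' j')
  have fr: "N' ''T'' = N ''T''" "N' ''l'' = N ''l''"
    using agree_offD[OF 2(2), of "''T''"] agree_offD[OF 2(2), of "''l''"] by (simp_all add: rank_loop_def)
  have "runs n Z (rank_loop ;;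
        Cond (BAnd (BNot (NLess (NVar ''T'') (NPlus (NVar ''a'') (NVar ''a''))))
                   (BNot (NLess (NVar ''T'') (NPlus (NVar ''b'') (NVar ''b'')))))
          (RAssign ''x'' (NVar ''l'') (At ''e'' ''t'')) SKIP ;;
        incr ''t'') (N', R', j') (\<lambda>(N', R', j').
          N' ''t'' + (v - 1) = N ''T'' \<and> R' = R(''x'' := (R ''x'')(N ''l'' := 
         fold (\<lambda>t m. if is_median (N ''T'') (R ''e'') (R ''e'' t) then R ''e'' t else m) [0..<N' ''t''] 0)) \<and> j' = j)
       (8 + 6 * N ''T'')"
  proof (rule runs_le, rule runs_seq_call[OF runs_rank_loop, where b' = 3], goal_cases)
    case (1 N'' R'' j'')
    have fr2: "N'' ''T'' = N ''T''" "N'' ''l'' = N ''l''" "N'' ''t'' = N' ''t''"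
      using agree_offD[OF 1(2), of "''T''"] agree_offD[OF 1(2), of "''l''"] agree_offD[OF 1(2), of "''t''"] fr
      by (simp_all add: rank_loop_def)
    show ?case
      using 1(1) 2(1,4) fr fr2 by (auto simp: eval_nat_numeral is_median_def intro!: runs_step)
  qed (simp add: fr)
  then show ?case using 2(1,4) fr by auto
next
  case (3 v N' R' j')
  have "N' ''t'' = N ''T''" using 3(1,4) agree_offD[OF 3(2), of "''T''"] by (auto simp: rank_loop_def)
  then show ?case using 3(1) by (simp add: median_def)
qed simp_all

lemma runs_reset_counts:
  "runs n Z reset_counts (N, R, j)
    (\<lambda>(N', R', j'). (\<forall>i\<in>{1..N ''k''}. R' ''c'' i = 0) \<and> j' = j) (2 + 3 * N ''k'')"
  unfolding reset_counts_def
proof (rule runs_le, (rule runs_seq_NAssign runs_seq_RAssign)+, 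
    rule runs_While[where B = 2 and ?v0.0 = "N ''k''" and
      I = "\<lambda>v N' R' j'. N' ''i'' + v = N ''k'' \<and> (\<forall>i\<in>{1..N' ''i''}. R' ''c'' i = 0) \<and> j' = j",
      OF _ _ _ order_refl],
    goal_cases)
  case (2 v N' R' j')
  have fr: "N' ''k'' = N ''k''" using agree_offD[OF 2(2), of "''k''"] by simp
  show ?case using 2(1,4) fr by (auto simp: eval_nat_numeral le_Suc_eq intro!: runs_step)
next
  case (3 v N' R' j')
  then show ?case using agree_offD[OF 3(2), of "''k''"] by simp
qed simp_all

lemma runs_reset_levels:
  "runs n Z reset_levels (N, R, j)
    (\<lambda>(N', R', j'). (\<forall>i\<in>{1..N ''k''}. R' ''g'' i = 0 \<and> R' ''f'' i = 1) \<and> j' = j) (2 + 4 * N ''k'')"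
  unfolding reset_levels_def
proof (rule runs_le, (rule runs_seq_NAssign runs_seq_RAssign)+, 
    rule runs_While[where B = 3 and ?v0.0 = "N ''k''" and
      I = "\<lambda>v N' R' j'. N' ''i'' + v = N ''k'' \<and> (\<forall>i\<in>{1..N' ''i''}. R' ''g'' i = 0 \<and> R' ''f'' i = 1) \<and> j' = j",
      OF _ _ _ order_refl],
    goal_cases)
  case (2 v N' R' j')
  have fr: "N' ''k'' = N ''k''" using agree_offD[OF 2(2), of "''k''"] by simp
  show ?case using 2(1,4) fr by (auto simp: eval_nat_numeral le_Suc_eq intro!: runs_step)
next
  case (3 v N' R' j')
  then show ?case using agree_offD[OF 3(2), of "''k''"] by simp
qed simp_all

lemma transcript_eq_map:
  "transcript Z q j t = map (\<lambda>s. Z (j + s) (q (transcript Z q j s))) [0..<t]"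
  by (induction t) (auto simp: Let_def)

definition tau :: "nat \<Rightarrow> nat \<Rightarrow> real" where "tau M q = (real M - real q) / real M"

definition search_query :: "nat \<Rightarrow> nat \<Rightarrow> nat \<Rightarrow> nat list \<Rightarrow> real" where
  "search_query k M q = query k (1 / (100 * real M)) (tau M q)"

lemma tau_unit: "0 < M \<Longrightarrow> q \<le> M \<Longrightarrow> 0 \<le> tau M q \<and> tau M q \<le> 1"
  by (simp add: tau_def)

lemma search_query_unit: "0 < M \<Longrightarrow> q \<le> M \<Longrightarrow> 0 \<le> search_query k M q ws \<and> search_query k M q ws \<le> 1"
  using query_unit[of "tau M q" "1 / (100 * real M)" k ws] tau_unit[of M q]
  by (simp add: search_query_def field_simps)

lemma card_Suc_filter:
  "card {s. s < Suc t \<and> P s} = card {s. s < t \<and> P s} + of_bool (P t)"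
proof -
  have "{s. s < Suc t \<and> P s} = (if P t then insert t {s. s < t \<and> P s} else {s. s < t \<and> P s})"
    by (auto simp: less_Suc_eq)
  then show ?thesis by simp
qed

lemma runs_sample_loop:
  fixes Z N R j
  defines "q \<equiv> search_query (N ''k'') (N ''M'') (N ''q'')"
  defines "ws \<equiv> transcript Z q j (N ''T'')"
  assumes M: "0 < N ''M''" "N ''q'' \<le> N ''M''" and j: "j + N ''T'' \<le> n"
  shows "runs n Z sample_loop (N, R, j)
    (\<lambda>(N', R', j'). (\<forall>t<N ''T''. R' ''e'' t = q (take t ws)) \<and>
       (\<forall>i\<in>{1..N ''k''}. R' ''c'' i = wins ws i) \<and> j' = j + N ''T'')
    (4 + 3 * N ''k'' + N ''T'' * (12 + 5 * N ''T''))"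
proof -
  define w where "w s = Z (j + s) (q (transcript Z q j s))" for s
  define h where "h = gain (N ''k'') (1 / (100 * real (N ''M''))) (tau (N ''M'') (N ''q''))"
  have tr: "transcript Z q j t = map w [0..<t]" for t
    by (subst transcript_eq_map) (simp add: w_def)
  \<comment> \<open>The program stores gains rather than winners, so the price is rewritten as a
    fold over the gains.\<close>
  have q_eq: "q us = foldr untilt (map h us) (1 / 2)" for us
    by (simp add: q_def search_query_def query_def h_def foldr_map o_def)
  have q01: "0 \<le> q us" "q us \<le> 1" for us
    using search_query_unit[OF M] by (auto simp: q_def)
  define I where "I v N' R' j' \<longleftrightarrow> N' ''t'' + v = N ''T'' \<and> j' = j + N' ''t'' \<and>
      (\<forall>t<N' ''t''. R' ''e'' t = q (map w [0..<t]) \<and> R' ''h'' t = h (w t)) \<and>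
      (\<forall>i\<in>{1..N ''k''}. R' ''c'' i = card {t. t < N' ''t'' \<and> w t = i})" 
    for v and N' :: nregs and R' :: arrays and j'
  show ?thesis unfolding sample_loop_def
  proof (rule runs_le, rule runs_seq_call[OF runs_reset_counts], rule runs_seq_NAssign,
      rule runs_While[where I = I and B = "11 + 5 * N ''T''" and ?v0.0 = "N ''T''", OF _ _ _ order_refl], goal_cases)
    case (1 N1 R1 j1)
    have "N1 ''T'' = N ''T''" using agree_offD[OF 1(2), of "''T''"] by (simp add: reset_counts_def)
    then show ?case using 1(1) by (simp add: I_def)
  next
    case (2 N1 R1 j1 v N' R' j')
    have fr1: "N1 x = N x" if "x \<notin> {''i''}" for x
      using agree_offD[OF 2(2), of x] that by (simp add: reset_counts_def)
    have fr: "N' ''T'' = N ''T''" "N' ''k'' = N ''k''" "N' ''M'' = N ''M''" "N' ''q'' = N ''q''"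
      using agree_offD[OF 2(5), of "''T''"] agree_offD[OF 2(5), of "''k''"]
        agree_offD[OF 2(5), of "''M''"] agree_offD[OF 2(5), of "''q''"] fr1
      by (simp_all add: sample_body_def query_loop_def)
    have I: "N' ''t'' + v = N ''T''" "j' = j + N' ''t''"
      "\<And>t. t < N' ''t'' \<Longrightarrow> R' ''e'' t = q (map w [0..<t]) \<and> R' ''h'' t = h (w t)"
      "\<And>i. i \<in> {1..N ''k''} \<Longrightarrow> R' ''c'' i = card {t. t < N' ''t'' \<and> w t = i}"
      using 2(4) by (auto simp: I_def)
    have t: "N' ''t'' < N ''T''" using 2(7) fr by simp
    have "runs n Z sample_body (N', R', j') (\<lambda>(N', R', j'). I (v - 1) N' R' j') (11 + 5 * N ''T'')"
      unfolding sample_body_def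
    proof (rule runs_le, rule runs_seq_call[OF runs_query_loop, where b' = 6], goal_cases)
      case (1 N2 R2 j2)
      have fr2: "N2 x = N' x" if "x \<notin> {''s''}" for x
        using agree_offD[OF 1(2), of x] that by (simp add: query_loop_def)
      have fr2': "R2 x = R' x" if "x \<notin> {''u''}" for x
        using agree_offD[OF 1(3), of x] that by (simp add: query_loop_def)
      have "map (R' ''h'') [0..<N' ''t''] = map h (map w [0..<N' ''t''])"
        using I(3) by simp
      then have u: "R2 ''u'' 0 = q (map w [0..<N' ''t''])" and j2: "j2 = j + N' ''t''"
        using 1(1) I(2) by (simp_all only: q_eq case_prod_conv simp_thms)
      have "Z (j + N' ''t'') (q (map w [0..<N' ''t''])) = w (N' ''t'')"
        by (simp add: w_def tr)
      moreover have "j + N' ''t'' < n" using t j by simp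
      moreover have "0 < v" using I(1) t by simp
      ultimately show ?case
        using fr fr2 fr2' u j2 I t q01
        by (auto simp: eval_nat_numeral All_less_Suc I_def card_Suc_filter betaR_def tauR_def h_def gain_def tau_def 
             intro!: runs_step runs_seq_Observe)
    next
      case 2
      then show ?case using t by simp
    qed
    moreover have "0 < v" using I(1) t by simp
    ultimately show ?case by simp
  next
    case (3 N1 R1 j1 v N' R' j')
    have fr: "N' ''T'' = N ''T''"
      using agree_offD[OF 3(5), of "''T''"] agree_offD[OF 3(2), of "''T''"]
      by (simp_all add: sample_body_def query_loop_def reset_counts_def)
    have t: "N' ''t'' = N ''T''" using 3(4,7) fr by (auto simp: I_def)
    have "wins ws i = card {t. t < N ''T'' \<and> w t = i}" for i
    proof -
      have "{t. t < N ''T'' \<and> map w [0..<N ''T''] ! t = i} = {t. t < N ''T'' \<and> w t = i}" by auto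
      then show ?thesis by (simp add: wins_def ws_def tr)
    qed
    moreover have "take t ws = map w [0..<t]" if "t < N ''T''" for t
      using that by (simp add: ws_def tr take_map)
    ultimately show ?case using 3(4) t by (auto simp: I_def)
  next
    case 4
    then show ?case by simp
  qed
qed

text \<open>The clause on the unchanged entries of the array \<open>v\<close> is what preserves the
  records written earlier. The divisor belongs to the previous threshold, hence
  \<open>q - 1\<close>.\<close>

lemma runs_update_loop:
  assumes m: "0 < N ''m''"
  shows "runs n Z update_loop (N, R, j)
    (\<lambda>(N', R', j'). (\<forall>i\<in>{1..N ''k''}. R' ''g'' i = R ''c'' i / N ''T'' \<and>
         R' ''f'' i = R ''f'' i * (1 - (R ''c'' i / N ''T'' - R ''g'' i) / tau (N ''M'') (N ''q'' - 1)) \<and>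
         R' ''v'' (i * N ''m'' + N ''l'') = R' ''f'' i) \<and>
       (\<forall>i. i \<notin> {i * N ''m'' + N ''l'' |i. i \<in> {1..N ''k''}} \<longrightarrow> R' ''v'' i = R ''v'' i) \<and> j' = j)
    (3 + 6 * N ''k'')"
  unfolding update_loop_def
proof (rule runs_le, (rule runs_seq_NAssign)+, 
    rule runs_While[where B = 5 and ?v0.0 = "N ''k''" and
      I = "\<lambda>v N' R' j'. N' ''i'' + v = N ''k'' \<and> N' ''o'' = N' ''i'' * N ''m'' \<and>
       (\<forall>i\<in>{1..N' ''i''}. R' ''g'' i = R ''c'' i / N ''T'' \<and>
         R' ''f'' i = R ''f'' i * (1 - (R ''c'' i / N ''T'' - R ''g'' i) / tau (N ''M'') (N ''q'' - 1)) \<and>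
         R' ''v'' (i * N ''m'' + N ''l'') = R' ''f'' i) \<and>
       (\<forall>i>N' ''i''. R' ''g'' i = R ''g'' i \<and> R' ''f'' i = R ''f'' i) \<and>
       (\<forall>i. i \<notin> {i * N ''m'' + N ''l'' |i. i \<in> {1..N ''k''}} \<longrightarrow> R' ''v'' i = R ''v'' i) \<and> j' = j",
      OF _ _ _ order_refl],
    goal_cases)
  case (2 v N' R' j')
  have fr: "N' ''k'' = N ''k''" "N' ''T'' = N ''T''" "N' ''M'' = N ''M''" "N' ''q'' = N ''q''" "N' ''m'' = N ''m''"
      "N' ''l'' = N ''l''" "R' ''c'' = R ''c''"
    using agree_offD[OF 2(2), of "''k''"] agree_offD[OF 2(2), of "''T''"] agree_offD[OF 2(2), of "''M''"]
      agree_offD[OF 2(2), of "''q''"] agree_offD[OF 2(2), of "''m''"] agree_offD[OF 2(2), of "''l''"]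
      agree_offD[OF 2(3), of "''c''"] by simp_all
  have I: "N' ''i'' + v = N ''k''" "N' ''o'' = N' ''i'' * N ''m''"
    "\<And>i. i \<in> {1..N' ''i''} \<Longrightarrow> R' ''g'' i = R ''c'' i / N ''T'' \<and>
         R' ''f'' i = R ''f'' i * (1 - (R ''c'' i / N ''T'' - R ''g'' i) / tau (N ''M'') (N ''q'' - 1)) \<and>
         R' ''v'' (i * N ''m'' + N ''l'') = R' ''f'' i"
    "R' ''g'' (Suc (N' ''i'')) = R ''g'' (Suc (N' ''i''))" "R' ''f'' (Suc (N' ''i'')) = R ''f'' (Suc (N' ''i''))"
    "\<And>i. N' ''i'' < i \<Longrightarrow> R' ''g'' i = R ''g'' i \<and> R' ''f'' i = R ''f'' i"
    "\<And>i. i \<notin> {i * N ''m'' + N ''l'' |i. i \<in> {1..N ''k''}} \<Longrightarrow> R' ''v'' i = R ''v'' i" "j' = j"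
    using 2(1) by auto
  define a where "a = Suc (N' ''i'')"
  have a: "a \<in> {1..N ''k''}" using 2(4) fr by (simp add: a_def)
  have idx: "N' ''o'' + N ''m'' + N ''l'' = a * N ''m'' + N ''l''" using I(2) by (simp add: a_def)
  have "0 < v" using I(1) 2(4) fr by simp
  show ?case
  proof (rule conjI, rule \<open>0 < v\<close>, rule runs_le[where b = "Suc (Suc (Suc (Suc (Suc 0))))"], (rule runs_step)+, unfold case_prod_conv, intro conjI, goal_cases)
    case 3
    show ?case (is "\<forall>i\<in>_. ?P i")
    proof (rule ballI)
      fix i assume "i \<in> {1..(N'(''i'' := nval (NPlus (NVar ''i'') (NConst 1)) N',
        ''o'' := nval (NPlus (NVar ''o'') (NVar ''m'')) (N'(''i'' := nval (NPlus (NVar ''i'') (NConst 1)) N')))) ''i''}"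
      then consider "i = a" | "i \<in> {1..N' ''i''}" "i \<noteq> a" by (auto simp: le_Suc_eq a_def)
      then show "?P i"
      proof cases
        case 1
        then show ?thesis using I(4,5) fr by (simp add: idx tauR_def tau_def a_def[symmetric])
      next
        case 2
        then show ?thesis using I(3)[OF 2(1)] fr m by (simp add: idx a_def[symmetric])
      qed
    qed
  next
    case 5
    show ?case using I(7) fr a by (auto simp: idx)
  qed (use I fr \<open>0 < v\<close> in auto)
next
  case (3 v N' R' j')
  have "N' ''i'' = N ''k''" using 3(1,4) agree_offD[OF 3(2), of "''k''"] by auto
  then show ?case using 3(1) by simp
qed simp_all

section \<open>The records as functions of the observed winners\<close>

definition share :: "nat \<Rightarrow> (nat \<Rightarrow> nat list) \<Rightarrow> nat \<Rightarrow> nat \<Rightarrow> real" where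
  "share T W i q = (if q = 0 then 0 else real (wins (W q) i) / real T)"

text \<open>An Euler scheme for the logarithm of the distribution function: one step down multiplies
  the estimate by 1 minus the estimated increment, which is the increment of the share of wins
  divided by \<open>H\<close>.\<close>

fun level :: "nat \<Rightarrow> nat \<Rightarrow> (nat \<Rightarrow> nat list) \<Rightarrow> nat \<Rightarrow> nat \<Rightarrow> real" where
  "level M T W i 0 = 1"
| "level M T W i (Suc q) = level M T W i q * (1 - (share T W i (Suc q) - share T W i q) / tau M q)"

text \<open>The accuracy is the \<open>64 * \<eta> / \<gamma>\<close> of \<open>record_lower\<close>
  and \<open>record_upper\<close>, with \<open>\<eta> = 1 / M\<close>.\<close>

definition threshold_estimate :: "nat \<Rightarrow> real \<Rightarrow> nat \<Rightarrow> nat \<Rightarrow> (nat \<Rightarrow> nat list) \<Rightarrow> nat \<Rightarrow> estimate" where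
  "threshold_estimate k \<gamma> M T W q =
     (median T (\<lambda>t. search_query k M q (take t (W q))), 64 / (M * \<gamma>), \<lambda>i. level M T W i q)"

definition scale_estimates :: "nat \<Rightarrow> real \<Rightarrow> nat \<Rightarrow> nat \<Rightarrow> (nat \<Rightarrow> nat list) \<Rightarrow> nat \<Rightarrow> estimate list" where
  "scale_estimates k \<gamma> M T W c = map (threshold_estimate k \<gamma> M T W) [1..<Suc c]"

lemma scale_estimates_0 [simp]: "scale_estimates k \<gamma> M T W 0 = []"
  and scale_estimates_Suc: "scale_estimates k \<gamma> M T W (Suc c) = 
    scale_estimates k \<gamma> M T W c @ [threshold_estimate k \<gamma> M T W (Suc c)]"
  by (simp_all add: scale_estimates_def)

lemma length_scale_estimates [simp]: "length (scale_estimates k \<gamma> M T W c) = c"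
  by (simp add: scale_estimates_def)

definition stored :: "nat \<Rightarrow> nat \<Rightarrow> estimate list \<Rightarrow> arrays \<Rightarrow> bool" where
  "stored k m es R \<longleftrightarrow>
     (\<forall>l<length es. R ''x'' (Suc l) = fst (es ! l) \<and> R ''z'' (Suc l) = fst (snd (es ! l)) \<and>
        (\<forall>i\<in>{1..k}. R ''v'' (i * m + Suc l) = snd (snd (es ! l)) i)) \<and>
     (\<forall>l>length es. R ''x'' l = 0)"

lemma index_unique:
  fixes m :: nat
  assumes "i * m + l = i' * m + l'" "l < m" "l' < m"
  shows "i = i' \<and> l = l'"
proof -
  have "l = l'" using arg_cong[OF assms(1), of "\<lambda>a. a mod m"] assms(2,3) by simp
  then show ?thesis using assms by simp
qed

lemma stored_snoc:
  assumes "stored k m es R" "Suc (length es) < m"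
    and "R' ''x'' = (R ''x'')(Suc (length es) := b)" "R' ''z'' = (R ''z'')(Suc (length es) := r)"
    and "\<And>i. i \<in> {1..k} \<Longrightarrow> R' ''v'' (i * m + Suc (length es)) = Y i"
    and "\<And>a. a \<notin> {i * m + Suc (length es) |i. i \<in> {1..k}} \<Longrightarrow> R' ''v'' a = R ''v'' a"
  shows "stored k m (es @ [(b, r, Y)]) R'"
proof -
  have "R' ''v'' (i * m + Suc l) = snd (snd (es ! l)) i" if "i \<in> {1..k}" "l < length es" for i l
  proof -
    have "i * m + Suc l \<notin> {i * m + Suc (length es) |i. i \<in> {1..k}}"
      using index_unique[of i m "Suc l" _ "Suc (length es)"] assms(2) that(2) by fastforce
    then show ?thesis using assms(1,6) that by (simp add: stored_def)
  qed
  then show ?thesis using assms by (auto simp: stored_def nth_append less_Suc_eq)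
qed

lemma runs_threshold_body:
  assumes N: "N ''k'' = k" "N ''m'' = m" "N ''M'' = M" "N ''T'' = T" "N ''q'' = q" "N ''l'' = length es"
    and R: "R ''gamma'' 0 = \<gamma>" "stored k m es R"
      "\<And>i. i \<in> {1..k} \<Longrightarrow> R ''g'' i = share T W i (q - 1) \<and> R ''f'' i = level M T W i (q - 1)"
    and W: "W q = transcript Z (search_query k M q) j T"
    and q: "0 < q" "q \<le> M" and j: "j + T \<le> n" and m: "Suc (length es) < m"
  shows "runs n Z threshold_body (N, R, j)
    (\<lambda>(N', R', j'). N' ''q'' = Suc q \<and> N' ''l'' = Suc (length es) \<and> j' = j + T \<and>
       stored k m (es @ [threshold_estimate k \<gamma> M T W q]) R' \<and>
       (\<forall>i\<in>{1..k}. R' ''g'' i = share T W i q \<and> R' ''f'' i = level M T W i q))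
    (14 + 9 * k + T * (21 + 11 * T))"
proof -
  have M: "0 < M" using q by simp
  let ?N = "N(''l'' := nval (NPlus (NVar ''l'') (NConst 1)) N)"
  show ?thesis unfolding threshold_body_def
  proof (rule runs_le, rule runs_seq_NAssign, 
      rule runs_seq_call[OF runs_sample_loop, where b' = "3 + T * (9 + 6 * T) + Suc (3 + 6 * k + 1)"], goal_cases)
    case 1 then show ?case using M N by simp
  next
    case 2 then show ?case using q N by simp
  next
    case 3 then show ?case using j N by simp
  next
    case (4 N1 R1 j1)
    have n1: "N1 x = ?N x" if "x \<notin> {''i'', ''t'', ''s'', ''w''}" for x
      using agree_offD[OF 4(2), of x] that by (simp add: sample_loop_def sample_body_def query_loop_def reset_counts_def)
    have r1: "R1 x = R x" if "x \<notin> {''c'', ''u'', ''e'', ''h''}" for x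
      using agree_offD[OF 4(3), of x] that by (simp add: sample_loop_def sample_body_def query_loop_def reset_counts_def)
    have e1: "t < T \<Longrightarrow> R1 ''e'' t = search_query k M q (take t (W q))"
      "i \<in> {1..k} \<Longrightarrow> R1 ''c'' i = wins (W q) i" and j1: "j1 = j + T" for t i
      using 4(1) N W by auto
    show ?case
    proof (rule runs_le, rule runs_seq_call[OF runs_median_loop, where b' = "Suc (3 + 6 * k + 1)"],
        rule runs_seq_RAssign, rule runs_le, 
        rule runs_seq_call[OF runs_update_loop, where b' = 1], goal_cases)
      case (1 N2 R2 j2)
      have n2: "N2 x = N1 x" if "x \<notin> {''t'', ''a'', ''b'', ''s''}" for x
        using agree_offD[OF 1(2), of x] that by (simp add: median_loop_def rank_loop_def)
      show ?case using n2 n1 N m by simp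
    next
      case (3 N2 R2 j2)
      have n2: "N2 x = N1 x" if "x \<notin> {''t'', ''a'', ''b'', ''s''}" for x
        using agree_offD[OF 3(2), of x] that by (simp add: median_loop_def rank_loop_def)
      show ?case using n2 n1 N by simp
    next
      case 4
      show ?case using n1 N by simp
    next
      case (2 N2 R2 j2 N3 R3 j3)
      have n2: "N2 x = N1 x" if "x \<notin> {''t'', ''a'', ''b'', ''s''}" for x
        using agree_offD[OF 2(2), of x] that by (simp add: median_loop_def rank_loop_def)
      have r2: "R2 = R1(''x'' := (R1 ''x'')(Suc (length es) := median T (R1 ''e'')))" "j2 = j1"
        using 2(1) n1 N by auto
      \<comment> \<open>A median depends on the entries below \<open>T\<close> only, and there the
        array agrees with the prices.\<close>
      have med: "median T (R1 ''e'') = median T (\<lambda>t. search_query k M q (take t (W q)))"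
      proof -
        have set: "{s. s < T \<and> R1 ''e'' s < v} = {s. s < T \<and> search_query k M q (take s (W q)) < v}"
          "{s. s < T \<and> v < R1 ''e'' s} = {s. s < T \<and> v < search_query k M q (take s (W q))}" for v
          using e1(1) by auto
        have "is_median T (R1 ''e'') v \<longleftrightarrow> is_median T (\<lambda>t. search_query k M q (take t (W q))) v" for v
          unfolding is_median_def set by simp
        then show ?thesis unfolding median_def using e1(1) by (intro fold_cong) auto
      qed
      have n3: "N3 x = N2 x" if "x \<notin> {''i'', ''o''}" for x
        using agree_offD[OF 2(5), of x] that by (simp add: update_loop_def)
      have regs: "N2 ''k'' = k" "N2 ''m'' = m" "N2 ''M'' = M" "N2 ''T'' = T" "N2 ''q'' = q" "N2 ''l'' = Suc (length es)"
        using n1 n2 N by simp_all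
      have regs3: "N3 ''q'' = q" "N3 ''l'' = Suc (length es)" using n3 regs by simp_all
      let ?R = "R2(''z'' := (R2 ''z'')(nval (NVar ''l'') N2 :=
                 rval (RDivide (NumR 64) (RTimes (RegR ''M'') (Scalar ''gamma''))) N2 R2))"
      have r3: "R3 x = ?R x" if "x \<notin> {''f'', ''g'', ''v''}" for x
        using agree_offD[OF 2(6), of x] that by (simp add: update_loop_def)
      have gf: "R2 ''g'' = R ''g''" "R2 ''f'' = R ''f''" "R2 ''c'' = R1 ''c''" "R2 ''v'' = R ''v''" "R2 ''z'' = R ''z''"
         "R2 ''gamma'' = R ''gamma''" "R1 ''x'' = R ''x''"
        using r1 by (simp_all add: r2)
      have upd: "R3 ''g'' i = share T W i q \<and> R3 ''f'' i = level M T W i q \<and>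
          R3 ''v'' (i * m + Suc (length es)) = level M T W i q" if i: "i \<in> {1..k}" for i
      proof -
        have "R3 ''g'' i = wins (W q) i / T \<and> R3 ''f'' i = level M T W i (q - 1) * 
           (1 - (wins (W q) i / T - share T W i (q - 1)) / tau M (q - 1)) \<and>
           R3 ''v'' (i * m + Suc (length es)) = R3 ''f'' i"
          using 2(4) i R(3)[OF i] e1(2)[OF i] regs gf by simp
        then show ?thesis using q by (cases q) (auto simp: share_def)
      qed
      have other: "R3 ''v'' a = R ''v'' a" if "a \<notin> {i * m + Suc (length es) |i. i \<in> {1..k}}" for a
        using 2(4) regs gf that by simp
      have "stored k m (es @ [threshold_estimate k \<gamma> M T W q]) R3"
        unfolding threshold_estimate_def
      proof (rule stored_snoc[OF R(2) m])
        show "R3 ''x'' = (R ''x'')(Suc (length es) := median T (\<lambda>t. search_query k M q (take t (W q))))"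
          using r3[of "''x''"] gf by (simp add: r2 med)
        show "R3 ''z'' = (R ''z'')(Suc (length es) := 64 / (M * \<gamma>))"
          using r3[of "''z''"] gf regs R(1) by simp
      qed (use upd other in auto)
      then show ?case using 2(4) upd regs3 r2 j1
        by (auto intro!: runs_NAssign)
    qed
  next
    case 5
    then show ?case using N by (simp add: distrib_left)
  qed
qed

section \<open>The number of thresholds and the initial scale\<close>

definition active :: "real \<Rightarrow> nat \<Rightarrow> nat \<Rightarrow> bool" where
  "active \<gamma> M q \<longleftrightarrow> \<gamma> * M < 2 * (real M - real q)"

definition thresholds :: "real \<Rightarrow> nat \<Rightarrow> nat" where
  "thresholds \<gamma> M = (LEAST c. \<not> active \<gamma> M (Suc c))"

lemma active_less: "0 < \<gamma> \<Longrightarrow> active \<gamma> M q \<Longrightarrow> q < M"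
proof -
  assume "0 < \<gamma>" and a: "active \<gamma> M q"
  then have "0 \<le> \<gamma> * M" by simp
  with a have "0 < 2 * (real M - real q)" unfolding active_def by linarith
  then show "q < M" by simp
qed

lemma active_mono: "active \<gamma> M q \<Longrightarrow> q' \<le> q \<Longrightarrow> active \<gamma> M q'"
  by (simp add: active_def)

text \<open>The loop stops at the first inactive index. Activity passes to smaller indices, so no
  active index comes later.\<close>

lemma active_thresholds_iff:
  assumes "0 < \<gamma>" "0 < q"
  shows "active \<gamma> M q \<longleftrightarrow> q \<le> thresholds \<gamma> M"
proof -
  have ex: "\<not> active \<gamma> M (Suc M)" using active_less[OF assms(1)] by fastforce
  have stop: "\<not> active \<gamma> M (Suc (thresholds \<gamma> M))"
    unfolding thresholds_def using ex by (rule LeastI)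
  have go: "active \<gamma> M (Suc c)" if "c < thresholds \<gamma> M" for c
    using not_less_Least[of c "\<lambda>c. \<not> active \<gamma> M (Suc c)"] that by (simp add: thresholds_def)
  show ?thesis
  proof
    assume a: "active \<gamma> M q"
    show "q \<le> thresholds \<gamma> M"
    proof (rule ccontr)
      assume "\<not> q \<le> thresholds \<gamma> M"
      then show False using active_mono[OF a, of "Suc (thresholds \<gamma> M)"] stop by simp
    qed
  next
    assume "q \<le> thresholds \<gamma> M"
    then show "active \<gamma> M q" using go[of "q - 1"] assms by simp
  qed
qed

lemma thresholds_le: "0 < \<gamma> \<Longrightarrow> thresholds \<gamma> M \<le> M"
proof (cases "thresholds \<gamma> M")
  case (Suc c)
  assume g: "0 < \<gamma>"
  then have "active \<gamma> M (thresholds \<gamma> M)" using Suc by (subst active_thresholds_iff) auto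
  then show ?thesis using active_less[OF g] by fastforce
qed simp

lemma runs_threshold_loop:
  assumes N: "N ''k'' = k" "N ''m'' = m" "N ''M'' = M" "N ''T'' = T" "N ''l'' = length es"
    and R: "R ''gamma'' 0 = \<gamma>" "stored k m es R"
    and \<gamma>: "0 < \<gamma>" and c: "c = thresholds \<gamma> M"
    and W: "\<And>q. q \<in> {1..c} \<Longrightarrow> W q = transcript Z (search_query k M q) (j + (q - 1) * T) T"
    and j: "j + c * T \<le> n" and m: "length es + c < m"
  shows "runs n Z threshold_loop (N, R, j)
    (\<lambda>(N', R', j'). N' ''l'' = length es + c \<and> j' = j + c * T \<and>
       stored k m (es @ scale_estimates k \<gamma> M T W c) R')
    (4 + 4 * k + c * (15 + 9 * k + T * (21 + 11 * T)))"
proof -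
  define I where "I v N' R' j' \<longleftrightarrow> (\<exists>d. d + v = c \<and> N' ''q'' = Suc d \<and> N' ''l'' = length es + d \<and>
     j' = j + d * T \<and> stored k m (es @ scale_estimates k \<gamma> M T W d) R' \<and>
     (\<forall>i\<in>{1..k}. R' ''g'' i = share T W i d \<and> R' ''f'' i = level M T W i d))"
    for v and N' :: nregs and R' :: arrays and j'
  have mods: "nat_mods threshold_body = {''l'', ''i'', ''t'', ''s'', ''w'', ''a'', ''b'', ''o'', ''q''}"
    "real_mods threshold_body = {''c'', ''u'', ''e'', ''h'', ''x'', ''z'', ''f'', ''g'', ''v''}"
    by (auto simp: threshold_body_def sample_loop_def sample_body_def query_loop_def reset_counts_def
        median_loop_def rank_loop_def update_loop_def)
  show ?thesis unfolding threshold_loop_def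
  proof (rule runs_le, rule runs_seq_call[OF runs_reset_levels, where b' = "Suc (c * (15 + 9 * k + T * (21 + 11 * T)) + 1)"],
      rule runs_seq_NAssign,
      rule runs_While[where I = I and B = "14 + 9 * k + T * (21 + 11 * T)" and ?v0.0 = c], goal_cases)
    case (1 N1 R1 j1)
    have "N1 ''l'' = length es" "R1 ''x'' = R ''x''" "R1 ''z'' = R ''z''" "R1 ''v'' = R ''v''"
      using agree_offD[OF 1(2), of "''l''"] agree_offD[OF 1(3), of "''x''"]
        agree_offD[OF 1(3), of "''z''"] agree_offD[OF 1(3), of "''v''"] N
      by (simp_all add: reset_levels_def)
    then show ?case using 1(1) R N by (auto simp: I_def stored_def share_def)
  next
    case (2 N1 R1 j1 v N' R' j')
    have n: "N' x = N x" if "x \<in> {''k'', ''m'', ''M'', ''T''}" for x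
      using that agree_offD[OF 2(2), of x] agree_offD[OF 2(5), of x] by (auto simp: reset_levels_def mods)
    have g: "R' ''gamma'' = R ''gamma''"
      using agree_offD[OF 2(3), of "''gamma''"] agree_offD[OF 2(6), of "''gamma''"]
      by (simp add: reset_levels_def mods)
    obtain d where d: "d + v = c" "N' ''q'' = Suc d" "N' ''l'' = length es + d" "j' = j + d * T" 
      "stored k m (es @ scale_estimates k \<gamma> M T W d) R'"
      "\<forall>i\<in>{1..k}. R' ''g'' i = share T W i d \<and> R' ''f'' i = level M T W i d"
      using 2(4) by (auto simp: I_def)
    have "active \<gamma> M (Suc d)" using 2(7) n[of "''M''"] N g R d by (simp add: active_def)
    then have dc: "Suc d \<le> c" and dM: "Suc d \<le> M"
      using active_thresholds_iff[OF \<gamma>, of "Suc d"] active_less[OF \<gamma>] c by fastforce+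
    have "j + Suc d * T \<le> j + c * T" using dc by (intro add_left_mono mult_right_mono) auto
    then have jd: "j + d * T + T \<le> n" using j by simp
    have v: "0 < v" "d + 1 + (v - 1) = c" using d dc by auto
    have "runs n Z threshold_body (N', R', j') (\<lambda>(N', R', j'). N' ''q'' = Suc (Suc d) \<and> 
        N' ''l'' = Suc (length (es @ scale_estimates k \<gamma> M T W d)) \<and> j' = j + d * T + T \<and>
       stored k m ((es @ scale_estimates k \<gamma> M T W d) @ [threshold_estimate k \<gamma> M T W (Suc d)]) R' \<and>
       (\<forall>i\<in>{1..k}. R' ''g'' i = share T W i (Suc d) \<and> R' ''f'' i = level M T W i (Suc d)))
      (14 + 9 * k + T * (21 + 11 * T))"
      unfolding d(4)
      by (rule runs_threshold_body) (use n N g R d W[of "Suc d"] dc dM jd m in auto)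
    then have "runs n Z threshold_body (N', R', j') (\<lambda>(N', R', j'). I (v - 1) N' R' j') (14 + 9 * k + T * (21 + 11 * T))"
      by (rule runs_mono) (use v in \<open>auto simp: I_def scale_estimates_Suc intro!: exI[of _ "Suc d"]\<close>)
    then show ?case using v by simp
  next
    case (3 N1 R1 j1 v N' R' j')
    have n: "N' ''M'' = M"
      using agree_offD[OF 3(2), of "''M''"] agree_offD[OF 3(5), of "''M''"] N by (simp add: reset_levels_def mods)
    have g: "R' ''gamma'' 0 = \<gamma>"
      using agree_offD[OF 3(3), of "''gamma''"] agree_offD[OF 3(6), of "''gamma''"] R
      by (simp add: reset_levels_def mods)
    obtain d where d: "d + v = c" "N' ''q'' = Suc d" "N' ''l'' = length es + d" "j' = j + d * T" 
      "stored k m (es @ scale_estimates k \<gamma> M T W d) R'"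
      using 3(4) by (auto simp: I_def)
    have "\<not> active \<gamma> M (Suc d)" using 3(7) n g d by (simp add: active_def)
    then have "d = c" using active_thresholds_iff[OF \<gamma>, of "Suc d"] c d by simp
    then show ?case using d by simp
  next
    case 4
    then show ?case by simp
  next
    case 5
    then show ?case using N by simp
  qed
qed

definition base_size :: "real \<Rightarrow> nat" where
  "base_size \<gamma> = 2 ^ (LEAST e::nat. 128 \<le> \<gamma> * 2 ^ e)"

lemma base_size:
  assumes "0 < \<gamma>"
  shows "128 \<le> \<gamma> * base_size \<gamma>" "\<gamma> \<le> 1 \<Longrightarrow> \<gamma> * base_size \<gamma> < 256" "0 < base_size \<gamma>"
proof -
  let ?P = "\<lambda>e::nat. 128 \<le> \<gamma> * 2 ^ e"
  obtain e where "128 / \<gamma> < 2 ^ e" using real_arch_pow[of 2 "128 / \<gamma>"] by auto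
  then have "?P e" using assms by (simp add: field_simps)
  then have L: "?P (LEAST e. ?P e)" by (rule LeastI)
  then show "128 \<le> \<gamma> * base_size \<gamma>" by (simp add: base_size_def)
  show "0 < base_size \<gamma>" by (simp add: base_size_def)
  assume "\<gamma> \<le> 1"
  show "\<gamma> * base_size \<gamma> < 256"
  proof (cases "LEAST e. ?P e")
    case 0
    then show ?thesis using \<open>\<gamma> \<le> 1\<close> by (simp add: base_size_def)
  next
    case (Suc e)
    then have "\<not> ?P e" using not_less_Least[of e ?P] by simp
    then show ?thesis by (simp add: base_size_def Suc)
  qed
qed

lemma runs_base_loop:
  assumes \<gamma>: "0 < \<gamma>" and R: "R ''gamma'' 0 = \<gamma>"
  shows "runs n Z base_loop (N, R, j) (\<lambda>(N', R', j'). N' ''M'' = base_size \<gamma> \<and> j' = j) (2 + 2 * base_size \<gamma>)"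
proof -
  let ?P = "\<lambda>e::nat. 128 \<le> \<gamma> * 2 ^ e"
  define E where "E = (LEAST e. ?P e)"
  obtain e where "128 / \<gamma> < 2 ^ e" using real_arch_pow[of 2 "128 / \<gamma>"] by auto
  then have "?P e" using \<gamma> by (simp add: field_simps)
  then have E: "?P E" unfolding E_def by (rule LeastI)
  have E': "\<not> ?P e" if "e < E" for e using not_less_Least[of e ?P] that by (simp add: E_def)
  have "E \<le> 2 ^ E" using less_exp[of E] by simp
  then have le: "E \<le> base_size \<gamma>" by (simp add: base_size_def E_def)
  show ?thesis unfolding base_loop_def
  proof (rule runs_le, rule runs_seq_NAssign,
      rule runs_While[where B = 1 and ?v0.0 = E and
        I = "\<lambda>v N' R' j'. \<exists>e. e + v = E \<and> N' ''M'' = 2 ^ e \<and> j' = j", OF _ _ _ order_refl], goal_cases)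
    case (2 v N' R' j')
    obtain e where e: "e + v = E" "N' ''M'' = 2 ^ e" "j' = j" using 2(1) by auto
    have g: "R' ''gamma'' 0 = \<gamma>" using agree_offD[OF 2(3), of "''gamma''"] R by simp
    have "\<not> ?P e" using 2(4) e g by simp
    then have "e \<noteq> E" using E by auto
    then have v: "0 < v" "Suc e + (v - 1) = E" using e by auto
    have "runs n Z (NAssign ''M'' (NPlus (NVar ''M'') (NVar ''M''))) (N', R', j')
       (\<lambda>(N', R', j'). \<exists>e. e + (v - 1) = E \<and> N' ''M'' = 2 ^ e \<and> j' = j) 1"
      by (rule runs_NAssign) (use v e in \<open>auto intro!: exI[of _ "Suc e"]\<close>)
    then show ?case using v by simp
  next
    case (3 v N' R' j')
    obtain e where e: "e + v = E" "N' ''M'' = 2 ^ e" "j' = j" using 3(1) by auto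
    have g: "R' ''gamma'' 0 = \<gamma>" using agree_offD[OF 3(3), of "''gamma''"] R by simp
    have "?P e" using 3(4) e g by simp
    then have "e = E" using E' e by (cases "e < E") auto
    then show ?case using e by (simp add: base_size_def E_def)
  qed (use le in auto)
qed

lemma runs_fold_loop:
  assumes N: "N ''l'' = length es"
    and es: "\<And>l. l < length es \<Longrightarrow> R ''x'' (Suc l) = fst (es ! l) \<and> R ''z'' (Suc l) = fst (snd (es ! l)) \<and>
        R ''v'' (N ''o'' + Suc l) = snd (snd (es ! l)) i"
  shows "runs n Z fold_loop (N, R, j)
    (\<lambda>(N', R', j'). R' ''u'' 0 = combine i (R ''x'' (N ''t'')) es 1 \<and> j' = j) (3 + 5 * length es)"
  unfolding fold_loop_def
proof (rule runs_le, (rule runs_seq_NAssign runs_seq_RAssign)+,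
    rule runs_While[where B = 4 and ?v0.0 = "length es" and
        I = "\<lambda>v N' R' j'. N' ''s'' = v \<and> v \<le> length es \<and> 
          R' ''u'' 0 = combine i (R ''x'' (N ''t'')) (drop v es) 1 \<and> j' = j", OF _ _ _ order_refl], goal_cases)
  case (2 v N' R' j')
  have fr: "N' ''t'' = N ''t''" "N' ''o'' = N ''o''" "R' ''x'' = R ''x''" "R' ''z'' = R ''z''" "R' ''v'' = R ''v''"
    using agree_offD[OF 2(2), of "''t''"] agree_offD[OF 2(2), of "''o''"]
      agree_offD[OF 2(3), of "''x''"] agree_offD[OF 2(3), of "''z''"] agree_offD[OF 2(3), of "''v''"] by simp_all
  obtain v' where v: "v = Suc v'" using 2(1,4) by (cases v) auto
  have s: "N' ''s'' = Suc v'" "Suc v' \<le> length es" using 2(1) v by auto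
  obtain b r Y where e: "es ! v' = (b, r, Y)" by (cases "es ! v'")
  have d: "drop v' es = (b, r, Y) # drop (Suc v') es"
    using s e by (metis Cons_nth_drop_Suc Suc_le_lessD)
  have vals: "R ''x'' (Suc v') = b" "R ''z'' (Suc v') = r" "R ''v'' (N ''o'' + Suc v') = Y i"
    using es[of v'] s e by auto
  show ?case using 2(1) s vals
    by (auto simp: eval_nat_numeral fr v d intro!: runs_step)
qed (use N in auto)

lemma runs_row_loop:
  assumes N: "N ''k'' = k" "N ''m'' = m" "N ''l'' = length es" "N ''t'' = t"
    and m: "0 < m" and R: "stored k m es R"
  shows "runs n Z row_loop (N, R, j)
    (\<lambda>(N', R', j'). (\<forall>i\<in>{1..k}. R' ''y'' (i * m + t) = min 1 (combine i (R ''x'' t) es 1)) \<and>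
       (\<forall>a. a \<notin> {i * m + t |i. i \<in> {1..k}} \<longrightarrow> R' ''y'' a = R ''y'' a) \<and> j' = j)
    (3 + k * (10 + 5 * length es))"
proof -
  define I where "I v N' R' j' \<longleftrightarrow> N' ''i'' + v = k \<and> N' ''o'' = N' ''i'' * m \<and>
     (\<forall>i\<in>{1..N' ''i''}. R' ''y'' (i * m + t) = min 1 (combine i (R ''x'' t) es 1)) \<and>
     (\<forall>a. a \<notin> {i * m + t |i. i \<in> {1..k}} \<longrightarrow> R' ''y'' a = R ''y'' a) \<and> j' = j"
    for v and N' :: nregs and R' :: arrays and j'
  show ?thesis unfolding row_loop_def
  proof (rule runs_le, (rule runs_seq_NAssign)+,
      rule runs_While[where I = I and B = "9 + 5 * length es" and ?v0.0 = k, OF _ _ _ order_refl], goal_cases)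
    case 1
    then show ?case by (simp add: I_def)
  next
    case (2 v N' R' j')
    have fr: "N' ''k'' = k" "N' ''m'' = m" "N' ''l'' = length es" "N' ''t'' = t"
      using agree_offD[OF 2(2), of "''k''"] agree_offD[OF 2(2), of "''m''"] agree_offD[OF 2(2), of "''l''"]
        agree_offD[OF 2(2), of "''t''"] N by (simp_all add: fold_loop_def)
    have fr': "R' ''x'' = R ''x''" "R' ''z'' = R ''z''" "R' ''v'' = R ''v''"
      using agree_offD[OF 2(3), of "''x''"] agree_offD[OF 2(3), of "''z''"] agree_offD[OF 2(3), of "''v''"]
      by (simp_all add: fold_loop_def)
    have I: "N' ''i'' + v = k" "N' ''o'' = N' ''i'' * m"
      "\<And>i. i \<in> {1..N' ''i''} \<Longrightarrow> R' ''y'' (i * m + t) = min 1 (combine i (R ''x'' t) es 1)"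
      "\<And>a. a \<notin> {i * m + t |i. i \<in> {1..k}} \<Longrightarrow> R' ''y'' a = R ''y'' a" "j' = j"
      using 2(1) by (auto simp: I_def)
    define a where "a = Suc (N' ''i'')"
    have a: "a \<in> {1..k}" using 2(4) fr by (simp add: a_def)
    have v: "0 < v" using I(1) 2(4) fr by simp
    have am: "N' ''o'' + m = a * m" using I(2) by (simp add: a_def)
    let ?N1 = "N'(''i'' := nval (NPlus (NVar ''i'') (NConst 1)) N')"
    let ?N2 = "?N1(''o'' := nval (NPlus (NVar ''o'') (NVar ''m'')) ?N1)"
    have fold: "runs n Z fold_loop (?N2, R', j')
      (\<lambda>(N'', R'', j''). R'' ''u'' 0 = combine a (R' ''x'' (?N2 ''t'')) es 1 \<and> j'' = j') (3 + 5 * length es)"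
      using R a by (intro runs_fold_loop) (auto simp: fr fr' am stored_def)
    have "runs n Z (incr ''i'' ;; NAssign ''o'' (NPlus (NVar ''o'') (NVar ''m'')) ;; fold_loop ;;
        Cond (RLess (NumR 1) (Scalar ''u'')) (SetScalar ''u'' (NumR 1)) SKIP ;;
        RAssign ''y'' (NPlus (NVar ''o'') (NVar ''t'')) (Scalar ''u'')) (N', R', j')
        (\<lambda>(N', R', j'). I (v - 1) N' R' j') (9 + 5 * length es)"
    proof (rule runs_le, (rule runs_seq_NAssign)+, rule runs_seq_call[OF fold, where b' = 4], goal_cases)
      case (1 N3 R3 j3)
      have n3: "N3 x = ?N2 x" if "x \<notin> {''s''}" for x
        using agree_offD[OF 1(2), of x] that by (simp add: fold_loop_def)
      have r3: "R3 ''y'' = R' ''y''"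
        using agree_offD[OF 1(3), of "''y''"] by (simp add: fold_loop_def)
      have u: "R3 ''u'' 0 = combine a (R ''x'' t) es 1" "j3 = j" using 1(1) fr fr' I(5) by auto
      have regs: "N3 ''i'' = a" "N3 ''o'' = a * m" "N3 ''t'' = t" using n3 fr am by (simp_all add: a_def)
      have finish: "I (v - 1) N3 R4 j" if "R4 ''y'' = (R' ''y'')(a * m + t := min 1 (combine a (R ''x'' t) es 1))" for R4
        unfolding I_def
      proof (intro conjI ballI allI impI)
        fix i assume "i \<in> {1..N3 ''i''}"
        then consider "i = a" | "i \<in> {1..N' ''i''}" "i \<noteq> a" by (auto simp: regs le_Suc_eq a_def)
        then show "R4 ''y'' (i * m + t) = min 1 (combine i (R ''x'' t) es 1)"
          by cases (use I(3) m in \<open>auto simp: that\<close>)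
      next
        fix b assume "b \<notin> {i * m + t |i. i \<in> {1..k}}"
        then show "R4 ''y'' b = R ''y'' b" using I(4)[of b] a by (auto simp: that)
      qed (use regs I v in \<open>auto simp: a_def\<close>)
      show ?case using finish
        by (auto simp: eval_nat_numeral regs u r3 min_def intro!: runs_step)
    next
      case 2
      then show ?case by simp
    qed
    then show ?case using v by simp
  next
    case (3 v N' R' j')
    have "N' ''i'' = k" using 3(1,4) agree_offD[OF 3(2), of "''k''"] N by (auto simp: I_def fold_loop_def)
    then show ?case using 3(1) by (simp add: I_def)
  next
    case 4
    then show ?case by simp
  qed
qed

lemma runs_combine_loop:
  assumes N: "N ''k'' = k" "N ''m'' = m" "N ''l'' = length es"
    and m: "length es < m" and R: "stored k m es R"
  shows "runs n Z combine_loop (N, R, j)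
    (\<lambda>(N', R', j'). (\<forall>i\<in>{1..k}. \<forall>t\<in>{1..length es}. R' ''y'' (i * m + t) = min 1 (combine i (R ''x'' t) es 1)) \<and>
       (\<forall>a. a \<notin> {i * m + t |i t. i \<in> {1..k} \<and> t \<in> {1..length es}} \<longrightarrow> R' ''y'' a = R ''y'' a) \<and> j' = j)
    (2 + length es * (5 + k * (10 + 5 * length es)))"
proof -
  define I where "I v N' R' j' \<longleftrightarrow> N' ''t'' + v = length es \<and>
     (\<forall>i\<in>{1..k}. \<forall>t\<in>{1..N' ''t''}. R' ''y'' (i * m + t) = min 1 (combine i (R ''x'' t) es 1)) \<and>
     (\<forall>a. a \<notin> {i * m + t |i t. i \<in> {1..k} \<and> t \<in> {1..length es}} \<longrightarrow> R' ''y'' a = R ''y'' a) \<and> j' = j"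
    for v and N' :: nregs and R' :: arrays and j'
  show ?thesis unfolding combine_loop_def
  proof (rule runs_le, (rule runs_seq_NAssign)+,
      rule runs_While[where I = I and B = "4 + k * (10 + 5 * length es)" and ?v0.0 = "length es", OF _ _ _ order_refl], goal_cases)
    case 1
    then show ?case by (simp add: I_def)
  next
    case (2 v N' R' j')
    have fr: "N' ''k'' = k" "N' ''m'' = m" "N' ''l'' = length es"
      using agree_offD[OF 2(2), of "''k''"] agree_offD[OF 2(2), of "''m''"] agree_offD[OF 2(2), of "''l''"]
        N by (simp_all add: fold_loop_def row_loop_def)
    have fr': "R' ''x'' = R ''x''" "R' ''z'' = R ''z''" "R' ''v'' = R ''v''"
      using agree_offD[OF 2(3), of "''x''"] agree_offD[OF 2(3), of "''z''"] agree_offD[OF 2(3), of "''v''"]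
      by (simp_all add: fold_loop_def row_loop_def)
    have I: "N' ''t'' + v = length es"
      "\<And>i t. i \<in> {1..k} \<Longrightarrow> t \<in> {1..N' ''t''} \<Longrightarrow> R' ''y'' (i * m + t) = min 1 (combine i (R ''x'' t) es 1)"
      "\<And>a. a \<notin> {i * m + t |i t. i \<in> {1..k} \<and> t \<in> {1..length es}} \<Longrightarrow> R' ''y'' a = R ''y'' a" "j' = j"
      using 2(1) by (auto simp: I_def)
    define a where "a = Suc (N' ''t'')"
    have a: "a \<in> {1..length es}" using 2(4) fr by (simp add: a_def)
    have v: "0 < v" using I(1) 2(4) fr by simp
    let ?N1 = "N'(''t'' := nval (NPlus (NVar ''t'') (NConst 1)) N')"
    have row: "runs n Z row_loop (?N1, R', j')
      (\<lambda>(N'', R'', j''). (\<forall>i\<in>{1..k}. R'' ''y'' (i * m + a) = min 1 (combine i (R' ''x'' a) es 1)) \<and>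
       (\<forall>b. b \<notin> {i * m + a |i. i \<in> {1..k}} \<longrightarrow> R'' ''y'' b = R' ''y'' b) \<and> j'' = j')
      (3 + k * (10 + 5 * length es))"
      using m R by (intro runs_row_loop) (auto simp: fr fr' stored_def a_def)
    have "runs n Z (incr ''t'' ;; row_loop) (N', R', j')
        (\<lambda>(N', R', j'). I (v - 1) N' R' j') (4 + k * (10 + 5 * length es))"
    proof (rule runs_le, rule runs_seq_NAssign, rule runs_call[OF row], goal_cases)
      case (1 N3 R3 j3)
      have t3: "N3 ''t'' = a"
        using agree_offD[OF 1(2), of "''t''"] by (simp add: fold_loop_def row_loop_def a_def)
      have y: "\<And>i. i \<in> {1..k} \<Longrightarrow> R3 ''y'' (i * m + a) = min 1 (combine i (R ''x'' a) es 1)"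
         "\<And>b. b \<notin> {i * m + a |i. i \<in> {1..k}} \<Longrightarrow> R3 ''y'' b = R' ''y'' b" "j3 = j"
        using 1(1) fr' I(4) by auto
      have "I (v - 1) N3 R3 j3" unfolding I_def
      proof (intro conjI ballI allI impI)
        fix i t assume i: "i \<in> {1..k}" and "t \<in> {1..N3 ''t''}"
        then consider "t = a" | "t \<in> {1..N' ''t''}" "t \<noteq> a" by (auto simp: t3 le_Suc_eq a_def)
        then show "R3 ''y'' (i * m + t) = min 1 (combine i (R ''x'' t) es 1)"
        proof cases
          case 1 then show ?thesis using y(1) i by simp
        next
          case 2
          have "t < m" "a < m" using 2 a m by (auto simp: a_def)
          then have "i * m + t \<notin> {i * m + a |i. i \<in> {1..k}}"
            using index_unique[of i m t _ a] 2(2) by blast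
          then show ?thesis using y(2) I(2)[OF i 2(1)] by simp
        qed
      next
        fix b assume "b \<notin> {i * m + t |i t. i \<in> {1..k} \<and> t \<in> {1..length es}}"
        then have "R' ''y'' b = R ''y'' b" "b \<notin> {i * m + a |i. i \<in> {1..k}}" using I(3) a by auto
        then show "R3 ''y'' b = R ''y'' b" using y(2) by simp
      qed (use t3 I v y in \<open>auto simp: a_def\<close>)
      then show ?case by simp
    next
      case 2
      then show ?case by simp
    qed
    then show ?case using v by simp
  next
    case (3 v N' R' j')
    have "N' ''t'' = length es" using 3(1,4) agree_offD[OF 3(2), of "''l''"] N
      by (auto simp: I_def fold_loop_def row_loop_def)
    then show ?case using 3(1) by (simp add: I_def)
  next
    case 4
    then show ?case by simp
  qed
qed

lemma runs_endpoint_loop: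
  assumes N: "N ''k'' = k" "N ''m'' = m" and m: "0 < m"
  shows "runs n Z endpoint_loop (N, R, j)
    (\<lambda>(N', R', j'). R' ''x'' = (R ''x'')(0 := 1) \<and> (\<forall>i\<in>{1..k}. R' ''y'' (i * m) = 1) \<and>
       (\<forall>a. a \<notin> {i * m |i. i \<in> {1..k}} \<longrightarrow> R' ''y'' a = R ''y'' a) \<and> j' = j)
    (4 + k * 4)"
  unfolding endpoint_loop_def
proof (rule runs_le, (rule runs_seq_NAssign runs_seq_RAssign)+,
      rule runs_While[where B = 3 and ?v0.0 = k and 
      I = "\<lambda>v N' R' j'. N' ''i'' + v = k \<and> N' ''o'' = N' ''i'' * m \<and> R' ''x'' = (R ''x'')(0 := 1) \<and>
       (\<forall>i\<in>{1..N' ''i''}. R' ''y'' (i * m) = 1) \<and>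
       (\<forall>a. a \<notin> {i * m |i. i \<in> {1..k}} \<longrightarrow> R' ''y'' a = R ''y'' a) \<and> j' = j", OF _ _ _ order_refl], goal_cases)
  case (2 v N' R' j')
  have fr: "N' ''k'' = k" "N' ''m'' = m"
    using agree_offD[OF 2(2), of "''k''"] agree_offD[OF 2(2), of "''m''"] N by simp_all
  define a where "a = Suc (N' ''i'')"
  have a: "a \<in> {1..k}" using 2(4) fr by (simp add: a_def)
  have am: "N' ''o'' + m = a * m" using 2(1) by (simp add: a_def)
  have v: "0 < v" using 2(1,4) fr by simp
  show ?case using 2(1) fr a v
    by (auto simp: eval_nat_numeral am a_def[symmetric] intro!: runs_step)
       (auto simp: le_Suc_eq a_def)
next
  case (3 v N' R' j')
  have "N' ''i'' = k" using 3(1,4) agree_offD[OF 3(2), of "''k''"] N by auto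
  then show ?case using 3(1) by simp
qed simp_all

section \<open>The schedule of scales\<close>

definition scale_size :: "real \<Rightarrow> nat \<Rightarrow> nat" where
  "scale_size \<gamma> s = base_size \<gamma> * 2 ^ s"

text \<open>The register \<open>d\<close> at scale \<open>s\<close>: each threshold gets n divided
  by this number, so the at most \<open>base_size \<gamma> * 2 ^ s\<close> thresholds use no more
  than n/2^(s+1) samples.\<close>

definition scale_cost :: "real \<Rightarrow> nat \<Rightarrow> nat" where
  "scale_cost \<gamma> s = 2 * base_size \<gamma> * 4 ^ s"

definition scale_samples :: "real \<Rightarrow> nat \<Rightarrow> nat \<Rightarrow> nat" where
  "scale_samples \<gamma> n s = n div scale_cost \<gamma> s"

definition scale_thresholds :: "real \<Rightarrow> nat \<Rightarrow> nat" where
  "scale_thresholds \<gamma> s = thresholds \<gamma> (scale_size \<gamma> s)"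

definition scale_offset :: "real \<Rightarrow> nat \<Rightarrow> nat \<Rightarrow> nat" where
  "scale_offset \<gamma> n s = (\<Sum>r<s. scale_thresholds \<gamma> r * scale_samples \<gamma> n r)"

definition scales :: "real \<Rightarrow> nat \<Rightarrow> nat" where
  "scales \<gamma> n = (LEAST s. n < scale_cost \<gamma> s)"

definition scale_transcript ::
  "(nat \<Rightarrow> real \<Rightarrow> nat) \<Rightarrow> nat \<Rightarrow> real \<Rightarrow> nat \<Rightarrow> nat \<Rightarrow> nat \<Rightarrow> nat list" where
  "scale_transcript Z k \<gamma> n s q = transcript Z (search_query k (scale_size \<gamma> s) q)
     (scale_offset \<gamma> n s + (q - 1) * scale_samples \<gamma> n s) (scale_samples \<gamma> n s)"

definition estimates_at :: "nat \<Rightarrow> real \<Rightarrow> nat \<Rightarrow> (nat \<Rightarrow> nat \<Rightarrow> nat list) \<Rightarrow> nat \<Rightarrow> estimate list" where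
  "estimates_at k \<gamma> n W s = scale_estimates k \<gamma> (scale_size \<gamma> s) (scale_samples \<gamma> n s) (W s) (scale_thresholds \<gamma> s)"

definition estimates :: "nat \<Rightarrow> real \<Rightarrow> nat \<Rightarrow> (nat \<Rightarrow> nat \<Rightarrow> nat list) \<Rightarrow> nat \<Rightarrow> estimate list" where
  "estimates k \<gamma> n W S = concat (map (estimates_at k \<gamma> n W) [0..<S])"

lemma estimates_0 [simp]: "estimates k \<gamma> n W 0 = []"
  and estimates_Suc: "estimates k \<gamma> n W (Suc S) = estimates k \<gamma> n W S @ estimates_at k \<gamma> n W S"
  by (simp_all add: estimates_def)

lemma length_estimates_at [simp]: "length (estimates_at k \<gamma> n W s) = scale_thresholds \<gamma> s"
  by (simp add: estimates_at_def)

lemma scale_cost_pos: "0 < \<gamma> \<Longrightarrow> 0 < scale_cost \<gamma> s"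
  using base_size(3)[of \<gamma>] by (simp add: scale_cost_def)

lemma scale_size_pos: "0 < \<gamma> \<Longrightarrow> 0 < scale_size \<gamma> s"
  using base_size(3)[of \<gamma>] by (simp add: scale_size_def)

lemma scale_size_Suc: "scale_size \<gamma> (Suc s) = scale_size \<gamma> s + scale_size \<gamma> s"
  and scale_cost_Suc: "scale_cost \<gamma> (Suc s) = (scale_cost \<gamma> s + scale_cost \<gamma> s) + (scale_cost \<gamma> s + scale_cost \<gamma> s)"
  by (simp_all add: scale_size_def scale_cost_def)

lemma scale_offset_le:
  assumes "0 < \<gamma>"
  shows "scale_offset \<gamma> n s \<le> n"
proof -
  \<comment> \<open>The bound n (1 - 2^-s) on the samples used by the first s scales, multiplied by
    2^s to remain within the natural numbers.\<close>
  have "scale_offset \<gamma> n s * 2 ^ s + n \<le> n * 2 ^ s" for s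
  proof (induction s)
    case 0
    then show ?case by (simp add: scale_offset_def)
  next
    case (Suc s)
    have "scale_thresholds \<gamma> s * scale_samples \<gamma> n s * 2 ^ Suc s \<le> 
        scale_size \<gamma> s * scale_samples \<gamma> n s * 2 ^ Suc s"
      using thresholds_le[OF assms, of "scale_size \<gamma> s"] by (intro mult_right_mono) (auto simp: scale_thresholds_def)
    also have "\<dots> = scale_samples \<gamma> n s * scale_cost \<gamma> s"
      by (simp add: scale_size_def scale_cost_def flip: power_mult_distrib)
    also have "\<dots> \<le> n" by (simp add: scale_samples_def)
    finally have "scale_offset \<gamma> n (Suc s) * 2 ^ Suc s + n \<le> 2 * (scale_offset \<gamma> n s * 2 ^ s + n)"
      by (simp add: scale_offset_def algebra_simps)
    also have "\<dots> \<le> n * 2 ^ Suc s" using Suc by simp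
    finally show ?case .
  qed
  then have "scale_offset \<gamma> n s * 2 ^ s \<le> n * 2 ^ s" by (rule add_leD1)
  then show ?thesis by simp
qed

lemma scales_iff:
  assumes "0 < \<gamma>"
  shows "s < scales \<gamma> n \<longleftrightarrow> scale_cost \<gamma> s \<le> n"
proof -
  have "n < scale_cost \<gamma> n"
  proof -
    have "n < 4 ^ n" by (rule power_gt_expt) simp
    also have "(4::nat) ^ n \<le> scale_cost \<gamma> n" using base_size(3)[OF assms] by (simp add: scale_cost_def)
    finally show ?thesis .
  qed
  then have L: "n < scale_cost \<gamma> (scales \<gamma> n)" unfolding scales_def by (rule LeastI)
  have mono: "scale_cost \<gamma> a \<le> scale_cost \<gamma> b" if "a \<le> b" for a b
    using that by (simp add: scale_cost_def power_increasing)
  show ?thesis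
  proof
    assume "s < scales \<gamma> n"
    then have "\<not> n < scale_cost \<gamma> s" unfolding scales_def by (rule not_less_Least)
    then show "scale_cost \<gamma> s \<le> n" by simp
  next
    assume "scale_cost \<gamma> s \<le> n"
    then show "s < scales \<gamma> n" using L mono[of "scales \<gamma> n" s] by (cases "s < scales \<gamma> n") auto
  qed
qed

text \<open>Every executed scale spends at least one sample per threshold, so there are no more
  records than samples. This allows the row length \<open>n + 1\<close> of the tables to be fixed in
  advance.\<close>

lemma length_estimates:
  assumes "0 < \<gamma>" "s \<le> scales \<gamma> n"
  shows "length (estimates k \<gamma> n W s) \<le> n" "s \<le> n"
proof -
  have 1: "1 \<le> scale_samples \<gamma> n r" if "r < s" for r
  proof -
    have "scale_cost \<gamma> r \<le> n" using scales_iff[OF assms(1), of r n] that assms(2) by simp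
    then show ?thesis using scale_cost_pos[OF assms(1), of r] by (simp add: scale_samples_def div_greater_zero_iff Suc_leI)
  qed
  have "length (estimates k \<gamma> n W s) = (\<Sum>r<s. scale_thresholds \<gamma> r)"
    by (induction s) (auto simp: estimates_Suc)
  also have "\<dots> \<le> scale_offset \<gamma> n s"
    unfolding scale_offset_def using 1 by (intro sum_mono) auto
  also have "\<dots> \<le> n" by (rule scale_offset_le) fact
  finally show "length (estimates k \<gamma> n W s) \<le> n" .
  show "s \<le> n"
  proof (cases s)
    case (Suc r)
    then have "scale_cost \<gamma> r \<le> n" using scales_iff[OF assms(1), of r n] assms(2) by simp
    moreover have "r < 4 ^ r" by (rule power_gt_expt) simp
    moreover have "(4::nat) ^ r \<le> scale_cost \<gamma> r" using base_size(3)[OF assms(1)] by (simp add: scale_cost_def)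
    ultimately show ?thesis using Suc by simp
  qed simp
qed

section \<open>The output table and the whole program\<close>

definition final_x :: "estimate list \<Rightarrow> nat \<Rightarrow> real" where
  "final_x es l = (if l = 0 then 1 else if l \<le> length es then fst (es ! (l - 1)) else 0)"

definition final_y :: "estimate list \<Rightarrow> nat \<Rightarrow> nat \<Rightarrow> real" where
  "final_y es i l = (if l = 0 then 1 else if l \<le> length es then min 1 (combine i (final_x es l) es 1) else 0)"

definition final_estimate :: "nat \<Rightarrow> estimate list \<Rightarrow> nat \<Rightarrow> real \<Rightarrow> real" where
  "final_estimate n es i = step_fun (final_x es) (final_y es i) (n + 1)"

text \<open>The sum of the bounds of the loops after replacing \<open>k\<close>, the number of
  scales and the number of records by \<open>n\<close>; \<open>B\<close> stands for the initial
  scale, which bounds the iterations of \<open>base_loop\<close>.\<close>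

definition time_bound :: "nat \<Rightarrow> nat \<Rightarrow> nat" where
  "time_bound n B = 30 + 2 * B + n * (20 + 3 * n + 4 * n + n * (15 + 9 * n + n * (21 + 11 * n)))
     + n * (5 + n * (10 + 5 * n)) + 4 * n"

lemma threshold_loop_mods:
  "nat_mods threshold_loop = {''l'', ''i'', ''t'', ''s'', ''w'', ''a'', ''b'', ''o'', ''q''}"
  "real_mods threshold_loop = {''c'', ''u'', ''e'', ''h'', ''x'', ''z'', ''f'', ''g'', ''v''}"
  by (auto simp: threshold_loop_def threshold_body_def sample_loop_def sample_body_def query_loop_def reset_counts_def
        median_loop_def rank_loop_def update_loop_def reset_levels_def)

lemma runs_scale_body:
  fixes s k n \<gamma> Z
  defines "W \<equiv> scale_transcript Z k \<gamma> n"
  assumes N: "N ''k'' = k" "N ''n'' = n" "N ''m'' = n + 1" "N ''M'' = scale_size \<gamma> s" "N ''d'' = scale_cost \<gamma> s"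
      "N ''l'' = length (estimates k \<gamma> n W s)"
    and R: "R ''gamma'' 0 = \<gamma>" "stored k (n + 1) (estimates k \<gamma> n W s) R"
    and \<gamma>: "0 < \<gamma>" and s: "s < scales \<gamma> n" and k: "k \<le> n"
  shows "runs n Z scale_body (N, R, scale_offset \<gamma> n s)
    (\<lambda>(N', R', j'). N' ''M'' = scale_size \<gamma> (Suc s) \<and> N' ''d'' = scale_cost \<gamma> (Suc s) \<and>
       N' ''l'' = length (estimates k \<gamma> n W (Suc s)) \<and> j' = scale_offset \<gamma> n (Suc s) \<and>
       stored k (n + 1) (estimates k \<gamma> n W (Suc s)) R')
    (15 + 3 * n + 4 * n + n * (15 + 9 * n + n * (21 + 11 * n)))"
proof -
  let ?T = "scale_samples \<gamma> n s" and ?c = "scale_thresholds \<gamma> s" and ?es = "estimates k \<gamma> n W s"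
  have T: "?T \<le> n" by (simp add: scale_samples_def)
  have off: "scale_offset \<gamma> n s + ?c * ?T = scale_offset \<gamma> n (Suc s)" by (simp add: scale_offset_def)
  have len: "length ?es + ?c \<le> n"
    using length_estimates(1)[OF \<gamma>, of "Suc s" n k W] s by (simp add: estimates_Suc)
  show ?thesis unfolding scale_body_def
  proof (rule runs_le, rule runs_seq_call[OF runs_divide_loop, 
        where b' = "4 + 4 * k + ?c * (15 + 9 * k + ?T * (21 + 11 * ?T)) + 2"], goal_cases)
    case 1
    then show ?case using N scale_cost_pos[OF \<gamma>] by simp
  next
    case (2 N1 R1 j1)
    have n1: "N1 x = N x" if "x \<notin> {''T'', ''a''}" for x
      using agree_offD[OF 2(2), of x] that by (simp add: divide_loop_def)
    have r1: "R1 = R" using 2(3) by (simp add: divide_loop_def agree_off_def fun_eq_iff)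
    have t1: "N1 ''T'' = ?T" "j1 = scale_offset \<gamma> n s" using 2(1) N by (auto simp: scale_samples_def)
    have thr: "runs n Z threshold_loop (N1, R1, j1)
      (\<lambda>(N', R', j'). N' ''l'' = length ?es + ?c \<and> j' = j1 + ?c * ?T \<and>
       stored k (n + 1) (?es @ scale_estimates k \<gamma> (scale_size \<gamma> s) ?T (W s) ?c) R')
      (4 + 4 * k + ?c * (15 + 9 * k + ?T * (21 + 11 * ?T)))"
      using N R n1 \<gamma> t1 off len scale_offset_le[OF \<gamma>, of n "Suc s"]
      by (intro runs_threshold_loop) (auto simp: r1 scale_thresholds_def W_def scale_transcript_def)
    show ?case
    proof (rule runs_seq_call[OF thr], goal_cases)
      case (1 N2 R2 j2)
      have "N2 ''M'' = scale_size \<gamma> s" "N2 ''d'' = scale_cost \<gamma> s"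
        using agree_offD[OF 1(2), of "''M''"] agree_offD[OF 1(2), of "''d''"] N n1
        by (simp_all add: threshold_loop_mods)
      then show ?case using 1(1) t1 off
        by (auto simp: eval_nat_numeral estimates_Suc estimates_at_def scale_size_Suc scale_cost_Suc intro!: runs_step)
    qed
  next
    case 3
    have "?c \<le> n" using len by simp
    then have "?c * (15 + 9 * k + ?T * (21 + 11 * ?T)) \<le> n * (15 + 9 * n + n * (21 + 11 * n))"
      using T k by (intro mult_mono add_mono) auto
    then show ?case using N k by simp
  qed
qed

lemma runs_estimator:
  fixes k n \<gamma> Z L p
  defines "es \<equiv> estimates k \<gamma> n (scale_transcript Z k \<gamma> n) (scales \<gamma> n)"
  assumes \<gamma>: "0 < \<gamma>" and k: "k \<le> n"
  shows "\<exists>t s. exec n Z estimator (input_state k n L p \<gamma>) t s \<and> t \<le> time_bound n (base_size \<gamma>) \<and>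
    (\<forall>i\<in>{1..k}. output_fun s i = final_estimate n es i)"
proof -
  let ?W = "scale_transcript Z k \<gamma> n" and ?S = "scales \<gamma> n"
  define N :: nregs where "N = (\<lambda>_. 0)(''k'' := k, ''n'' := n)"
  define R :: arrays where
    "R = (\<lambda>_ _. 0)(''L'' := (\<lambda>_. 0)(0 := L), ''p'' := (\<lambda>_. 0)(0 := p), ''gamma'' := (\<lambda>_. 0)(0 := \<gamma>))"
  have NR: "input_state k n L p \<gamma> = (N, R, 0)"
    by (simp add: input_state_def N_def R_def)
  have N: "N ''k'' = k" "N ''n'' = n" and R: "R ''gamma'' 0 = \<gamma>"
    by (simp_all add: N_def R_def)
  have R0: "R x a = 0" if "x \<notin> {''L'', ''p'', ''gamma''}" for x a
    using that by (simp add: R_def)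
  have len: "length es \<le> n" unfolding es_def by (rule length_estimates(1)[OF \<gamma> order_refl])
  define I where "I v N' R' j' \<longleftrightarrow> (\<exists>s. s + v = ?S \<and> N' ''M'' = scale_size \<gamma> s \<and> N' ''d'' = scale_cost \<gamma> s \<and>
       N' ''l'' = length (estimates k \<gamma> n ?W s) \<and> j' = scale_offset \<gamma> n s \<and>
       stored k (n + 1) (estimates k \<gamma> n ?W s) R')" for v and N' :: nregs and R' :: arrays and j'
  have mods: "''k'' \<notin> nat_mods scale_body" "''n'' \<notin> nat_mods scale_body" "''m'' \<notin> nat_mods scale_body"
    "''gamma'' \<notin> real_mods scale_body" "''y'' \<notin> real_mods scale_body"
    by (simp_all add: scale_body_def threshold_loop_mods divide_loop_def)
  let ?B = "15 + 3 * n + 4 * n + n * (15 + 9 * n + n * (21 + 11 * n))"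
  let ?C = "2 + length es * (5 + k * (10 + 5 * length es))"
  have "runs n Z estimator (N, R, 0) 
      (\<lambda>(N', R', j'). N' ''m'' = n + 1 \<and> (\<forall>l<n + 1. R' ''x'' l = final_x es l) \<and>
         (\<forall>i\<in>{1..k}. \<forall>l<n + 1. R' ''y'' (i * (n + 1) + l) = final_y es i l)) (time_bound n (base_size \<gamma>))"
    unfolding estimator_def
  proof (rule runs_le, rule runs_seq_NAssign, 
      rule runs_seq_call[OF runs_base_loop[OF \<gamma>], where b' = "Suc (Suc (?S * (?B + 1) + 1 + (?C + (4 + k * 4))))"], goal_cases)
    case 1
    then show ?case by (rule R)
  next
    case (2 N1 R1 j1)
    let ?N0 = "N(''m'' := nval (NPlus (NVar ''n'') (NConst 1)) N)"
    have n1: "N1 x = ?N0 x" if "x \<noteq> ''M''" for x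
      using agree_offD[OF 2(2), of x] that by (simp add: base_loop_def)
    have r1: "R1 = R" using 2(3) by (simp add: base_loop_def agree_off_def fun_eq_iff)
    have m1: "N1 ''M'' = base_size \<gamma>" "j1 = 0" using 2(1) by auto
    let ?N1 = "N1(''d'' := nval (NPlus (NVar ''M'') (NVar ''M'')) N1)"
    let ?N2 = "?N1(''l'' := nval (NConst 0) ?N1)"
    have loop: "runs n Z (While (BNot (NLess (NVar ''n'') (NVar ''d''))) scale_body) (?N2, R1, j1)
      (\<lambda>(N', R', j'). N' ''l'' = length es \<and> stored k (n + 1) es R') (?S * (?B + 1) + 1)"
    proof (rule runs_While[where I = I and B = ?B and ?v0.0 = ?S, OF _ _ _ order_refl], goal_cases)
      case 1
      have "stored k (n + 1) [] R1" using R0 by (simp add: stored_def r1)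
      then show ?case
        using m1 by (auto simp: I_def scale_size_def scale_cost_def scale_offset_def intro!: exI[of _ 0])
    next
      case (2 v N' R' j')
      obtain s where s: "s + v = ?S" "N' ''M'' = scale_size \<gamma> s" "N' ''d'' = scale_cost \<gamma> s"
        "N' ''l'' = length (estimates k \<gamma> n ?W s)" "j' = scale_offset \<gamma> n s"
        "stored k (n + 1) (estimates k \<gamma> n ?W s) R'"
        using 2(1) by (auto simp: I_def)
      have fr: "N' ''k'' = k" "N' ''n'' = n" "N' ''m'' = n + 1" "R' ''gamma'' 0 = \<gamma>"
        using agree_offD[OF 2(2) mods(1)] agree_offD[OF 2(2) mods(2)] agree_offD[OF 2(2) mods(3)]
          agree_offD[OF 2(3) mods(4)] n1[of "''k''"] n1[of "''n''"] n1[of "''m''"] N R r1 by simp_all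
      have "scale_cost \<gamma> s \<le> n" using 2(4) s fr by simp
      then have lt: "s < ?S" using scales_iff[OF \<gamma>] by simp
      then have v: "0 < v" "Suc s + (v - 1) = ?S" using s by auto
      have "runs n Z scale_body (N', R', j') (\<lambda>(N', R', j'). I (v - 1) N' R' j') ?B"
        unfolding s(5)
        by (rule runs_mono[OF runs_scale_body[OF fr(1-3) s(2-4) fr(4) s(6) \<gamma> lt k] _ order_refl])
           (use v in \<open>auto simp: I_def intro!: exI[of _ "Suc s"]\<close>)
      then show ?case using v by simp
    next
      case (3 v N' R' j')
      obtain s where s: "s + v = ?S" "N' ''d'' = scale_cost \<gamma> s"
        "N' ''l'' = length (estimates k \<gamma> n ?W s)"
        "stored k (n + 1) (estimates k \<gamma> n ?W s) R'"
        using 3(1) by (auto simp: I_def)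
      have "N' ''n'' = n" using agree_offD[OF 3(2) mods(2)] n1[of "''n''"] N by simp
      then have "n < scale_cost \<gamma> s" using 3(4) s by simp
      then have "s = ?S" using scales_iff[OF \<gamma>, of s n] s(1) by simp
      then show ?case using s by (simp add: es_def)
    qed
    show ?case
    proof ((rule runs_seq_NAssign)+, rule runs_seq_call[OF loop], goal_cases)
      case (1 N3 R3 j3)
      have n3: "N3 ''k'' = k" "N3 ''m'' = n + 1" and y3: "R3 ''y'' = R ''y''"
        using agree_offD[OF 1(2), of "''k''"] agree_offD[OF 1(2), of "''m''"]
          agree_offD[OF 1(3), of "''y''"] mods n1[of "''k''"] n1[of "''m''"] N r1 by simp_all
      have l3: "N3 ''l'' = length es" and st: "stored k (n + 1) es R3" using 1(1) by auto
      have comb: "runs n Z combine_loop (N3, R3, j3)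
         (\<lambda>(N', R', j'). (\<forall>i\<in>{1..k}. \<forall>t\<in>{1..length es}. R' ''y'' (i * (n + 1) + t) = 
             min 1 (combine i (R3 ''x'' t) es 1)) \<and>
           (\<forall>a. a \<notin> {i * (n + 1) + t |i t. i \<in> {1..k} \<and> t \<in> {1..length es}} \<longrightarrow> R' ''y'' a = R3 ''y'' a) \<and> j' = j3) ?C"
        using n3 l3 st len by (intro runs_combine_loop) auto
      show ?case
      proof (rule runs_seq_call[OF comb], goal_cases)
        case (1 N4 R4 j4)
        have n4: "N4 ''k'' = k" "N4 ''m'' = n + 1" and x4: "R4 ''x'' = R3 ''x''"
          using agree_offD[OF 1(2), of "''k''"] agree_offD[OF 1(2), of "''m''"] agree_offD[OF 1(3), of "''x''"] n3
          by (simp_all add: combine_loop_def row_loop_def fold_loop_def)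
        have y4: "\<And>i t. i \<in> {1..k} \<Longrightarrow> t \<in> {1..length es} \<Longrightarrow> R4 ''y'' (i * (n + 1) + t) = 
             min 1 (combine i (R3 ''x'' t) es 1)"
          "\<And>a. a \<notin> {i * (n + 1) + t |i t. i \<in> {1..k} \<and> t \<in> {1..length es}} \<Longrightarrow> R4 ''y'' a = 0"
          using 1(1) y3 R0[of "''y''"] by simp_all
        have fx: "R3 ''x'' l = final_x es l" if "0 < l" for l
          using st that by (cases l) (auto simp: stored_def final_x_def)
        show ?case
        proof (rule runs_call[OF runs_endpoint_loop[OF n4]], goal_cases)
          case 1
          show ?case by simp
        next
          case (2 N5 R5 j5)
          have n5: "N5 ''m'' = n + 1" using agree_offD[OF 2(2), of "''m''"] n4 by (simp add: endpoint_loop_def)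
          have x5: "R5 ''x'' l = final_x es l" for l
            using 2(1) fx x4 by (cases "l = 0") (auto simp: final_x_def)
          have y5: "R5 ''y'' (i * (n + 1) + l) = final_y es i l" if i: "i \<in> {1..k}" and l: "l < n + 1" for i l
          proof (cases "l = 0")
            case True
            then show ?thesis using 2(1) i by (simp add: final_y_def)
          next
            case False
            have "i * (n + 1) + l \<notin> {i * (n + 1) |i. i \<in> {1..k}}"
              using index_unique[of i "n + 1" l _ 0] l False by auto
            then have R5: "R5 ''y'' (i * (n + 1) + l) = R4 ''y'' (i * (n + 1) + l)" using 2(1) by blast
            show ?thesis
            proof (cases "l \<le> length es")
              case True
              then show ?thesis unfolding R5 using y4(1)[OF i, of l] False fx[of l] by (simp add: final_y_def)
            next
              case False
              have "i * (n + 1) + l \<notin> {i * (n + 1) + t |i t. i \<in> {1..k} \<and> t \<in> {1..length es}}"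
                using index_unique[of i "n + 1" l] l False len by fastforce
              then show ?thesis unfolding R5 using y4(2) False by (simp add: final_y_def)
            qed
          qed
          show ?case using n5 x5 y5 by simp
        qed
      qed
    qed
  next
    case 3
    have S: "?S \<le> n" using length_estimates(2)[OF \<gamma> order_refl] .
    have "?S * (?B + 1) \<le> n * (20 + 3 * n + 4 * n + n * (15 + 9 * n + n * (21 + 11 * n)))"
      using S by (intro mult_mono) auto
    moreover have "length es * (5 + k * (10 + 5 * length es)) \<le> n * (5 + n * (10 + 5 * n))"
      using len k by (intro mult_mono add_mono) auto
    moreover have "Suc (2 + 2 * B + Suc (Suc (X + 1 + (2 + Y + (4 + k * 4))))) \<le> 30 + 2 * B + X' + Y' + 4 * n"
      if "X \<le> X'" "Y \<le> Y'" for B X Y X' Y' :: nat using that k by simp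
    ultimately show ?case unfolding time_bound_def by blast
  qed
  then obtain t N' R' j' where ex: "exec n Z estimator (N, R, 0) t (N', R', j')" "t \<le> time_bound n (base_size \<gamma>)"
    and out: "N' ''m'' = n + 1" "\<And>l. l < n + 1 \<Longrightarrow> R' ''x'' l = final_x es l"
      "\<And>i l. i \<in> {1..k} \<Longrightarrow> l < n + 1 \<Longrightarrow> R' ''y'' (i * (n + 1) + l) = final_y es i l"
    by (auto simp: runs_def)
  have "output_fun (N', R', j') i = final_estimate n es i" if "i \<in> {1..k}" for i
  proof
    fix z
    have "{R' ''y'' (i * (n + 1) + l) |l. l < n + 1 \<and> R' ''x'' l \<le> z} = {final_y es i l |l. l < n + 1 \<and> final_x es l \<le> z}"
      using out(2,3) that by metis
    then show "output_fun (N', R', j') i z = final_estimate n es i z"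
      by (simp only: output_fun_def final_estimate_def step_fun_def case_prod_conv out(1))
  qed
  then show ?thesis using ex unfolding NR by blast
qed

section \<open>Accuracy and sample size\<close>

lemma sum_power4: "(\<Sum>r\<le>s. (4::real) ^ r) \<le> 2 * 4 ^ s"
proof (induction s)
  case (Suc s)
  have "0 \<le> (4::real) ^ s" by simp
  then show ?case using Suc unfolding sum.atMost_Suc power_Suc by linarith
qed simp

lemma median_unit:
  assumes "\<And>t. r t \<in> {0..1}"
  shows "median T r \<in> {0..1}"
proof (cases "T = 0")
  case False
  then show ?thesis using median(2)[of T r] assms by auto
qed (simp add: median_def)

lemma level_cong:
  "(\<And>r. r \<in> {1..q} \<Longrightarrow> W r = W' r) \<Longrightarrow> level M T W i q = level M T W' i q"
  by (induction q) (auto simp: share_def)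

text \<open>The records depend on finitely many transcripts only. The measurability of the output
  rests on this.\<close>

lemma estimates_cong:
  assumes "\<And>s q. s < S \<Longrightarrow> q \<in> {1..scale_thresholds \<gamma> s} \<Longrightarrow> W s q = W' s q"
  shows "estimates k \<gamma> n W S = estimates k \<gamma> n W' S"
proof -
  have "estimates_at k \<gamma> n W s = estimates_at k \<gamma> n W' s" if s: "s < S" for s
    unfolding estimates_at_def scale_estimates_def
  proof (intro map_cong refl)
    fix q assume "q \<in> set [1..<Suc (scale_thresholds \<gamma> s)]"
    then have q: "W s r = W' s r" if "r \<in> {1..q}" for r using assms[OF s, of r] that by auto
    moreover have "1 \<le> q" using \<open>q \<in> _\<close> by auto
    then have "W s q = W' s q" using q[of q] by simp
    ultimately show "threshold_estimate k \<gamma> (scale_size \<gamma> s) (scale_samples \<gamma> n s) (W s) q =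
        threshold_estimate k \<gamma> (scale_size \<gamma> s) (scale_samples \<gamma> n s) (W' s) q"
      unfolding threshold_estimate_def using level_cong[of q "W s" "W' s"] by simp
  qed
  then show ?thesis unfolding estimates_def
    by (intro arg_cong[where f = concat] map_cong refl) auto
qed

lemma estimates_split:
  assumes "s \<le> S"
  obtains es where "estimates k \<gamma> n W S = estimates k \<gamma> n W s @ es"
proof -
  have "[0..<S] = [0..<s] @ [s..<S]" using assms by (metis le0 upt_add_eq_append le_add_diff_inverse)
  then show ?thesis using that by (simp add: estimates_def)
qed

lemma set_estimates:
  "set (estimates k \<gamma> n W S) = (\<Union>s<S. set (estimates_at k \<gamma> n W s))"
  by (auto simp: estimates_def)

lemma set_estimates_at:
  "set (estimates_at k \<gamma> n W s) = (\<lambda>q. threshold_estimate k \<gamma> (scale_size \<gamma> s) (scale_samples \<gamma> n s) (W s) q) ` 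
     {1..scale_thresholds \<gamma> s}"
  by (auto simp: estimates_at_def scale_estimates_def)

lemma final_x_unit:
  assumes "0 < \<gamma>" "l \<le> n"
  shows "final_x (estimates k \<gamma> n W S) l \<in> {0..1}"
proof (cases "l = 0 \<or> length (estimates k \<gamma> n W S) < l")
  case True
  then show ?thesis by (auto simp: final_x_def)
next
  case False
  then have "estimates k \<gamma> n W S ! (l - 1) \<in> set (estimates k \<gamma> n W S)" by (intro nth_mem) auto
  then obtain s q where q: "q \<in> {1..scale_thresholds \<gamma> s}"
    "estimates k \<gamma> n W S ! (l - 1) = threshold_estimate k \<gamma> (scale_size \<gamma> s) (scale_samples \<gamma> n s) (W s) q"
    by (auto simp: set_estimates set_estimates_at)
  have "q \<le> scale_size \<gamma> s" using q(1) thresholds_le[OF assms(1), of "scale_size \<gamma> s"]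
    by (auto simp: scale_thresholds_def)
  then have "fst (estimates k \<gamma> n W S ! (l - 1)) \<in> {0..1}"
    unfolding q(2) threshold_estimate_def fst_conv
    using search_query_unit[of "scale_size \<gamma> s" q k] scale_size_pos[OF assms(1), of s]
    by (intro median_unit) auto
  then show ?thesis using False by (simp add: final_x_def not_less)
qed

lemma final_estimate_is_cdf:
  assumes "0 < \<gamma>"
  shows "is_cdf (final_estimate n (estimates k \<gamma> n W S) i)"
  unfolding final_estimate_def
proof (rule step_fun_is_cdf)
  show "0 \<le> final_x (estimates k \<gamma> n W S) l \<and> final_x (estimates k \<gamma> n W S) l \<le> 1" if "l < n + 1" for l
    using final_x_unit[OF assms, of l n k W S] that by auto
qed (auto simp: final_y_def final_x_def)

text \<open>The combined value changes only at breakpoints, so its value at \<open>z\<close> is the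
  table entry at the largest breakpoint below or at \<open>z\<close>. By monotonicity no other entry
  that counts at \<open>z\<close> exceeds it. Cutting off at 0 does no harm as \<open>f\<close> is
  nonnegative.\<close>

lemma final_estimate_close:
  assumes z: "0 \<le> z" "z \<le> 1" and f: "0 \<le> f" "f \<le> 1" "z = 1 \<Longrightarrow> f = 1" and e: "0 \<le> e"
    and len: "length es \<le> n"
    and close: "\<bar>min 1 (combine i z es 1) - f\<bar> \<le> e"
    and ex: "\<exists>b\<in>fst ` set es. b \<le> z"
  shows "\<bar>final_estimate n es i z - f\<bar> \<le> e"
proof -
  let ?V = "{final_y es i l |l. l < n + 1 \<and> final_x es l \<le> z}"
  have fin: "finite ?V" by auto
  have val: "final_estimate n es i z = Max (insert 0 ?V)" by (simp add: final_estimate_def step_fun_def)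
  show ?thesis
  \<comment> \<open>Only at 1 does the entry with index 0 take part, and there the exact value is
    1.\<close>
  proof (cases "z = 1")
    case True
    have "Max (insert 0 ?V) = 1"
    proof (rule Max_eqI)
      show "y \<le> 1" if "y \<in> insert 0 ?V" for y using that by (auto simp: final_y_def)
      have "final_y es i 0 = 1" "final_x es 0 = 1" by (simp_all add: final_y_def final_x_def)
      then show "1 \<in> insert 0 ?V" using True by (metis (mono_tags, lifting) Suc_eq_plus1 insertCI mem_Collect_eq order_refl zero_less_Suc)
    qed (use fin in simp)
    then show ?thesis using True f e val by simp
  next
    case False
    define C where "C = min 1 (combine i z es 1)"
    define B where "B = {b \<in> fst ` set es. b \<le> z}"
    have B: "finite B" "B \<noteq> {}" using ex by (auto simp: B_def)
    define b where "b = Max B"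
    have b: "b \<in> B" unfolding b_def using B by (rule Max_in)
    have "combine i b es 1 = combine i z es 1"
    proof (rule combine_cong)
      fix c R Y assume c: "(c, R, Y) \<in> set es"
      have "c \<le> b" if "c \<le> z" unfolding b_def
        using B c that by (intro Max_ge) (force simp: B_def)+
      then show "c \<le> b \<longleftrightarrow> c \<le> z" using b by (auto simp: B_def)
    qed
    moreover obtain l where l: "l < length es" "fst (es ! l) = b"
      using b by (auto simp: B_def in_set_conv_nth)
    ultimately have "final_y es i (Suc l) = C" "final_x es (Suc l) \<le> z"
      using b by (auto simp: final_y_def final_x_def C_def B_def)
    then have mem: "C \<in> ?V" using l len by force
    have le: "y \<le> max 0 C" if y: "y \<in> insert 0 ?V" for y
    proof (cases "y = 0")
      case nz: False
      then obtain l where l: "l < n + 1" "final_x es l \<le> z" "y = final_y es i l" using y by auto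
      have "l \<noteq> 0" using l(2) False z by (cases "l = 0") (auto simp: final_x_def)
      moreover have "l \<le> length es" using nz l(3) \<open>l \<noteq> 0\<close> by (auto simp: final_y_def split: if_splits)
      ultimately have "y = min 1 (combine i (final_x es l) es 1)" using l(3) by (simp add: final_y_def)
      also have "\<dots> \<le> C" unfolding C_def using combine_mono[OF l(2), of 1 1 i es] by (auto simp: min_def)
      finally show ?thesis by simp
    qed simp
    have "Max (insert 0 ?V) = max 0 C"
      using fin mem le by (intro Max_eqI) (auto simp: max_def)
    then show ?thesis using close f by (auto simp: val C_def[symmetric] max_def)
  qed
qed

section \<open>Accuracy of the output and its probability\<close>

context auction
begin

definition good_scale :: "nat \<Rightarrow> real \<Rightarrow> nat \<Rightarrow> (nat \<Rightarrow> nat list) \<Rightarrow> nat \<Rightarrow> bool" where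
  "good_scale i \<gamma> n W s \<longleftrightarrow> (\<forall>q\<in>{1..scale_thresholds \<gamma> s}.
     good_block i (1 / (100 * real (scale_size \<gamma> s))) (tau (scale_size \<gamma> s) q) (scale_samples \<gamma> n s) (W q))"

text \<open>\<open>H\<close> may be constant on an interval, so a quantile has to be chosen. For
  index 0 it must be the point 1, where the recursion for the levels starts without error.\<close>

definition quantile :: "nat \<Rightarrow> nat \<Rightarrow> real" where
  "quantile M q = (if q = 0 then 1 else SOME x. 0 \<le> x \<and> x \<le> 1 \<and> H x = tau M q)"

lemma quantile:
  assumes "0 < M" "q \<le> M"
  shows "0 \<le> quantile M q \<and> quantile M q \<le> 1 \<and> H (quantile M q) = tau M q"
proof (cases "q = 0")
  case True
  then show ?thesis using assms H_unit by (simp add: quantile_def tau_def)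
next
  case False
  have "\<exists>x. 0 \<le> x \<and> x \<le> 1 \<and> H x = tau M q"
    using IVT'[of H 0 "tau M q" 1] tau_unit[OF assms] H_unit H_continuous by auto
  then show ?thesis using someI_ex[of "\<lambda>x. 0 \<le> x \<and> x \<le> 1 \<and> H x = tau M q"] False by (simp add: quantile_def)
qed

text \<open>With \<beta> = 1/(100 M), the errors 7 \<beta> and 20 \<beta> of a good block are the
  7/(100 M) and 1/(5 M) of the locale. At index 0 the share is exact.\<close>

lemma good_scale_estimate:
  fixes \<gamma> :: real
  assumes i: "i \<in> {1..k}" and \<gamma>: "0 < \<gamma>" "\<gamma> \<le> 1" and s: "s < scales \<gamma> n"
    and good: "good_scale i \<gamma> n (W s) s"
  defines "M \<equiv> scale_size \<gamma> s"
  defines "T \<equiv> scale_samples \<gamma> n s"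
  shows "scale_estimate (F i) (\<lambda>r. win_prob r i) H M \<gamma> (quantile M) (share T (W s) i) (level M T (W s) i)
     (\<lambda>q. median T (\<lambda>t. search_query k M q (take t (W s q))))"
proof -
  have M: "0 < M" using scale_size_pos[OF \<gamma>(1)] by (simp add: M_def)
  have \<gamma>M: "128 \<le> \<gamma> * M"
  proof -
    have "base_size \<gamma> \<le> M" by (simp add: M_def scale_size_def)
    then have "\<gamma> * base_size \<gamma> \<le> \<gamma> * M" using \<gamma> by (intro mult_left_mono) auto
    then show ?thesis using base_size(1)[OF \<gamma>(1)] by linarith
  qed
  have M100: "128 \<le> real M" using \<gamma>M \<gamma> mult_right_mono[of \<gamma> 1 "real M"] by simp
  have T: "0 < T"
    using s scales_iff[OF \<gamma>(1)] scale_cost_pos[OF \<gamma>(1)] by (simp add: T_def scale_samples_def div_greater_zero_iff)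
  have act: "q < M" if "\<gamma> * M < 2 * (real M - real q)" for q
    using active_less[OF \<gamma>(1), of M q] that by (simp add: active_def)
  let ?\<beta> = "1 / (100 * real M)"
  have \<beta>: "0 < ?\<beta>" "?\<beta> \<le> 1 / 2" using M100 by (auto simp: field_simps)
  have est: "\<bar>share T (W s) i q - win_prob (quantile M q) i\<bar> \<le> 7 * ?\<beta>"
    "\<bar>H (median T (\<lambda>t. search_query k M q (take t (W s q)))) - tau M q\<bar> \<le> 20 * ?\<beta>"
    "median T (\<lambda>t. search_query k M q (take t (W s q))) \<in> {0..1}"
    if a: "\<gamma> * M < 2 * (real M - real q)" and q: "0 < q" for q
  proof -
    have "q \<in> {1..scale_thresholds \<gamma> s}"
      using active_thresholds_iff[OF \<gamma>(1) q, of M] a q by (simp add: active_def M_def scale_thresholds_def)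
    then have g: "good_block i ?\<beta> (tau M q) T (W s q)"
      using good by (simp add: good_scale_def M_def T_def)
    have p: "prices k ?\<beta> (tau M q) (W s q) = (\<lambda>t. search_query k M q (take t (W s q)))"
      by (simp add: prices_def search_query_def fun_eq_iff)
    have "q \<le> M" using act[OF a] by simp
    with tau_unit[OF M this] quantile[OF M this] good_block_estimates[OF g i T _ _ \<beta>, of "quantile M q"] q
    show "\<bar>share T (W s) i q - win_prob (quantile M q) i\<bar> \<le> 7 * ?\<beta>"
      "\<bar>H (median T (\<lambda>t. search_query k M q (take t (W s q)))) - tau M q\<bar> \<le> 20 * ?\<beta>"
      "median T (\<lambda>t. search_query k M q (take t (W s q))) \<in> {0..1}"
      by (auto simp: p share_def)
  qed
  interpret auction_marginal "F i" "\<lambda>r. win_prob r i" H by (rule marginal_estimable[OF i])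
  have x: "0 \<le> quantile M q \<and> quantile M q \<le> 1 \<and> H (quantile M q) = (real M - real q) / real M"
    if "\<gamma> * M < 2 * (real M - real q)" for q
    using quantile[OF M, of q] act[OF that] by (simp add: tau_def)
  have g: "\<bar>share T (W s) i q - win_prob (quantile M q) i\<bar> \<le> 7 / (100 * real M)"
    if "\<gamma> * M < 2 * (real M - real q)" for q
    using est(1)[OF that] win_prob_1[OF i] by (cases "q = 0") (auto simp: share_def quantile_def)
  have b: "0 \<le> median T (\<lambda>t. search_query k M q (take t (W s q))) \<and>
         median T (\<lambda>t. search_query k M q (take t (W s q))) \<le> 1 \<and>
         \<bar>H (median T (\<lambda>t. search_query k M q (take t (W s q)))) - (real M - real q) / real M\<bar> \<le> 1 / (5 * real M)"
      if "\<gamma> * M < 2 * (real M - real q)" "0 < q" for q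
    using est(2,3)[OF that] M by (auto simp: tau_def)
  show ?thesis
    by unfold_locales (use \<gamma>M \<gamma> x g b in \<open>auto simp: quantile_def share_def tau_def\<close>)
qed

lemma good_scale_records:
  fixes \<gamma> :: real
  assumes i: "i \<in> {1..k}" and \<gamma>: "0 < \<gamma>" "\<gamma> \<le> 1" and s: "s < scales \<gamma> n"
    and good: "good_scale i \<gamma> n (W s) s"
    and z: "0 \<le> z" "z \<le> 1" "\<gamma> \<le> H z"
  defines "e \<equiv> 128 / (scale_size \<gamma> s * \<gamma>)"
  shows "r \<in> set (estimates_at k \<gamma> n W s) \<Longrightarrow> sound_at i z (F i z) r"
    "\<exists>(b, R, Y)\<in>set (estimates_at k \<gamma> n W s). b \<le> z \<and> F i z - e \<le> Y i - R"
    "1 \<le> F i z + e \<or> (\<exists>(b, R, Y)\<in>set (estimates_at k \<gamma> n W s). z < b \<and> Y i + R \<le> F i z + e)"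
proof -
  define M where "M = scale_size \<gamma> s"
  define T where "T = scale_samples \<gamma> n s"
  let ?b = "\<lambda>q. median T (\<lambda>t. search_query k M q (take t (W s q)))"
  interpret S: scale_estimate "F i" "\<lambda>r. win_prob r i" H M \<gamma> "quantile M" "share T (W s) i" "level M T (W s) i" ?b
    unfolding M_def T_def using i \<gamma> s good by (rule good_scale_estimate)
  have R: "64 / (M * \<gamma>) = 64 * S.\<eta> / \<gamma>" and e: "e = 128 * S.\<eta> / \<gamma>"
    unfolding S.\<eta>_def by (simp_all add: e_def M_def)
  have act: "q \<in> {1..scale_thresholds \<gamma> s} \<longleftrightarrow> 0 < q \<and> \<gamma> < 2 * S.\<tau> q" for q
    using active_thresholds_iff[OF \<gamma>(1), of q M] S.active_iff[of q]
    by (auto simp: scale_thresholds_def M_def active_def)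
  have set: "set (estimates_at k \<gamma> n W s) = (\<lambda>q. (?b q, 64 * S.\<eta> / \<gamma>, \<lambda>i. level M T (W s) i q)) ` {q. 0 < q \<and> \<gamma> < 2 * S.\<tau> q}"
  proof -
    have "{1..scale_thresholds \<gamma> s} = {q. 0 < q \<and> \<gamma> < 2 * S.\<tau> q}"
      by (rule set_eqI) (simp only: act mem_Collect_eq)
    then show ?thesis
      unfolding set_estimates_at threshold_estimate_def by (simp add: M_def[symmetric] T_def[symmetric] R)
  qed
  show "sound_at i z (F i z) r" if "r \<in> set (estimates_at k \<gamma> n W s)"
    using that S.record_lower[OF z] S.record_upper[OF z(1,2)]
    by (auto simp: set sound_at_def not_le)
  obtain q where "\<gamma> < 2 * S.\<tau> q" "0 < q" "?b q \<le> z" "F i z \<le> level M T (W s) i q - 64 * S.\<eta> / \<gamma> + 128 * S.\<eta> / \<gamma>"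
    using S.record_lower_tight[OF z] by blast
  then show "\<exists>(b, R, Y)\<in>set (estimates_at k \<gamma> n W s). b \<le> z \<and> F i z - e \<le> Y i - R"
    unfolding set e by (intro bexI[of _ "(?b q, 64 * S.\<eta> / \<gamma>, \<lambda>i. level M T (W s) i q)"]) auto
  show "1 \<le> F i z + e \<or> (\<exists>(b, R, Y)\<in>set (estimates_at k \<gamma> n W s). z < b \<and> Y i + R \<le> F i z + e)"
    using S.record_upper_tight[OF z] unfolding set e by fastforce
qed

lemma final_estimate_accurate:
  fixes \<gamma> :: real
  assumes i: "i \<in> {1..k}" and \<gamma>: "0 < \<gamma>" "\<gamma> \<le> 1" and s: "s < scales \<gamma> n"
    and good: "\<And>r. r \<le> s \<Longrightarrow> good_scale i \<gamma> n (W r) r"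
    and z: "0 \<le> z" "z \<le> 1" "\<gamma> \<le> H z"
  shows "\<bar>final_estimate n (estimates k \<gamma> n W (scales \<gamma> n)) i z - F i z\<bar> \<le> 128 / (scale_size \<gamma> s * \<gamma>)"
proof -
  let ?e = "128 / (scale_size \<gamma> s * \<gamma>)" and ?es = "estimates k \<gamma> n W"
  have e: "0 \<le> ?e" using \<gamma> by simp
  note rec = good_scale_records[where W = W, OF i \<gamma> s good[OF order_refl] z]
  obtain rest where split: "?es (scales \<gamma> n) = ?es (Suc s) @ rest"
    using estimates_split[of "Suc s" "scales \<gamma> n" k \<gamma> n W] s by auto
  have len: "length (?es (scales \<gamma> n)) \<le> n" by (rule length_estimates(1)[OF \<gamma>(1) order_refl])
  have sub: "set (estimates_at k \<gamma> n W s) \<subseteq> set (?es (Suc s))" by (auto simp: set_estimates)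
  \<comment> \<open>Nothing is known about the finer scales in \<open>rest\<close>; their outcome is
    only the start value, which is arbitrary in \<open>combine_close\<close>.\<close>
  have "\<bar>min 1 (combine i z (?es (Suc s)) (combine i z rest 1)) - F i z\<bar> \<le> ?e"
  proof (rule combine_close)
    show "\<forall>r\<in>set (?es (Suc s)). sound_at i z (F i z) r"
      using good_scale_records(1)[where W = W, OF i \<gamma> _ good z] s by (auto simp: set_estimates less_Suc_eq_le)
    show "\<exists>(b, R, Y)\<in>set (?es (Suc s)). b \<le> z \<and> F i z - ?e \<le> Y i - R"
      using rec(2) sub by blast
    show "1 \<le> F i z + ?e \<or> (\<exists>(b, R, Y)\<in>set (?es (Suc s)). z < b \<and> Y i + R \<le> F i z + ?e)"
      using rec(3) sub by blast
  qed (use F_unit[OF i] e in auto)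
  moreover have "\<exists>b\<in>fst ` set (?es (scales \<gamma> n)). b \<le> z"
  proof -
    obtain b R Y where "(b, R, Y) \<in> set (estimates_at k \<gamma> n W s)" "b \<le> z" using rec(2) by blast
    then have "(b, R, Y) \<in> set (?es (scales \<gamma> n))" using sub by (auto simp: split)
    then show ?thesis using \<open>b \<le> z\<close> by force
  qed
  ultimately show ?thesis
    using z e F_unit[OF i] len[unfolded split]
    by (intro final_estimate_close) (auto simp: split)
qed

lemma scale_transcript_block:
  "scale_transcript (\<lambda>j. winner k (\<omega> j)) k \<gamma> n s q = block \<omega> (search_query k (scale_size \<gamma> s) q)
     (scale_offset \<gamma> n s + (q - 1) * scale_samples \<gamma> n s) (scale_samples \<gamma> n s)"
  by (simp add: scale_transcript_def block_def)

lemma block_in_budget: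
  assumes "0 < \<gamma>" "q \<in> {1..scale_thresholds \<gamma> s}"
  shows "scale_offset \<gamma> n s + (q - 1) * scale_samples \<gamma> n s + scale_samples \<gamma> n s \<le> n"
proof -
  have "scale_offset \<gamma> n s + (q - 1) * scale_samples \<gamma> n s + scale_samples \<gamma> n s =
      scale_offset \<gamma> n s + q * scale_samples \<gamma> n s"
    using assms(2) by (cases q) auto
  also have "\<dots> \<le> scale_offset \<gamma> n (Suc s)" using assms(2) by (simp add: scale_offset_def)
  also have "\<dots> \<le> n" by (rule scale_offset_le) fact
  finally show ?thesis .
qed

lemma good_block_sets:
  assumes "j + T \<le> n"
  shows "{\<omega> \<in> space (sample_law n k F). P (block \<omega> q j T)} \<in> sets (sample_law n k F)"
  using measurable_sets[OF block_measurable[OF assms, of q], of "Collect P"]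
  by (simp add: vimage_def Int_def conj_commute)

text \<open>A union bound over all thresholds of the scales up to \<open>s\<close>. A scale of size
  M has at most M thresholds, each failing with probability at most 300 k (1 + L) M exp(-X), where
  300 is 3/\<beta> divided by M. The squares of the sizes grow geometrically with ratio 4, and their
  sum is at most twice the last one.\<close>

lemma good_scales_prob:
  fixes \<gamma> \<delta> X :: real
  assumes i: "i \<in> {1..k}" and \<gamma>: "0 < \<gamma>" "\<gamma> \<le> 1"
    and X: "\<And>r. r \<le> s \<Longrightarrow> X \<le> scale_samples \<gamma> n r / (100 * real (scale_size \<gamma> r))\<^sup>2"
    and \<delta>: "600 * (k * (1 + L)) * (real (scale_size \<gamma> s))\<^sup>2 * exp (- X) \<le> \<delta>"
  defines "W \<equiv> \<lambda>\<omega>. scale_transcript (\<lambda>j. winner k (\<omega> j)) k \<gamma> n"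
  shows "\<exists>E\<in>sets (sample_law n k F). measure (sample_law n k F) E \<le> \<delta> \<and>
    (\<forall>\<omega>\<in>space (sample_law n k F) - E. \<forall>r\<le>s. good_scale i \<gamma> n (W \<omega> r) r)"
proof -
  interpret S: prob_space "sample_law n k F" by (rule sample_prob_space)
  define K where "K = real k * (1 + L)"
  have K1: "1 \<le> K" using slope_ge_1 by (simp add: K_def)
  define J where "J = (SIGMA r:{..s}. {1..scale_thresholds \<gamma> r})"
  define B where "B = (\<lambda>(r, q). {\<omega> \<in> space (sample_law n k F). \<not> good_block i (1 / (100 * real (scale_size \<gamma> r)))
     (tau (scale_size \<gamma> r) q) (scale_samples \<gamma> n r) (W \<omega> r q)})"
  have B: "B x \<in> S.events \<and> S.prob (B x) \<le> 300 * K * real (scale_size \<gamma> (fst x)) * exp (- X)" if x: "x \<in> J" for x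
  proof -
    obtain r q where rq: "x = (r, q)" "r \<le> s" "q \<in> {1..scale_thresholds \<gamma> r}" using x by (auto simp: J_def)
    let ?M = "scale_size \<gamma> r" and ?T = "scale_samples \<gamma> n r"
    have M: "0 < ?M" by (rule scale_size_pos) fact
    have q: "q \<le> ?M" using rq(3) thresholds_le[OF \<gamma>(1), of ?M] by (auto simp: scale_thresholds_def)
    have \<beta>: "0 < 1 / (100 * real ?M)" "1 / (100 * real ?M) \<le> 1 / 2" using M by (auto simp: field_simps)
    have "S.prob (B x) \<le> 3 * (K / (1 / (100 * real ?M))) * exp (- ((1 / (100 * real ?M))\<^sup>2 * ?T))"
      using good_block_prob[OF i _ _ \<beta> block_in_budget[OF \<gamma>(1) rq(3)], of "tau ?M q"] tau_unit[OF M q]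
      unfolding B_def W_def scale_transcript_block search_query_def K_def rq(1) by simp
    also have "\<dots> = 300 * K * ?M * exp (- (?T / (100 * real ?M)\<^sup>2))"
      by (simp add: power_divide)
    also have "\<dots> \<le> 300 * K * ?M * exp (- X)"
      using X[OF rq(2)] K1 by (intro mult_left_mono) auto
    finally show ?thesis
      using good_block_sets[OF block_in_budget[OF \<gamma>(1) rq(3)]]
      unfolding B_def W_def scale_transcript_block rq(1) by auto
  qed
  have fin: "finite J" by (simp add: J_def)
  define E where "E = (\<Union>x\<in>J. B x)"
  have "S.prob E \<le> (\<Sum>x\<in>J. S.prob (B x))"
    unfolding E_def using fin B by (intro S.finite_measure_subadditive_finite) auto
  also have "\<dots> \<le> (\<Sum>x\<in>J. 300 * K * real (scale_size \<gamma> (fst x)) * exp (- X))"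
    using B by (intro sum_mono) auto
  also have "\<dots> = (\<Sum>r\<le>s. \<Sum>q\<in>{1..scale_thresholds \<gamma> r}. 300 * K * real (scale_size \<gamma> r) * exp (- X))"
    unfolding J_def by (subst sum.Sigma) (auto simp: split_def)
  also have "\<dots> = (\<Sum>r\<le>s. 300 * K * exp (- X) * (real (scale_thresholds \<gamma> r) * real (scale_size \<gamma> r)))"
    by (simp add: mult_ac)
  also have "\<dots> \<le> (\<Sum>r\<le>s. 300 * K * exp (- X) * (real (scale_size \<gamma> r) * real (scale_size \<gamma> r)))"
    using thresholds_le[OF \<gamma>(1)] K1
    by (intro sum_mono mult_left_mono mult_right_mono) (auto simp: scale_thresholds_def)
  also have "\<dots> = 300 * K * exp (- X) * ((real (base_size \<gamma>))\<^sup>2 * (\<Sum>r\<le>s. 4 ^ r))"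
    by (simp add: scale_size_def sum_distrib_left power2_eq_square mult_ac flip: power_mult_distrib)
  also have "\<dots> \<le> 300 * K * exp (- X) * ((real (base_size \<gamma>))\<^sup>2 * (2 * 4 ^ s))"
    using K1 sum_power4[of s] by (intro mult_left_mono) auto
  also have "\<dots> = 600 * (k * (1 + L)) * (real (scale_size \<gamma> s))\<^sup>2 * exp (- X)"
    by (simp add: scale_size_def K_def power2_eq_square flip: power_mult_distrib)
  finally have "S.prob E \<le> \<delta>" using \<delta> by simp
  moreover have "E \<in> S.events" unfolding E_def using fin B by auto
  moreover have "good_scale i \<gamma> n (W \<omega> r) r" if "\<omega> \<in> space (sample_law n k F) - E" "r \<le> s" for \<omega> r
    using that by (auto simp: good_scale_def E_def B_def J_def)
  ultimately show ?thesis by blast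
qed

lemma map_measurable:
  fixes f :: "'c \<Rightarrow> 'b \<Rightarrow> 'a::countable"
  assumes "\<And>x. x \<in> set xs \<Longrightarrow> f x \<in> measurable M (count_space UNIV)"
  shows "(\<lambda>\<omega>. map (\<lambda>x. f x \<omega>) xs) \<in> measurable M (count_space UNIV)"
  using assms
proof (induction xs)
  case (Cons x xs)
  have "(\<lambda>\<omega>. map (\<lambda>x. f x \<omega>) (x # xs)) -` {h} \<inter> space M \<in> sets M" for h
  proof (cases h)
    case Nil
    then show ?thesis by (simp add: vimage_def)
  next
    case (Cons y ys)
    have "(\<lambda>\<omega>. map (\<lambda>x. f x \<omega>) (x # xs)) -` {h} \<inter> space M =
        (f x -` {y} \<inter> space M) \<inter> ((\<lambda>\<omega>. map (\<lambda>x. f x \<omega>) xs) -` {ys} \<inter> space M)"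
      by (auto simp: Cons)
    also have "\<dots> \<in> sets M"
    proof (rule sets.Int)
      show "f x -` {y} \<inter> space M \<in> sets M"
        using Cons.prems by (intro measurable_sets[of "f x" M "count_space UNIV"]) auto
      show "(\<lambda>\<omega>. map (\<lambda>x. f x \<omega>) xs) -` {ys} \<inter> space M \<in> sets M"
        using Cons.IH Cons.prems
        by (intro measurable_sets[of "\<lambda>\<omega>. map (\<lambda>x. f x \<omega>) xs" M "count_space UNIV"]) auto
    qed
    finally show ?thesis .
  qed
  then show ?case by (simp add: measurable_count_space_eq_countable)
qed simp

text \<open>All transcripts together form a nested list of natural numbers, an element of a
  countable type, and the records are a function of it. So every property of the records is an
  event.\<close>

lemma estimates_event_sets:
  assumes "0 < \<gamma>"
  shows "{\<omega> \<in> space (sample_law n k F).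
    P (estimates k \<gamma> n (scale_transcript (\<lambda>j. winner k (\<omega> j)) k \<gamma> n) S)} \<in> sets (sample_law n k F)"
proof -
  define W where "W \<omega> = scale_transcript (\<lambda>j. winner k (\<omega> j)) k \<gamma> n" for \<omega>
  define h where "h \<omega> = map (\<lambda>s. map (W \<omega> s) [1..<Suc (scale_thresholds \<gamma> s)]) [0..<S]" for \<omega>
  \<comment> \<open>Recovers the transcripts from the list. Thresholds count from 1, list positions
    from 0.\<close>
  define V where "V hs s q = hs ! s ! (q - 1)" for hs :: "nat list list list" and s q
  have eq: "estimates k \<gamma> n (W \<omega>) S = estimates k \<gamma> n (V (h \<omega>)) S" for \<omega>
    by (rule estimates_cong) (auto simp: V_def h_def simp del: upt_Suc)
  have "h \<in> measurable (sample_law n k F) (count_space UNIV)"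
    unfolding h_def
  proof (intro map_measurable)
    fix s q assume "q \<in> set [1..<Suc (scale_thresholds \<gamma> s)]"
    then have "q \<in> {1..scale_thresholds \<gamma> s}" by auto
    then show "(\<lambda>\<omega>. W \<omega> s q) \<in> measurable (sample_law n k F) (count_space UNIV)"
      unfolding W_def scale_transcript_block by (intro block_measurable block_in_budget assms)
  qed
  then have "h -` {x. P (estimates k \<gamma> n (V x) S)} \<inter> space (sample_law n k F) \<in> sets (sample_law n k F)"
    by (rule measurable_sets) simp
  then show ?thesis unfolding W_def[symmetric] eq by (simp add: vimage_def Int_def conj_commute)
qed

end

section \<open>Numerical verification of the sample size\<close>

lemma half_div_le:
  fixes n d :: nat
  assumes "0 < d" "d \<le> n"
  shows "real n / (2 * real d) \<le> real (n div d)"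
proof -
  have "1 \<le> n div d" using assms by (simp add: div_greater_zero_iff Suc_leI)
  moreover have "n < (n div d + 1) * d" using assms by (simp add: dividend_less_div_times)
  ultimately have "n \<le> 2 * (n div d) * d"
    by (smt (verit) add_mult_distrib le_trans less_imp_le_nat mult.assoc mult_2 mult_le_mono1 add_le_mono1 nat_add_left_cancel_le)
  then have "real n \<le> real (2 * (n div d) * d)" by (rule of_nat_mono)
  then show ?thesis using assms by (simp add: field_simps)
qed

text \<open>\<open>s\<close> is the first scale whose accuracy is at most \<epsilon>, and
  \<open>X\<close> is a common exponent for the blocks of all scales up to \<open>s\<close>. What
  has to be checked is that \<open>X\<close> exceeds the logarithm of the number in front of
  \<open>exp (- X)\<close> divided by \<delta>.\<close>

lemma sample_size_suffices:
  fixes \<gamma> \<epsilon> \<delta> L :: real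
  assumes k: "2 \<le> k" and L: "0 \<le> L" and \<gamma>: "0 < \<gamma>" "\<gamma> \<le> 1" and \<epsilon>: "0 < \<epsilon>" "\<epsilon> \<le> \<gamma> / 2" and \<delta>: "0 < \<delta>" "\<delta> < 1"
    and n: "1000000000000000 * sample_bound k L \<gamma> \<epsilon> \<delta> \<le> real n"
  obtains s X where "128 / (scale_size \<gamma> s * \<gamma>) \<le> \<epsilon>" "s < scales \<gamma> n"
    "\<And>r. r \<le> s \<Longrightarrow> X \<le> scale_samples \<gamma> n r / (100 * real (scale_size \<gamma> r))\<^sup>2"
    "600 * (k * (1 + L)) * (real (scale_size \<gamma> s))\<^sup>2 * exp (- X) \<le> \<delta>"
    "k \<le> n" "base_size \<gamma> \<le> n"
proof -
  define A where "A = ln (real k / (\<gamma>\<^sup>2 * \<epsilon> * \<delta>))"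
  define B where "B = max 1 (ln (L / (\<gamma>\<^sup>2 * \<epsilon>)))"
  define P where "P = real k / (\<gamma> ^ 6 * \<epsilon> ^ 5)"
  have \<epsilon>1: "\<epsilon> \<le> 1 / 2" using \<epsilon> \<gamma> by simp
  have g2: "0 < \<gamma>\<^sup>2" "\<gamma>\<^sup>2 \<le> 1" using \<gamma> by (auto simp: power_le_one)
  have ge: "0 < \<gamma>\<^sup>2 * \<epsilon>" "\<gamma>\<^sup>2 * \<epsilon> \<le> 1 / 2"
    using g2 \<epsilon> \<epsilon>1 mult_mono[of "\<gamma>\<^sup>2" 1 \<epsilon> "1 / 2"] by auto
  have ged: "0 < \<gamma>\<^sup>2 * \<epsilon> * \<delta>" "\<gamma>\<^sup>2 * \<epsilon> * \<delta> \<le> 1 / 2"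
    using ge \<delta> mult_mono[of "\<gamma>\<^sup>2 * \<epsilon>" "1 / 2" \<delta> 1] by auto
  define a where "a = real k / (\<gamma>\<^sup>2 * \<epsilon> * \<delta>)"
  have a: "4 \<le> a"
  proof -
    have "4 * (\<gamma>\<^sup>2 * \<epsilon> * \<delta>) \<le> real k" using ged k by linarith
    then show ?thesis using ged by (simp add: a_def le_divide_eq)
  qed
  have A1: "1 \<le> A" 
  proof -
    have "exp 1 \<le> a" using exp_le a by linarith
    then show ?thesis using a unfolding A_def a_def[symmetric] by (subst ln_ge_iff) auto
  qed
  have B1: "1 \<le> B" by (simp add: B_def)
  have AB1: "1 \<le> A * B" using mult_mono[of 1 A 1 B] A1 B1 by simp
  have pw: "0 < \<gamma> ^ m * \<epsilon> ^ l" for m l using \<gamma> \<epsilon> by simp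
  have pw1: "\<gamma> ^ m \<le> 1" "\<epsilon> ^ m \<le> 1" for m using \<gamma> \<epsilon> \<epsilon>1 by (auto intro: power_le_one)
  have P0: "0 < P" using k pw by (simp add: P_def)
  have nP: "1000000000000000 * (P * (A * B)) \<le> n"
    using n by (simp add: sample_bound_def A_def B_def P_def mult.assoc)
  have "P * 1 \<le> P * (A * B)" using P0 AB1 by (intro mult_left_mono) auto
  then have "1000000000000000 * P \<le> 1000000000000000 * (P * (A * B))" by simp
  then have nP1: "1000000000000000 * P \<le> n" using nP by (rule order_trans)
  have Pge: "real k / (\<gamma> ^ a * \<epsilon> ^ b) \<le> P" if "a \<le> 6" "b \<le> 5" for a b
  proof -
    have "\<gamma> ^ 6 * \<epsilon> ^ 5 \<le> \<gamma> ^ a * \<epsilon> ^ b"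
      using that \<gamma> \<epsilon> \<epsilon>1 by (intro mult_mono power_decreasing) auto
    then show ?thesis unfolding P_def using pw by (intro divide_left_mono) auto
  qed
  have kP: "real k \<le> P" using Pge[of 0 0] by simp
  then have "real k \<le> real n" using nP1 P0 by linarith
  then have kn: "k \<le> n" by simp
  have inv: "1 / (\<gamma> ^ a * \<epsilon> ^ b) \<le> P" if "a \<le> 6" "b \<le> 5" for a b
  proof -
    have "1 / (\<gamma> ^ a * \<epsilon> ^ b) \<le> real k / (\<gamma> ^ a * \<epsilon> ^ b)"
      using k pw by (intro divide_right_mono) (auto simp: less_imp_le)
    then show ?thesis using Pge[OF that] by linarith
  qed
  let ?b = "real (base_size \<gamma>)"
  have b: "128 / \<gamma> \<le> ?b" "?b \<le> 256 / \<gamma>"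
    using base_size(1,2)[OF \<gamma>(1)] \<gamma> by (auto simp: field_simps)
  have b0: "0 < ?b" using base_size(3)[OF \<gamma>(1)] by simp
  have "256 / \<gamma> \<le> 256 * P" using inv[of 1 0] by simp
  then have "?b \<le> real n" using b nP1 P0 by linarith
  then have bn: "base_size \<gamma> \<le> n" by simp
  \<comment> \<open>Since the initial scale lies between 128/\<gamma> and 256/\<gamma>, this places
    the size of scale \<open>s\<close> between 128/(\<gamma> \<epsilon>) and 512/(\<gamma>
    \<epsilon>).\<close>
  define s where "s = (LEAST s::nat. 1 / \<epsilon> \<le> 2 ^ s)"
  obtain s0 :: nat where "1 / \<epsilon> < 2 ^ s0" using real_arch_pow[of 2 "1 / \<epsilon>"] by auto
  then have "1 / \<epsilon> \<le> 2 ^ s0" by simp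
  then have s1: "1 / \<epsilon> \<le> 2 ^ s" unfolding s_def by (rule LeastI)
  have s2: "2 ^ s \<le> 2 / \<epsilon>"
  proof (cases s)
    case 0
    then show ?thesis using \<epsilon> \<epsilon>1 by (simp add: field_simps)
  next
    case (Suc s')
    then have "\<not> 1 / \<epsilon> \<le> 2 ^ s'" using not_less_Least[of s' "\<lambda>s. 1 / \<epsilon> \<le> 2 ^ s"] by (simp add: s_def)
    then show ?thesis using \<epsilon> by (simp add: Suc field_simps)
  qed
  have four: "(4::real) ^ r = (2 ^ r)\<^sup>2" for r 
  proof -
    have "(4::real) ^ r = (2\<^sup>2) ^ r" by simp
    then show ?thesis by (simp only: power_mult[symmetric] mult.commute)
  qed
  have s4: "4 ^ s \<le> 4 / \<epsilon>\<^sup>2"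
    unfolding four using power_mono[OF s2, of 2] by (simp add: power_divide)
  have acc: "128 / (scale_size \<gamma> s * \<gamma>) \<le> \<epsilon>"
  proof -
    have "128 / \<gamma> * (1 / \<epsilon>) \<le> ?b * 2 ^ s" using b b0 s1 \<gamma> \<epsilon> by (intro mult_mono) auto
    then have "128 \<le> \<epsilon> * (?b * 2 ^ s * \<gamma>)" using \<gamma> \<epsilon> by (simp add: field_simps)
    then show ?thesis using b0 \<gamma> by (simp add: scale_size_def pos_divide_le_eq mult.commute)
  qed
  have cost: "scale_cost \<gamma> r \<le> n" if "r \<le> s" for r
  proof -
    have "real (scale_cost \<gamma> r) = 2 * ?b * 4 ^ r" by (simp add: scale_cost_def)
    also have "\<dots> \<le> 2 * (256 / \<gamma>) * (4 / \<epsilon>\<^sup>2)"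
      using b b0 s4 \<gamma> order_trans[OF power_increasing[OF that] s4] by (intro mult_mono) auto
    also have "\<dots> = 2048 * (1 / (\<gamma> ^ 1 * \<epsilon> ^ 2))" by simp
    also have "\<dots> \<le> 2048 * P" using inv[of 1 2] by (intro mult_left_mono) auto
    finally have "real (scale_cost \<gamma> r) \<le> real n" using nP1 P0 by linarith
    then show ?thesis by simp
  qed
  then have sc: "s < scales \<gamma> n" using scales_iff[OF \<gamma>(1)] by blast
  \<comment> \<open>This is 40000 * 256^3 * 4^2, the constant in the bound for 2 *
    \<open>scale_cost\<close> times the square of 100 * \<open>scale_size\<close>. The factor 2
    makes up for rounding in the integer division.\<close>
  define c :: real where "c = 10737418240000"
  define X where "X = real n * (\<gamma> ^ 3 * \<epsilon> ^ 4) / c"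
  have X: "X \<le> scale_samples \<gamma> n r / (100 * real (scale_size \<gamma> r))\<^sup>2" if r: "r \<le> s" for r
  proof -
    have d0: "0 < real (scale_cost \<gamma> r)" "0 < real (scale_size \<gamma> r)"
      using scale_cost_pos[OF \<gamma>(1)] scale_size_pos[OF \<gamma>(1)] by auto
    have r4: "4 ^ r \<le> 4 / \<epsilon>\<^sup>2" by (rule order_trans[OF power_increasing[OF r] s4]) simp
    have "2 * real (scale_cost \<gamma> r) * (100 * real (scale_size \<gamma> r))\<^sup>2 = 40000 * ?b ^ 3 * (4 ^ r)\<^sup>2"
      by (simp add: scale_cost_def scale_size_def four power2_eq_square power3_eq_cube)
    also have "\<dots> \<le> 40000 * (256 / \<gamma>) ^ 3 * (4 / \<epsilon>\<^sup>2)\<^sup>2"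
      using b b0 r4 \<gamma> by (intro mult_mono power_mono) auto
    also have "\<dots> = c / (\<gamma> ^ 3 * \<epsilon> ^ 4)"
      by (simp add: c_def power_divide power_mult[symmetric])
    finally have le: "2 * real (scale_cost \<gamma> r) * (100 * real (scale_size \<gamma> r))\<^sup>2 \<le> c / (\<gamma> ^ 3 * \<epsilon> ^ 4)" .
    have "X = n / (c / (\<gamma> ^ 3 * \<epsilon> ^ 4))" by (simp add: X_def)
    also have "\<dots> \<le> n / (2 * real (scale_cost \<gamma> r) * (100 * real (scale_size \<gamma> r))\<^sup>2)"
      using le d0 by (intro divide_left_mono) (auto simp: c_def intro!: mult_pos_pos divide_pos_pos pw)
    also have "\<dots> = n / (2 * real (scale_cost \<gamma> r)) / (100 * real (scale_size \<gamma> r))\<^sup>2" by simp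
    also have "\<dots> \<le> scale_samples \<gamma> n r / (100 * real (scale_size \<gamma> r))\<^sup>2"
      unfolding scale_samples_def
      using half_div_le[of "scale_cost \<gamma> r" n] cost[OF r] scale_cost_pos[OF \<gamma>(1)]
      by (intro divide_right_mono) auto
    finally show ?thesis .
  qed
  \<comment> \<open>The constant in the sample size exceeds 32 \<open>c\<close>, and
    \<open>P\<close> times \<open>\<gamma> ^ 3 * \<epsilon> ^ 4\<close> is
    \<open>k / (\<gamma> ^ 3 * \<epsilon>)\<close>, which is at least 1.\<close>
  have X90: "32 * (A * B) \<le> X"
  proof -
    have "c * (32 * (A * B)) \<le> 1000000000000000 * (A * B)" using AB1 by (simp add: c_def)
    also have "\<dots> \<le> 1000000000000000 * (P * (\<gamma> ^ 3 * \<epsilon> ^ 4) * (A * B))"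
    proof -
      have "P * (\<gamma> ^ 3 * \<epsilon> ^ 4) = real k / (\<gamma> ^ 3 * \<epsilon>)"
        using \<gamma> \<epsilon> by (simp add: P_def field_simps eval_nat_numeral)
      moreover have "\<gamma> ^ 3 * \<epsilon> \<le> 1" using pw1(1)[of 3] \<epsilon> \<epsilon>1 \<gamma> mult_mono[of "\<gamma> ^ 3" 1 \<epsilon> 1] by simp
      then have "1 \<le> real k / (\<gamma> ^ 3 * \<epsilon>)" using k \<gamma> \<epsilon> by (simp add: le_divide_eq)
      ultimately have "1 * (A * B) \<le> P * (\<gamma> ^ 3 * \<epsilon> ^ 4) * (A * B)" using AB1 by (intro mult_right_mono) auto
      then show ?thesis by simp
    qed
    also have "\<dots> = 1000000000000000 * (P * (A * B)) * (\<gamma> ^ 3 * \<epsilon> ^ 4)" by simp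
    also have "\<dots> \<le> n * (\<gamma> ^ 3 * \<epsilon> ^ 4)" using nP pw[of 3 4] by (intro mult_right_mono) auto
    finally show ?thesis by (simp add: X_def c_def)
  qed
  have "600 * (k * (1 + L)) * (real (scale_size \<gamma> s))\<^sup>2 / \<delta> \<le> exp X"
  proof -
    have M: "real (scale_size \<gamma> s) \<le> 512 / (\<gamma> * \<epsilon>)"
    proof -
      have "?b * 2 ^ s \<le> 256 / \<gamma> * (2 / \<epsilon>)" using b b0 s2 \<gamma> by (intro mult_mono) auto
      then show ?thesis by (simp add: scale_size_def)
    qed
    have "(real (scale_size \<gamma> s))\<^sup>2 \<le> (512 / (\<gamma> * \<epsilon>))\<^sup>2" by (intro power_mono M) simp
    then have "600 * (k * (1 + L)) * (real (scale_size \<gamma> s))\<^sup>2 / \<delta> \<le> 600 * (k * (1 + L)) * (512 / (\<gamma> * \<epsilon>))\<^sup>2 / \<delta>"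
      using L \<delta> by (intro divide_right_mono mult_left_mono) auto
    also have "\<dots> = 157286400 * (real k / (\<gamma>\<^sup>2 * \<epsilon>\<^sup>2 * \<delta>)) * (1 + L)"
      by (simp add: power_divide power_mult_distrib)
    \<comment> \<open>The three factors are bounded separately: 600 * 512^2 = 157286400 is below
      2^28, the second one is at most the square of the argument of the logarithm \<open>A\<close>,
      and 1 + L is at most e times exp \<open>B\<close>.\<close>
    also have "\<dots> \<le> exp 28 * exp (2 * A) * exp (1 + B)"
    proof (intro mult_mono)
      have "(2::real) ^ 28 \<le> exp 1 ^ 28" using exp_ge_add_one_self[of "1::real"] by (intro power_mono) auto
      also have "exp 1 ^ 28 = exp (28::real)" by (simp flip: exp_of_nat_mult)
      finally show "157286400 \<le> exp (28::real)" by simp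
      have "real k / (\<gamma>\<^sup>2 * \<epsilon>\<^sup>2 * \<delta>) \<le> a\<^sup>2"
      proof -
        have "real k * (\<gamma>\<^sup>2 * \<delta>) \<le> real k * real k"
          using k g2 \<delta> mult_mono[of "\<gamma>\<^sup>2" 1 \<delta> 1] by (intro mult_left_mono) auto
        then have "real k * (\<gamma>\<^sup>2 * \<delta>) / ((\<gamma>\<^sup>2 * \<epsilon> * \<delta>)\<^sup>2) \<le> real k * real k / ((\<gamma>\<^sup>2 * \<epsilon> * \<delta>)\<^sup>2)"
          by (intro divide_right_mono) auto
        moreover have "real k * (\<gamma>\<^sup>2 * \<delta>) / ((\<gamma>\<^sup>2 * \<epsilon> * \<delta>)\<^sup>2) = real k / (\<gamma>\<^sup>2 * \<epsilon>\<^sup>2 * \<delta>)"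
          using \<gamma> \<delta> \<epsilon> by (simp add: power2_eq_square)
        ultimately show ?thesis by (simp add: a_def power_divide power2_eq_square)
      qed
      also have "a\<^sup>2 = exp (2 * A)"
        using a unfolding A_def a_def[symmetric] by (simp add: exp_double)
      finally show "real k / (\<gamma>\<^sup>2 * \<epsilon>\<^sup>2 * \<delta>) \<le> exp (2 * A)" .
      have e1: "2 \<le> exp (1::real)" using exp_ge_add_one_self[of "1::real"] by simp
      show "1 + L \<le> exp (1 + B)"
      proof (cases "L \<le> 1")
        case True
        then have "1 + L \<le> exp 1" using e1 by simp
        also have "\<dots> \<le> exp (1 + B)" using B1 by simp
        finally show ?thesis .
      next
        case False
        have "L * (\<gamma>\<^sup>2 * \<epsilon>) \<le> L * 1" using L ge by (intro mult_left_mono) auto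
        then have "L \<le> L / (\<gamma>\<^sup>2 * \<epsilon>)" using ge by (simp add: le_divide_eq)
        also have "\<dots> = exp (ln (L / (\<gamma>\<^sup>2 * \<epsilon>)))" using False ge by simp
        also have "\<dots> \<le> exp B" by (simp add: B_def)
        finally have "2 * L \<le> exp 1 * exp B" using e1 L by (intro mult_mono) auto
        then show ?thesis using False by (simp add: exp_add)
      qed
    qed (use L k g2 \<epsilon> \<delta> in auto)
    also have "\<dots> = exp (28 + 2 * A + (1 + B))" by (simp only: exp_add)
    also have "\<dots> \<le> exp X"
    proof -
      \<comment> \<open>Each of 1, \<open>A\<close> and \<open>B\<close> is at most
        \<open>A * B\<close>, so the exponent 29 + 2 A + B is at most 32 A B.\<close>
      have "A \<le> A * B" "B \<le> A * B" using A1 B1 mult_left_mono[of 1 B A] mult_right_mono[of 1 A B] by auto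
      then have "28 + 2 * A + (1 + B) \<le> X" using X90 AB1 by linarith
      then show ?thesis by simp
    qed
    finally show ?thesis .
  qed
  then have "600 * (k * (1 + L)) * (real (scale_size \<gamma> s))\<^sup>2 * exp (- X) \<le> \<delta>"
    using \<delta> by (simp add: exp_minus field_simps)
  then show ?thesis using that acc sc X kn bn by blast
qed

lemma time_bound_poly: "B \<le> n \<Longrightarrow> time_bound n B \<le> poly [:30, 31, 32, 35, 11:] n"
  by (simp add: time_bound_def algebra_simps)

theorem theorem2p9:
  shows "\<exists>(C::real) > 0. \<exists>(alg::com) (q::nat poly).
    \<forall>(k::nat) (n::nat) (L::real) (F::nat \<Rightarrow> real \<Rightarrow> real) (p::real) (\<gamma>::real).
      2 \<le> k \<longrightarrow>
      (\<forall>i\<in>{1..k}. is_cdf (F i) \<and> continuous_on UNIV (F i) \<and> supported_unit (F i) \<and>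
                   lipschitz_density L (F i)) \<longrightarrow>
      p \<in> {0..1} \<longrightarrow> \<gamma> \<in> {0..1} \<longrightarrow>
      measure (bid_law k F) {X \<in> space (bid_law k F). \<forall>i\<in>{1..k}. X i \<le> p} \<ge> \<gamma> \<longrightarrow>
      (\<exists>Fhat :: (nat \<Rightarrow> nat \<Rightarrow> real) \<Rightarrow> nat \<Rightarrow> real \<Rightarrow> real.
        \<forall>\<epsilon>\<in>{0<..\<gamma> / 2}. \<forall>\<delta>\<in>{0<..<1}.
          real n \<ge> C * sample_bound k L \<gamma> \<epsilon> \<delta> \<longrightarrow>
            (\<forall>\<omega>\<in>space (sample_law n k F).
               computes_cdfs alg (poly q n) n k L p \<gamma> \<omega> (Fhat \<omega>)) \<and>
            (\<forall>i\<in>{1..k}.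
               measure (sample_law n k F)
                 {\<omega> \<in> space (sample_law n k F). \<forall>x\<in>{p..1}. \<bar>Fhat \<omega> i x - F i x\<bar> \<le> \<epsilon>} \<ge> 1 - \<delta>))"
proof (intro exI[of _ "1000000000000000::real"] exI[of _ estimator] exI[of _ "[:30, 31, 32, 35, 11:]"]
    conjI allI impI)
  fix k n :: nat and L :: real and F :: "nat \<Rightarrow> real \<Rightarrow> real" and p \<gamma> :: real
  assume k: "2 \<le> k"
    and marginals: "\<forall>i\<in>{1..k}. is_cdf (F i) \<and> continuous_on UNIV (F i) \<and> supported_unit (F i) \<and>
                   lipschitz_density L (F i)"
    and p: "p \<in> {0..1}" and \<gamma>01: "\<gamma> \<in> {0..1}"
    and low: "\<gamma> \<le> measure (bid_law k F) {X \<in> space (bid_law k F). \<forall>i\<in>{1..k}. X i \<le> p}"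
  interpret auction k L F using k marginals by unfold_locales
  define es where "es \<omega> = estimates k \<gamma> n (scale_transcript (\<lambda>j. winner k (\<omega> j)) k \<gamma> n) (scales \<gamma> n)" for \<omega>
  show "\<exists>Fhat. \<forall>\<epsilon>\<in>{0<..\<gamma> / 2}. \<forall>\<delta>\<in>{0<..<1}.
          1000000000000000 * sample_bound k L \<gamma> \<epsilon> \<delta> \<le> real n \<longrightarrow>
            (\<forall>\<omega>\<in>space (sample_law n k F).
               computes_cdfs estimator (poly [:30, 31, 32, 35, 11:] n) n k L p \<gamma> \<omega> (Fhat \<omega>)) \<and>
            (\<forall>i\<in>{1..k}. 1 - \<delta> \<le>
               measure (sample_law n k F)
                 {\<omega> \<in> space (sample_law n k F). \<forall>x\<in>{p..1}. \<bar>Fhat \<omega> i x - F i x\<bar> \<le> \<epsilon>})"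
  \<comment> \<open>The witness is fixed before \<epsilon> and \<delta> are introduced: the output
    depends on neither.\<close>
  proof (intro exI[of _ "\<lambda>\<omega>. final_estimate n (es \<omega>)"] ballI impI conjI)
    fix \<epsilon> \<delta> :: real
    assume \<epsilon>: "\<epsilon> \<in> {0<..\<gamma> / 2}" and \<delta>: "\<delta> \<in> {0<..<1}"
      and n: "1000000000000000 * sample_bound k L \<gamma> \<epsilon> \<delta> \<le> real n"
    \<comment> \<open>For \<gamma> = 0 there is no admissible \<epsilon>.\<close>
    have \<gamma>: "0 < \<gamma>" "\<gamma> \<le> 1" using \<epsilon> \<gamma>01 by auto
    \<comment> \<open>The bounds of \<open>k\<close> and of the initial scale by \<open>n\<close>
      make the running time a polynomial in \<open>n\<close> alone.\<close>
    obtain s X where acc: "128 / (scale_size \<gamma> s * \<gamma>) \<le> \<epsilon>" and s: "s < scales \<gamma> n"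
      and X: "\<And>r. r \<le> s \<Longrightarrow> X \<le> scale_samples \<gamma> n r / (100 * real (scale_size \<gamma> r))\<^sup>2"
        "600 * (k * (1 + L)) * (real (scale_size \<gamma> s))\<^sup>2 * exp (- X) \<le> \<delta>"
      and kn: "k \<le> n" and bn: "base_size \<gamma> \<le> n"
      by (rule sample_size_suffices[OF k L_nonneg \<gamma> _ _ _ _ n]) (use \<epsilon> \<delta> in auto)
    show "computes_cdfs estimator (poly [:30, 31, 32, 35, 11:] n) n k L p \<gamma> \<omega> (final_estimate n (es \<omega>))" for \<omega>
    proof -
      obtain t st where run: "exec n (\<lambda>j. winner k (\<omega> j)) estimator (input_state k n L p \<gamma>) t st"
        "t \<le> time_bound n (base_size \<gamma>)" "\<forall>i\<in>{1..k}. output_fun st i = final_estimate n (es \<omega>) i"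
        using runs_estimator[OF \<gamma>(1) kn, of "\<lambda>j. winner k (\<omega> j)" L p] unfolding es_def by blast
      have "t \<le> poly [:30, 31, 32, 35, 11:] n" using run(2) time_bound_poly[OF bn] by (rule order_trans)
      moreover have "is_cdf (final_estimate n (es \<omega>) i)" for i
        unfolding es_def by (rule final_estimate_is_cdf[OF \<gamma>(1)])
      ultimately show ?thesis unfolding computes_cdfs_def
        using run(1,3) by (intro exI[of _ t] exI[of _ st]) simp
    qed
    fix i assume i: "i \<in> {1..k}"
    interpret S: prob_space "sample_law n k F" by (rule sample_prob_space)
    let ?G = "{\<omega> \<in> space (sample_law n k F). \<forall>x\<in>{p..1}. \<bar>final_estimate n (es \<omega>) i x - F i x\<bar> \<le> \<epsilon>}"
    \<comment> \<open>The exceptional event depends on \<open>i\<close>, because a good scale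
      controls the wins of one agent; the claim is made for each agent separately.\<close>
    obtain E where E: "E \<in> S.events" "S.prob E \<le> \<delta>"
      "\<And>\<omega> r. \<omega> \<in> space (sample_law n k F) - E \<Longrightarrow> r \<le> s \<Longrightarrow>
         good_scale i \<gamma> n (scale_transcript (\<lambda>j. winner k (\<omega> j)) k \<gamma> n r) r"
      using good_scales_prob[OF i \<gamma> X] by blast
    have G: "?G \<in> S.events"
      unfolding es_def
      by (rule estimates_event_sets[OF \<gamma>(1), where P = "\<lambda>es. \<forall>x\<in>{p..1}. \<bar>final_estimate n es i x - F i x\<bar> \<le> \<epsilon>"])
    have "space (sample_law n k F) - E \<subseteq> ?G"
    proof (intro subsetI CollectI conjI ballI)
      fix \<omega> x assume \<omega>: "\<omega> \<in> space (sample_law n k F) - E" and x: "x \<in> {p..1}"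
      have "\<gamma> \<le> H p" using low H_le_p by simp
      also have "\<dots> \<le> H x" using x by (intro H_unit) auto
      finally have "\<gamma> \<le> H x" .
      then have "\<bar>final_estimate n (es \<omega>) i x - F i x\<bar> \<le> 128 / (scale_size \<gamma> s * \<gamma>)"
        unfolding es_def using E(3)[OF \<omega>] p x
        by (intro final_estimate_accurate[OF i \<gamma> s]) auto
      then show "\<bar>final_estimate n (es \<omega>) i x - F i x\<bar> \<le> \<epsilon>" using acc by linarith
    qed auto
    then have "S.prob (space (sample_law n k F) - E) \<le> S.prob ?G"
      using G by (rule S.finite_measure_mono)
    then show "1 - \<delta> \<le> S.prob ?G" using S.prob_compl[OF E(1)] E(2) by linarith
  qed
qed simp

end
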